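(* Let $\mathfrak g=\mathfrak{sl}_{l+1}(\Bbbk)$, $l\ge1$, and let $\vartheta$ be an inner automorphism of $\mathfrak g$ of finite order. Then $\mathfrak g_{(0)}$ is a parabolic contraction of $\mathfrak g$ and $\operatorname{ind}\mathfrak g_{(0)}=\operatorname{ind}\mathfrak g=l$.
   Context: $\Bbbk$ is an algebraically closed field of characteristic $0$. The index $\operatorname{ind}\mathfrak q$ of a Lie algebra $\mathfrak q$ is the minimal dimension of the stabilisers $\mathfrak q^\xi$, $\xi\in\mathfrak q^*$, for the coadjoint representation. Periodic contraction. Let $\vartheta$ be an automorphism of $\mathfrak g$ of order $m$, $\zeta$ a fixed primitive $m$-th root of unity, and $\mathfrak g=\bigoplus_{i=0}^{m-1}\mathfrak g_i$, where $\mathfrak g_i$ is the $\zeta^i$-eigenspace of $\vartheta$. The $\vartheta$-contraction $\mathfrak g_{(0)}$ is the vector space $\mathfrak g$ with the Lie bracket $[\ ,\,]_{(0)}$ defined for $x\in\mathfrak g_i$, $y\in\mathfrak g_j$ ($0\le i,j\le m-1$) by $[x,y]_{(0)}=[x,y]$ if $i+j\le m-1$ and $[x,y]_{(0)}=0$ if $i+j>m-1$. Parabolic contraction. A parabolic contraction of $\mathfrak g$ is a Lie algebra (isomorphic to one) of the form $\mathfrak p\ltimes(\mathfrak n^-)^{\sf ab}$, where $\mathfrak p\subset\mathfrak g$ is a parabolic subalgebra, $\mathfrak n^-$ is the nilradical of an opposite parabolic subalgebra (so $\mathfrak g=\mathfrak p\oplus\mathfrak n^-$), and the $\mathfrak p$-module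 $\mathfrak n^-\simeq\mathfrak g/\mathfrak p$ is an abelian ideal of the semi-direct product. *)

theory Defs
  imports "HOL-Analysis.Analysis"
begin

text \<open>
  A Lie algebra is a subspace of an ambient vector space together with a bracket. The operations
  are total functions on the ambient type, but only their values on the carrier matter.
\<close>

record ('k, 'v) lie_struct =
  lcarrier :: "'v set"
  lscale :: "'k \<Rightarrow> 'v \<Rightarrow> 'v"
  lbracket :: "'v \<Rightarrow> 'v \<Rightarrow> 'v"

locale lie_algebra =
  fixes L :: "('k::field, 'v::ab_group_add) lie_struct"
  assumes vector_space: "vector_space (lscale L)"
    and subspace: "module.subspace (lscale L) (lcarrier L)"
    and closed: "\<lbrakk>x \<in> lcarrier L; y \<in> lcarrier L\<rbrakk> \<Longrightarrow> lbracket L x y \<in> lcarrier L"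
    and add_left: "\<lbrakk>x \<in> lcarrier L; y \<in> lcarrier L; z \<in> lcarrier L\<rbrakk>
      \<Longrightarrow> lbracket L (x + y) z = lbracket L x z + lbracket L y z"
    and add_right: "\<lbrakk>x \<in> lcarrier L; y \<in> lcarrier L; z \<in> lcarrier L\<rbrakk>
      \<Longrightarrow> lbracket L x (y + z) = lbracket L x y + lbracket L x z"
    and scale_left: "\<lbrakk>x \<in> lcarrier L; y \<in> lcarrier L\<rbrakk>
      \<Longrightarrow> lbracket L (lscale L c x) y = lscale L c (lbracket L x y)"
    and scale_right: "\<lbrakk>x \<in> lcarrier L; y \<in> lcarrier L\<rbrakk>
      \<Longrightarrow> lbracket L x (lscale L c y) = lscale L c (lbracket L x y)"
    and alternating: "x \<in> lcarrier L \<Longrightarrow> lbracket L x x = 0"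
    and jacobi: "\<lbrakk>x \<in> lcarrier L; y \<in> lcarrier L; z \<in> lcarrier L\<rbrakk>
      \<Longrightarrow> lbracket L x (lbracket L y z) + lbracket L y (lbracket L z x)
          + lbracket L z (lbracket L x y) = 0"

definition lie_iso ::
  "('k::field, 'v::ab_group_add) lie_struct \<Rightarrow> ('k, 'w::ab_group_add) lie_struct \<Rightarrow> ('v \<Rightarrow> 'w) \<Rightarrow> bool"
  where "lie_iso L M f \<longleftrightarrow>
    bij_betw f (lcarrier L) (lcarrier M)
    \<and> (\<forall>x\<in>lcarrier L. \<forall>y\<in>lcarrier L. f (x + y) = f x + f y)
    \<and> (\<forall>c. \<forall>x\<in>lcarrier L. f (lscale L c x) = lscale M c (f x))
    \<and> (\<forall>x\<in>lcarrier L. \<forall>y\<in>lcarrier L. f (lbracket L x y) = lbracket M (f x) (f y))"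

subsection \<open>Index\<close>

definition dual_space :: "('k::field, 'v::ab_group_add) lie_struct \<Rightarrow> ('v \<Rightarrow> 'k) set"
  where "dual_space L = {\<xi>.
    (\<forall>x\<in>lcarrier L. \<forall>y\<in>lcarrier L. \<xi> (x + y) = \<xi> x + \<xi> y)
    \<and> (\<forall>c. \<forall>x\<in>lcarrier L. \<xi> (lscale L c x) = c * \<xi> x)}"

definition coadjoint :: "('k::field, 'v::ab_group_add) lie_struct \<Rightarrow> 'v \<Rightarrow> ('v \<Rightarrow> 'k) \<Rightarrow> 'v \<Rightarrow> 'k"
  where "coadjoint L x \<xi> = (\<lambda>y. - \<xi> (lbracket L x y))"

definition coadjoint_stabiliser ::
  "('k::field, 'v::ab_group_add) lie_struct \<Rightarrow> ('v \<Rightarrow> 'k) \<Rightarrow> 'v set"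
  where "coadjoint_stabiliser L \<xi> = {x \<in> lcarrier L. \<forall>y\<in>lcarrier L. coadjoint L x \<xi> y = 0}"

definition lie_index :: "('k::field, 'v::ab_group_add) lie_struct \<Rightarrow> nat"
  where "lie_index L =
    (INF \<xi>\<in>dual_space L. vector_space.dim (lscale L) (coadjoint_stabiliser L \<xi>))"

subsection \<open>Subalgebras and ideals\<close>

definition lie_subalgebra :: "('k::field, 'v::ab_group_add) lie_struct \<Rightarrow> 'v set \<Rightarrow> bool"
  where "lie_subalgebra L H \<longleftrightarrow>
    H \<subseteq> lcarrier L \<and> module.subspace (lscale L) H \<and> (\<forall>x\<in>H. \<forall>y\<in>H. lbracket L x y \<in> H)"

definition lie_restrict ::
  "('k::field, 'v::ab_group_add) lie_struct \<Rightarrow> 'v set \<Rightarrow> ('k, 'v) lie_struct"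
  where "lie_restrict L H = L\<lparr>lcarrier := H\<rparr>"

definition lie_ideal :: "('k::field, 'v::ab_group_add) lie_struct \<Rightarrow> 'v set \<Rightarrow> bool"
  where "lie_ideal L I \<longleftrightarrow>
    I \<subseteq> lcarrier L \<and> module.subspace (lscale L) I \<and> (\<forall>x\<in>lcarrier L. \<forall>y\<in>I. lbracket L x y \<in> I)"

definition bracket_span ::
  "('k::field, 'v::ab_group_add) lie_struct \<Rightarrow> 'v set \<Rightarrow> 'v set \<Rightarrow> 'v set"
  where "bracket_span L A B = module.span (lscale L) {lbracket L x y | x y. x \<in> A \<and> y \<in> B}"

fun derived_series :: "('k::field, 'v::ab_group_add) lie_struct \<Rightarrow> nat \<Rightarrow> 'v set"
  where
    "derived_series L 0 = lcarrier L"
  | "derived_series L (Suc n) = bracket_span L (derived_series L n) (derived_series L n)"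

fun lower_central_series :: "('k::field, 'v::ab_group_add) lie_struct \<Rightarrow> nat \<Rightarrow> 'v set"
  where
    "lower_central_series L 0 = lcarrier L"
  | "lower_central_series L (Suc n) = bracket_span L (lcarrier L) (lower_central_series L n)"

definition lie_solvable :: "('k::field, 'v::ab_group_add) lie_struct \<Rightarrow> bool"
  where "lie_solvable L \<longleftrightarrow> (\<exists>n. derived_series L n = {0})"

definition lie_nilpotent :: "('k::field, 'v::ab_group_add) lie_struct \<Rightarrow> bool"
  where "lie_nilpotent L \<longleftrightarrow> (\<exists>n. lower_central_series L n = {0})"

definition is_nilradical :: "('k::field, 'v::ab_group_add) lie_struct \<Rightarrow> 'v set \<Rightarrow> bool"
  where "is_nilradical L N \<longleftrightarrow>
    lie_ideal L N \<and> lie_nilpotent (lie_restrict L N)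
    \<and> (\<forall>I. lie_ideal L I \<and> lie_nilpotent (lie_restrict L I) \<longrightarrow> I \<subseteq> N)"

subsection \<open>Parabolic subalgebras and parabolic contractions\<close>

definition borel_subalgebra :: "('k::field, 'v::ab_group_add) lie_struct \<Rightarrow> 'v set \<Rightarrow> bool"
  where "borel_subalgebra L B \<longleftrightarrow>
    lie_subalgebra L B \<and> lie_solvable (lie_restrict L B)
    \<and> (\<forall>H. lie_subalgebra L H \<and> lie_solvable (lie_restrict L H) \<and> B \<subseteq> H \<longrightarrow> H = B)"

definition parabolic_subalgebra :: "('k::field, 'v::ab_group_add) lie_struct \<Rightarrow> 'v set \<Rightarrow> bool"
  where "parabolic_subalgebra L P \<longleftrightarrow>
    lie_subalgebra L P \<and> (\<exists>B. borel_subalgebra L B \<and> B \<subseteq> P)"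

text \<open>
  For a parabolic subalgebra of a semisimple Lie algebra in characteristic zero, the Levi
  subalgebras are exactly the subalgebras complementary to the nilradical; such a complement is
  automatically reductive, being isomorphic to the quotient by the nilradical.
\<close>

definition levi_of_parabolic ::
  "('k::field, 'v::ab_group_add) lie_struct \<Rightarrow> 'v set \<Rightarrow> 'v set \<Rightarrow> bool"
  where "levi_of_parabolic L P M \<longleftrightarrow>
    lie_subalgebra L M \<and> M \<subseteq> P
    \<and> (\<exists>N. is_nilradical (lie_restrict L P) N \<and> M \<inter> N = {0} \<and> P = {x + u | x u. x \<in> M \<and> u \<in> N})"

definition opposite_parabolics ::
  "('k::field, 'v::ab_group_add) lie_struct \<Rightarrow> 'v set \<Rightarrow> 'v set \<Rightarrow> bool"
  where "opposite_parabolics L P Q \<longleftrightarrow>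
    parabolic_subalgebra L P \<and> parabolic_subalgebra L Q
    \<and> levi_of_parabolic L P (P \<inter> Q) \<and> levi_of_parabolic L Q (P \<inter> Q)"

text \<open>
  If the carrier of \<open>L\<close> is the direct sum of \<open>P\<close> and \<open>N\<close>, then \<open>proj_along P N\<close> is the projection
  onto \<open>N\<close> with kernel \<open>P\<close>; it identifies \<open>N\<close> with the quotient of \<open>L\<close> by \<open>P\<close>. The action of
  \<open>x \<in> P\<close> on the quotient thereby becomes \<open>u \<mapsto> proj_along P N [x, u]\<close> on \<open>N\<close>.
\<close>

definition proj_along :: "'v::ab_group_add set \<Rightarrow> 'v set \<Rightarrow> 'v \<Rightarrow> 'v"
  where "proj_along P N z = (THE u. u \<in> N \<and> z - u \<in> P)"

definition parabolic_semidirect ::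
  "('k::field, 'v::ab_group_add) lie_struct \<Rightarrow> 'v set \<Rightarrow> 'v set \<Rightarrow> ('k, 'v \<times> 'v) lie_struct"
  where "parabolic_semidirect L P N = \<lparr>
    lcarrier = P \<times> N,
    lscale = (\<lambda>c (x, u). (lscale L c x, lscale L c u)),
    lbracket = (\<lambda>(x, u) (y, v).
      (lbracket L x y, proj_along P N (lbracket L x v) - proj_along P N (lbracket L y u)))\<rparr>"

definition is_parabolic_contraction ::
  "('k::field, 'v::ab_group_add) lie_struct \<Rightarrow> ('k, 'w::ab_group_add) lie_struct \<Rightarrow> bool"
  where "is_parabolic_contraction L Q \<longleftrightarrow>
    lie_algebra Q
    \<and> (\<exists>P P' N f. opposite_parabolics L P P' \<and> is_nilradical (lie_restrict L P') N
        \<and> lie_iso (parabolic_semidirect L P N) Q f)"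

subsection \<open>Automorphisms and periodic contractions\<close>

definition lie_automorphism :: "('k::field, 'v::ab_group_add) lie_struct \<Rightarrow> ('v \<Rightarrow> 'v) \<Rightarrow> bool"
  where "lie_automorphism L \<phi> \<longleftrightarrow> lie_iso L L \<phi>"

definition ad_nilpotent :: "('k::field, 'v::ab_group_add) lie_struct \<Rightarrow> 'v \<Rightarrow> bool"
  where "ad_nilpotent L x \<longleftrightarrow> (\<exists>n. \<forall>y\<in>lcarrier L. (lbracket L x ^^ n) y = 0)"

text \<open>The exponential series of \<open>ad x\<close>, for \<open>ad x\<close> nilpotent; then the sum is finite.\<close>

definition exp_ad :: "('k::field_char_0, 'v::ab_group_add) lie_struct \<Rightarrow> 'v \<Rightarrow> 'v \<Rightarrow> 'v"
  where "exp_ad L x y =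
    (\<Sum>k | (lbracket L x ^^ k) y \<noteq> 0. lscale L (1 / fact k) ((lbracket L x ^^ k) y))"

text \<open>
  The group of inner automorphisms is generated by the \<open>exp (ad x)\<close> with \<open>ad x\<close> nilpotent. This
  set of generators is closed under inverses (replace \<open>x\<close> by \<open>-x\<close>), so products suffice. Maps
  are identified when they agree on the carrier.
\<close>

inductive inner_group ::
  "('k::field_char_0, 'v::ab_group_add) lie_struct \<Rightarrow> ('v \<Rightarrow> 'v) \<Rightarrow> bool" for L
  where
    one: "(\<And>y. y \<in> lcarrier L \<Longrightarrow> \<phi> y = y) \<Longrightarrow> inner_group L \<phi>"
  | step: "\<lbrakk>inner_group L \<psi>; x \<in> lcarrier L; ad_nilpotent L x;
      \<And>y. y \<in> lcarrier L \<Longrightarrow> \<phi> y = exp_ad L x (\<psi> y)\<rbrakk> \<Longrightarrow> inner_group L \<phi>"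

definition inner_automorphism ::
  "('k::field_char_0, 'v::ab_group_add) lie_struct \<Rightarrow> ('v \<Rightarrow> 'v) \<Rightarrow> bool"
  where "inner_automorphism L \<phi> \<longleftrightarrow> lie_automorphism L \<phi> \<and> inner_group L \<phi>"

definition has_order :: "('k::field, 'v::ab_group_add) lie_struct \<Rightarrow> ('v \<Rightarrow> 'v) \<Rightarrow> nat \<Rightarrow> bool"
  where "has_order L \<phi> m \<longleftrightarrow>
    m > 0 \<and> (\<forall>x\<in>lcarrier L. (\<phi> ^^ m) x = x)
    \<and> (\<forall>k. 0 < k \<and> k < m \<longrightarrow> (\<exists>x\<in>lcarrier L. (\<phi> ^^ k) x \<noteq> x))"

definition primitive_root_of_unity :: "nat \<Rightarrow> 'k::field \<Rightarrow> bool"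
  where "primitive_root_of_unity m \<zeta> \<longleftrightarrow> m > 0 \<and> \<zeta> ^ m = 1 \<and> (\<forall>k. 0 < k \<and> k < m \<longrightarrow> \<zeta> ^ k \<noteq> 1)"

definition eigen_part ::
  "('k::field, 'v::ab_group_add) lie_struct \<Rightarrow> ('v \<Rightarrow> 'v) \<Rightarrow> 'k \<Rightarrow> nat \<Rightarrow> 'v set"
  where "eigen_part L \<phi> \<zeta> i = {x \<in> lcarrier L. \<phi> x = lscale L (\<zeta> ^ i) x}"

text \<open>
  \<open>eigen_components L \<phi> \<zeta> m x i\<close> is the component of \<open>x\<close> in \<open>eigen_part L \<phi> \<zeta> i\<close>, for \<open>i < m\<close>.
  It is meaningful when the carrier is the direct sum of these parts, as is the case for an
  automorphism of order \<open>m\<close> and a primitive \<open>m\<close>-th root of unity \<open>\<zeta>\<close>.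
\<close>

definition eigen_components ::
  "('k::field, 'v::ab_group_add) lie_struct \<Rightarrow> ('v \<Rightarrow> 'v) \<Rightarrow> 'k \<Rightarrow> nat \<Rightarrow> 'v \<Rightarrow> nat \<Rightarrow> 'v"
  where "eigen_components L \<phi> \<zeta> m x =
    (THE c. (\<forall>i<m. c i \<in> eigen_part L \<phi> \<zeta> i) \<and> (\<forall>i\<ge>m. c i = 0) \<and> (\<Sum>i<m. c i) = x)"

definition periodic_contraction ::
  "('k::field, 'v::ab_group_add) lie_struct \<Rightarrow> ('v \<Rightarrow> 'v) \<Rightarrow> 'k \<Rightarrow> nat \<Rightarrow> ('k, 'v) lie_struct"
  where "periodic_contraction L \<phi> \<zeta> m = L\<lparr>lbracket := (\<lambda>x y.
    \<Sum>i<m. \<Sum>j<m. if i + j \<le> m - 1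
      then lbracket L (eigen_components L \<phi> \<zeta> m x i) (eigen_components L \<phi> \<zeta> m y j)
      else 0)\<rparr>"

lemma eigen_parts_independent:
  assumes L: "lie_algebra L" and aut: "lie_automorphism L \<phi>"
    and prim: "primitive_root_of_unity m \<zeta>"
    and "n \<le> m" and "\<And>i. i < n \<Longrightarrow> e i \<in> eigen_part L \<phi> \<zeta> i" and "(\<Sum>i<n. e i) = 0" and "i < n"
  shows "e i = 0"
  using assms(4-)
proof (induction n arbitrary: e i)
  case 0
  then show ?case by simp
next
  case (Suc n)
  interpret lie_algebra L by (rule L)
  interpret V: vector_space "lscale L" by (rule vector_space)
  have zero: "0 \<in> lcarrier L" using subspace by (rule V.subspace_0)
  have add: "\<phi> (x + y) = \<phi> x + \<phi> y" if "x \<in> lcarrier L" "y \<in> lcarrier L" for x y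
    using aut that by (auto simp: lie_automorphism_def lie_iso_def)
  have scale: "\<phi> (lscale L c x) = lscale L c (\<phi> x)" if "x \<in> lcarrier L" for c x
    using aut that by (auto simp: lie_automorphism_def lie_iso_def)
  have phi0: "\<phi> 0 = 0" using add[OF zero zero] by simp
  have mem: "e i \<in> lcarrier L" "\<phi> (e i) = lscale L (\<zeta> ^ i) (e i)" if "i < Suc n" for i
    using Suc.prems(2)[OF that] by (auto simp: eigen_part_def)
  have phi_sum: "\<phi> (\<Sum>i<k. e i) = (\<Sum>i<k. lscale L (\<zeta> ^ i) (e i))" if "k \<le> Suc n" for k
    using that
  proof (induction k)
    case 0
    then show ?case by (simp add: phi0)
  next
    case (Suc k)
    have "(\<Sum>i<k. e i) \<in> lcarrier L"
      using Suc.prems mem by (intro V.subspace_sum[OF subspace]) auto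
    then show ?case using Suc mem[of k] add by simp
  qed
  define d where "d i = lscale L (\<zeta> ^ i - \<zeta> ^ n) (e i)" for i
  have "(\<Sum>i<Suc n. lscale L (\<zeta> ^ i) (e i)) = 0"
    using phi_sum[of "Suc n"] Suc.prems(3) phi0 by simp
  moreover have "(\<Sum>i<Suc n. lscale L (\<zeta> ^ n) (e i)) = 0"
    using Suc.prems(3) by (simp only: V.scale_sum_right[symmetric] V.scale_zero_right)
  ultimately have "(\<Sum>i<Suc n. d i) = 0"
    unfolding d_def V.scale_left_diff_distrib sum_subtractf by simp
  then have sum_d: "(\<Sum>i<n. d i) = 0" by (simp add: d_def)
  have "d i \<in> eigen_part L \<phi> \<zeta> i" if "i < n" for i
    using mem[of i] that V.subspace_scale[OF subspace]
    by (simp add: eigen_part_def d_def scale mult.commute)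
  then have d0: "d i = 0" if "i < n" for i
    using Suc.IH[of d i] sum_d that Suc.prems(1) by simp
  have ne: "\<zeta> ^ i \<noteq> \<zeta> ^ n" if "i < n" for i
  proof
    assume "\<zeta> ^ i = \<zeta> ^ n"
    moreover have "\<zeta> \<noteq> 0"
      using prim by (auto simp: primitive_root_of_unity_def power_0_left)
    moreover have "\<zeta> ^ n = \<zeta> ^ i * \<zeta> ^ (n - i)"
      using that by (simp flip: power_add)
    ultimately have "\<zeta> ^ (n - i) = 1" by simp
    moreover have "0 < n - i" "n - i < m" using that Suc.prems(1) by auto
    ultimately show False
      using prim unfolding primitive_root_of_unity_def by blast
  qed
  have e0: "e i = 0" if "i < n" for i
    using d0[OF that] ne[OF that] by (simp add: d_def)
  show ?case
  proof (cases "i < n")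
    case False
    with Suc.prems(4) have "i = n" by simp
    with Suc.prems(3) e0 show ?thesis by simp
  qed (rule e0)
qed

lemma eigen_components_homogeneous:
  assumes L: "lie_algebra L" and aut: "lie_automorphism L \<phi>"
    and prim: "primitive_root_of_unity m \<zeta>"
    and i: "i < m" and x: "x \<in> eigen_part L \<phi> \<zeta> i"
  shows "eigen_components L \<phi> \<zeta> m x = (\<lambda>j. if j = i then x else 0)"
  unfolding eigen_components_def
proof (rule the_equality)
  interpret lie_algebra L by (rule L)
  interpret V: vector_space "lscale L" by (rule vector_space)
  have zero: "0 \<in> lcarrier L" using subspace by (rule V.subspace_0)
  have "\<phi> (0 + 0) = \<phi> 0 + \<phi> 0"
    using aut zero unfolding lie_automorphism_def lie_iso_def by blast
  then have phi0: "\<phi> 0 = 0" by simp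
  show *: "(\<forall>j<m. (if j = i then x else 0) \<in> eigen_part L \<phi> \<zeta> j) \<and>
    (\<forall>j\<ge>m. (if j = i then x else 0) = 0) \<and> (\<Sum>j<m. if j = i then x else 0) = x"
    using i x zero phi0 by (auto simp: eigen_part_def)
  fix c
  assume c: "(\<forall>i<m. c i \<in> eigen_part L \<phi> \<zeta> i) \<and> (\<forall>i\<ge>m. c i = 0) \<and> (\<Sum>i<m. c i) = x"
  have diff: "u - v \<in> eigen_part L \<phi> \<zeta> j"
    if "u \<in> eigen_part L \<phi> \<zeta> j" "v \<in> eigen_part L \<phi> \<zeta> j" for u v j
  proof -
    have uv: "u \<in> lcarrier L" "v \<in> lcarrier L" "u - v \<in> lcarrier L"
      using that V.subspace_diff[OF subspace] by (auto simp: eigen_part_def)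
    have "\<phi> ((u - v) + v) = \<phi> (u - v) + \<phi> v"
      using aut uv unfolding lie_automorphism_def lie_iso_def by blast
    with that uv show ?thesis
      by (simp add: eigen_part_def V.scale_right_diff_distrib algebra_simps)
  qed
  define e where "e j = c j - (if j = i then x else 0)" for j
  have "e j \<in> eigen_part L \<phi> \<zeta> j" if "j < m" for j
    unfolding e_def using c * that by (intro diff) auto
  moreover have "(\<Sum>j<m. e j) = 0"
    unfolding e_def sum_subtractf using c * by simp
  ultimately have "e j = 0" if "j < m" for j
    using eigen_parts_independent[OF L aut prim, of m e j] that by simp
  moreover have "e j = 0" if "\<not> j < m" for j
    using c * that by (simp add: e_def)
  ultimately have "e j = 0" for j by blast
  then show "c = (\<lambda>j. if j = i then x else 0)"
    by (auto simp: e_def fun_eq_iff)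
qed

text \<open>The contracted bracket takes the defining values on homogeneous elements.\<close>

lemma periodic_contraction_bracket:
  assumes L: "lie_algebra L" and aut: "lie_automorphism L \<phi>"
    and prim: "primitive_root_of_unity m \<zeta>"
    and i: "i < m" and x: "x \<in> eigen_part L \<phi> \<zeta> i"
    and j: "j < m" and y: "y \<in> eigen_part L \<phi> \<zeta> j"
  shows "lbracket (periodic_contraction L \<phi> \<zeta> m) x y =
    (if i + j \<le> m - 1 then lbracket L x y else 0)"
proof -
  interpret lie_algebra L by (rule L)
  interpret V: vector_space "lscale L" by (rule vector_space)
  have zero: "0 \<in> lcarrier L" using subspace by (rule V.subspace_0)
  have xy: "x \<in> lcarrier L" "y \<in> lcarrier L" using x y by (auto simp: eigen_part_def)
  have z1: "lbracket L 0 w = 0" if "w \<in> lcarrier L" for w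
    using add_left[OF zero zero that] by simp
  have z2: "lbracket L w 0 = 0" if "w \<in> lcarrier L" for w
    using add_right[OF that zero zero] by simp
  have "lbracket (periodic_contraction L \<phi> \<zeta> m) x y =
    (\<Sum>i'<m. \<Sum>j'<m. if i' = i then (if j' = j then
      (if i + j \<le> m - 1 then lbracket L x y else 0) else 0) else 0)"
    by (auto intro!: sum.cong simp: periodic_contraction_def z1 z2 xy zero
        eigen_components_homogeneous[OF L aut prim i x]
        eigen_components_homogeneous[OF L aut prim j y])
  also have "\<dots> = (\<Sum>i'<m. if i' = i then
      (\<Sum>j'<m. if j' = j then (if i + j \<le> m - 1 then lbracket L x y else 0) else 0) else 0)"
    by (intro sum.cong) auto
  also have "\<dots> = (if i + j \<le> m - 1 then lbracket L x y else 0)"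
    using i j by simp
  finally show ?thesis .
qed

subsection \<open>The special linear Lie algebra\<close>

definition matrix_scale :: "'k::field \<Rightarrow> 'k^'n^'n \<Rightarrow> 'k^'n^'n"
  where "matrix_scale c A = (\<chi> i j. c * A $ i $ j)"

definition special_linear :: "('k::field, 'k^'n^'n) lie_struct"
  where "special_linear = \<lparr>
    lcarrier = {A. trace A = 0},
    lscale = matrix_scale,
    lbracket = (\<lambda>A B. A ** B - B ** A)\<rparr>"

lemma lie_algebra_special_linear: "lie_algebra (special_linear :: ('k::field, 'k^'n^'n) lie_struct)"
proof -
  interpret V: vector_space "matrix_scale :: 'k \<Rightarrow> 'k^'n^'n \<Rightarrow> 'k^'n^'n"
    by unfold_locales (auto simp: matrix_scale_def vec_eq_iff algebra_simps)
  have ldiff: "(A - B) ** C = A ** C - B ** C" and rdiff: "C ** (A - B) = C ** A - C ** B"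
    for A B C :: "'k^'n^'n"
    by (auto simp: vec_eq_iff matrix_matrix_mult_def sum_subtractf algebra_simps)
  have lscale: "matrix_scale c A ** B = matrix_scale c (A ** B)"
    and rscale: "A ** matrix_scale c B = matrix_scale c (A ** B)" for c and A B :: "'k^'n^'n"
    by (auto simp: vec_eq_iff matrix_matrix_mult_def matrix_scale_def sum_distrib_left algebra_simps)
  have rdistrib: "(A + B) ** C = A ** C + B ** C" for A B C :: "'k^'n^'n"
    by (auto simp: vec_eq_iff matrix_matrix_mult_def sum.distrib algebra_simps)
  have trace_scale: "trace (matrix_scale c A) = c * trace A" for c and A :: "'k^'n^'n"
    by (simp add: trace_def matrix_scale_def sum_distrib_left)
  show ?thesis
  proof
    show "module.subspace (lscale special_linear)
        (lcarrier (special_linear :: ('k, 'k^'n^'n) lie_struct))"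
      by (auto simp: special_linear_def V.subspace_def trace_0[simplified] trace_add trace_scale)
  next
    fix x y :: "'k^'n^'n"
    have "trace (x ** y) = trace (y ** x)" by (rule trace_mul_sym)
    then show "lbracket special_linear x y \<in> lcarrier special_linear"
      by (simp add: special_linear_def trace_sub)
  next
    fix x y z :: "'k^'n^'n"
    show "lbracket special_linear x (lbracket special_linear y z)
      + lbracket special_linear y (lbracket special_linear z x)
      + lbracket special_linear z (lbracket special_linear x y) = 0"
      by (simp add: special_linear_def ldiff rdiff matrix_mul_assoc)
  qed (simp_all add: special_linear_def V.vector_space_axioms lscale rscale rdistrib
      matrix_add_ldistrib V.scale_right_diff_distrib V.scale_right_distrib V.scale_left_distrib)
qed

end

theory Submission
  imports Defs
begin

text \<open>
  Up to conjugation \<open>\<theta>\<close> is \<open>Ad g\<close> with \<open>g\<close> diagonal with entries \<open>\<zeta>^(a j)\<close>, \<open>0 \<le> a j < m\<close>. The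
  matrix unit \<open>E\<^sub>j\<^sub>k\<close> then has degree \<open>a j - a k\<close>, plus \<open>m\<close> if \<open>a j < a k\<close>, so the contracted bracket
  keeps exactly those products \<open>E\<^sub>j\<^sub>k E\<^sub>k\<^sub>l = E\<^sub>j\<^sub>l\<close>
    for which \<open>[a j < a k] + [a k < a l] = [a j < a l]\<close>.
  This is the semidirect product of the parabolic subalgebra \<open>{a k \<le> a j}\<close> with the abelian ideal
  \<open>{a j < a k}\<close>.

  For the index, pass to all matrices, which adds one to the dimension of every stabiliser. Lower
  bound: the contraction is the limit \<open>t \<rightarrow> 0\<close> of brackets isomorphic to the commutator, stabilisers
  for the latter are centralisers, of dimension at least \<open>n\<close>, and the dimension of a kernel does not
  drop in the limit. Upper bound: the linear form \<open>\<Sum>j. 2^(\<rho> j) (E_{j, \<pi> j})^*\<close> has a stabiliser of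
  dimension at most \<open>n\<close>, where \<open>\<pi>\<close> permutes cyclically the rows of the diagram with column heights
  \<open>card {j. a j = i}\<close> and \<open>\<rho> j\<close> is the row of \<open>j\<close>.
\<close>

section \<open>Square matrices as a vector space\<close>

text \<open>The inner group is generated by exponentials of elements with nilpotent
  \<open>ad\<close>, so conjugations have to be recovered from the exponential series: such an
  element is nilpotent up to a scalar, hence its exponential is conjugation by a matrix. Finite
  order then makes a power of \<open>g\<close> scalar rather than the identity, and an m-th root of
  that scalar corrects \<open>g\<close>.

  Borel subalgebras and nilradicals are defined by maximality, so they have to be compared with
  arbitrary solvable subalgebras and nilpotent ideals. The check rests on one computation with a
  matrix unit and a matrix whose transposed entry is nonzero.

  The powers of 2 in the linear form separate the rows. On row h its matrix is 2^h times a cyclic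
  permutation, with eigenvalues 2^h times roots of unity. In characteristic 0 these differ from row
  to row, so the matrix is regular semisimple; without the powers all rows would share the
  eigenvalue 1. Aligning the boxes in rows keeps enough products alive for the same conclusion after
  contraction. Constant weights delete nothing, so the index of the special linear algebra itself is
  a special case.\<close>

interpretation mat: vector_space "matrix_scale :: 'k::field \<Rightarrow> 'k^'n^'n \<Rightarrow> 'k^'n^'n"
  by unfold_locales (auto simp: matrix_scale_def vec_eq_iff algebra_simps)

definition munit :: "'n \<Rightarrow> 'n \<Rightarrow> 'k::field^'n^'n" where
  "munit j k = (\<chi> p q. if p = j \<and> q = k then 1 else 0)"

lemma munit_nth: "munit j k $ p $ q = (if p = j \<and> q = k then 1 else 0)"
  by (simp add: munit_def)

lemma matrix_scale_nth [simp]: "matrix_scale c A $ i $ j = c * A $ i $ j"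
  by (simp add: matrix_scale_def)

lemma inj_munit: "inj (\<lambda>(j, k). munit j k :: 'k::field^'n^'n)"
proof (rule injI, clarify)
  fix j k p q assume "(munit j k :: 'k^'n^'n) = munit p q"
  then have "(munit j k :: 'k^'n^'n) $ j $ k = munit p q $ j $ k" by simp
  then show "j = p \<and> k = q" by (simp add: munit_nth split: if_splits)
qed

lemma munit_sum_nth:
  fixes c :: "'n::finite \<Rightarrow> 'n \<Rightarrow> 'k::field"
  shows "(\<Sum>x\<in>T. c (fst x) (snd x) * munit (fst x) (snd x) $ p $ q)
      = (if (p, q) \<in> T then c p q else 0)"
proof -
  have "(\<Sum>x\<in>T. c (fst x) (snd x) * munit (fst x) (snd x) $ p $ q)
      = (\<Sum>x\<in>T. if x = (p, q) then c p q else 0)"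
    by (intro sum.cong) (auto simp: munit_nth split: if_splits)
  then show ?thesis by simp
qed

definition coord_space :: "('n \<times> 'n) set \<Rightarrow> ('k::field^'n^'n) set" where
  "coord_space T = {A. \<forall>j k. A $ j $ k \<noteq> 0 \<longrightarrow> (j, k) \<in> T}"

lemma coord_space_subspace: "mat.subspace (coord_space T :: ('k::field^'n^'n) set)"
  by (auto simp: mat.subspace_def coord_space_def) (metis add.right_neutral)

lemma coord_space_span:
  "(coord_space T :: ('k::field^'n::finite^'n) set) = mat.span ((\<lambda>(j, k). munit j k) ` T)"
proof
  show "coord_space T \<subseteq> mat.span ((\<lambda>(j, k). munit j k :: 'k^'n^'n) ` T)"
  proof
    fix A :: "'k^'n^'n" assume "A \<in> coord_space T"
    then have "A = (\<Sum>x\<in>T. matrix_scale (A $ fst x $ snd x) (munit (fst x) (snd x)))"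
      by (auto simp: vec_eq_iff munit_sum_nth[of "\<lambda>j k. A $ j $ k"] coord_space_def)
    also have "\<dots> \<in> mat.span ((\<lambda>(j, k). munit j k :: 'k^'n^'n) ` T)"
      by (intro mat.span_sum mat.span_scale mat.span_base) (auto intro: rev_image_eqI)
    finally show "A \<in> mat.span ((\<lambda>(j, k). munit j k :: 'k^'n^'n) ` T)" .
  qed
  show "mat.span ((\<lambda>(j, k). munit j k :: 'k^'n^'n) ` T) \<subseteq> coord_space T"
    by (intro mat.span_minimal coord_space_subspace)
      (auto simp: coord_space_def munit_nth split: if_splits)
qed

lemma munit_independent: "mat.independent ((\<lambda>(j, k). munit j k :: 'k::field^'n::finite^'n) ` T)"
proof (rule mat.independent_if_scalars_zero)
  fix f x assume 0: "(\<Sum>x\<in>(\<lambda>(j, k). munit j k :: 'k^'n^'n) ` T. matrix_scale (f x) x) = 0"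
    and "x \<in> (\<lambda>(j, k). munit j k :: 'k^'n^'n) ` T"
  then obtain j k where jk: "(j, k) \<in> T" "x = munit j k" by auto
  have "inj_on (\<lambda>(j, k). munit j k :: 'k^'n^'n) T"
    using inj_munit inj_on_subset by blast
  then have "(\<Sum>x\<in>T. matrix_scale (f (munit (fst x) (snd x))) (munit (fst x) (snd x) :: 'k^'n^'n)) = 0"
    using 0 by (subst (asm) sum.reindex) (auto simp: case_prod_beta comp_def)
  then have "(\<Sum>x\<in>T. matrix_scale (f (munit (fst x) (snd x))) (munit (fst x) (snd x))) $ j $ k = 0"
    by simp
  then show "f x = 0" using jk by (simp add: munit_sum_nth[of "\<lambda>j k. f (munit j k)"])
qed simp

interpretation mat: finite_dimensional_vector_space
  "matrix_scale :: 'k::field \<Rightarrow> 'k^'n::finite^'n \<Rightarrow> 'k^'n^'n" "(\<lambda>(j, k). munit j k) ` UNIV"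
proof
  show "mat.span ((\<lambda>(j, k). munit j k :: 'k^'n^'n) ` UNIV) = UNIV"
    unfolding coord_space_span[symmetric] by (auto simp: coord_space_def)
qed (use munit_independent[of UNIV] in auto)

interpretation mats: finite_dimensional_vector_space_pair
  "matrix_scale :: 'k::field \<Rightarrow> 'k^'n::finite^'n \<Rightarrow> 'k^'n^'n" "(\<lambda>(j, k). munit j k) ` UNIV"
  "matrix_scale :: 'k::field \<Rightarrow> 'k^'n::finite^'n \<Rightarrow> 'k^'n^'n" "(\<lambda>(j, k). munit j k) ` UNIV" ..

interpretation matvec: finite_dimensional_vector_space_pair
  "matrix_scale :: 'k::field \<Rightarrow> 'k^'n::finite^'n \<Rightarrow> 'k^'n^'n" "(\<lambda>(j, k). munit j k) ` UNIV"
  "(*s) :: 'k \<Rightarrow> 'k^'n \<Rightarrow> 'k^'n" cart_basis ..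

lemma dim_coord_space: "mat.dim (coord_space T :: ('k::field^'n::finite^'n) set) = card T"
  unfolding coord_space_span mat.dim_span_eq_card_independent[OF munit_independent]
  by (rule card_image) (use inj_munit inj_on_subset in blast)

section \<open>Linear maps on matrices: rank, eigenvalues, kernels in a limit\<close>

abbreviation mat_linear :: "('k::field^'n^'n \<Rightarrow> 'k^'n^'n) \<Rightarrow> bool" where
  "mat_linear \<equiv> Vector_Spaces.linear matrix_scale matrix_scale"

lemma mat_linearI:
  assumes "\<And>A B. f (A + B) = f A + f B" "\<And>c A. f (matrix_scale c A) = matrix_scale c (f A)"
  shows "mat_linear f"
  using assms by unfold_locales

lemma mat_linear_add: "mat_linear f \<Longrightarrow> f (A + B) = f A + f B"
  and mat_linear_scale: "mat_linear f \<Longrightarrow> f (matrix_scale c A) = matrix_scale c (f A)"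
  and mat_linear_0: "mat_linear f \<Longrightarrow> f 0 = 0"
  by (auto simp: Vector_Spaces.linear.axioms mats.linear_add mats.linear_scale mats.linear_0)

lemma mat_linear_kernel: "mat_linear f \<Longrightarrow> mat.subspace {x. f x = 0}"
  by (auto simp: mat.subspace_def mat_linear_add mat_linear_scale mat_linear_0)

text \<open>A linear right inverse of \<open>f\<close> on the image of \<open>V\<close>, with values
  in \<open>V\<close>, carries that image onto a complement of the kernel inside
  \<open>V\<close>.\<close>

lemma mat_rank_nullity:
  fixes f :: "'k::field^'n::finite^'n \<Rightarrow> 'k^'n^'n"
  assumes f: "mat_linear f" and V: "mat.subspace V"
  shows "mat.dim V = mat.dim (f ` V) + mat.dim {x \<in> V. f x = 0}"
proof -
  obtain g where g: "range g \<subseteq> V" "mat_linear g" "\<And>v. v \<in> f ` V \<Longrightarrow> f (g v) = v"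
    using mats.linear_exists_right_inverse_on[OF f V] by blast
  let ?C = "g ` f ` V" and ?K = "{x \<in> V. f x = 0}"
  have K: "mat.subspace ?K"
    using mat.subspace_inter[OF V mat_linear_kernel[OF f]] by (simp add: Int_def)
  have C: "mat.subspace ?C"
    by (intro mats.linear_subspace_image g f V)
  have dimC: "mat.dim ?C = mat.dim (f ` V)"
  proof (rule mats.dim_image_eq[OF g(2)])
    have "mat.span (f ` V) = f ` V"
      using mats.linear_subspace_image[OF f V] by simp
    then show "inj_on g (mat.span (f ` V))"
      using g(3) by (metis inj_on_inverseI)
  qed
  have "?C \<inter> ?K \<subseteq> {0}"
  proof
    fix x assume "x \<in> ?C \<inter> ?K"
    then obtain v where "v \<in> V" "x = g (f v)" "f (g (f v)) = 0" by blast
    then show "x \<in> {0}" using g(3)[of "f v"] g(2) by (simp add: mat_linear_0)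
  qed
  then have int: "mat.dim (?C \<inter> ?K) = 0" by simp
  have sums: "{x + y |x y. x \<in> ?C \<and> y \<in> ?K} = V"
  proof (intro subset_antisym subsetI)
    fix x assume x: "x \<in> V"
    have "x = g (f x) + (x - g (f x))" "g (f x) \<in> ?C" using x by auto
    moreover have "x - g (f x) \<in> V" using x g(1) V by (auto intro: mat.subspace_diff)
    moreover have "f (x - g (f x)) = 0"
      using g(3) x by (simp add: mats.linear_diff[OF f])
    ultimately show "x \<in> {x + y |x y. x \<in> ?C \<and> y \<in> ?K}" by blast
  qed (use g(1) V mat.subspace_add in auto)
  show ?thesis
    using mat.dim_sums_Int[OF C K] unfolding sums int dimC by simp
qed

text \<open>
  Eigenvectors for distinct eigenvalues are independent, so their number is bounded by the dimension.
\<close>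

lemma mat_linear_eigenvalues_finite:
  fixes f :: "'k::field^'n::finite^'n \<Rightarrow> 'k^'n^'n"
  assumes f: "mat_linear f"
  shows "finite {c. \<exists>x. x \<noteq> 0 \<and> f x = matrix_scale c x}"
proof (rule ccontr)
  define E where "E = {c. \<exists>x. x \<noteq> 0 \<and> f x = matrix_scale c x}"
  assume "infinite {c. \<exists>x. x \<noteq> 0 \<and> f x = matrix_scale c x}"
  then have inf: "infinite E" by (simp only: E_def not_False_eq_True)
  define v where "v c = (SOME x. x \<noteq> 0 \<and> f x = matrix_scale c x)" for c
  have v: "v c \<noteq> 0" "f (v c) = matrix_scale c (v c)" if "c \<in> E" for c
    using someI_ex[of "\<lambda>x. x \<noteq> 0 \<and> f x = matrix_scale c x"] that
    unfolding v_def E_def mem_Collect_eq by blast+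
  have inj: "inj_on v E"
  proof (rule inj_onI)
    fix c d assume c: "c \<in> E" and d: "d \<in> E" and "v c = v d"
    then have "matrix_scale c (v c) = matrix_scale d (v c)" using v(2)[OF c] v(2)[OF d]
      by (simp only:)
    then show "c = d" using v(1)[OF c] by (simp only: mat.scale_cancel_right) blast
  qed
  have zero: "\<forall>c\<in>S. u c = 0"
    if "finite S" "S \<subseteq> E" "(\<Sum>c\<in>S. matrix_scale (u c) (v c)) = 0" for S u
    using that
  proof (induction S arbitrary: u rule: finite_induct)
    case (insert d S)
    have "f (\<Sum>c\<in>insert d S. matrix_scale (u c) (v c)) = 0"
      unfolding insert.prems(2) by (rule mat_linear_0[OF f])
    moreover have "f (\<Sum>c\<in>insert d S. matrix_scale (u c) (v c))
        = (\<Sum>c\<in>insert d S. matrix_scale (c * u c) (v c))"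
      unfolding mats.linear_sum[OF f]
    proof (intro sum.cong refl)
      fix c assume "c \<in> insert d S"
      then have "f (v c) = matrix_scale c (v c)" using insert.prems(1) v(2) by blast
      then show "f (matrix_scale (u c) (v c)) = matrix_scale (c * u c) (v c)"
        by (simp add: mat_linear_scale[OF f] mult.commute)
    qed
    \<comment> \<open>Subtracting \<open>d\<close> times the relation from its image under
      \<open>f\<close> removes the term at \<open>d\<close> and leaves the factors
      \<open>c - d\<close>, which are nonzero on \<open>S\<close>.\<close>
    moreover have "matrix_scale d (\<Sum>c\<in>insert d S. matrix_scale (u c) (v c)) = 0"
      unfolding insert.prems(2) by simp
    then have "(\<Sum>c\<in>insert d S. matrix_scale (d * u c) (v c)) = 0"
      by (simp only: mat.scale_sum_right mat.scale_scale)
    ultimately have "(\<Sum>c\<in>insert d S. matrix_scale ((c - d) * u c) (v c)) = 0"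
      by (simp only: left_diff_distrib mat.scale_left_diff_distrib sum_subtractf) simp
    then have "(\<Sum>c\<in>S. matrix_scale ((c - d) * u c) (v c)) = 0"
      using insert.hyps by simp
    then have "\<forall>c\<in>S. (c - d) * u c = 0"
      using insert.IH[of "\<lambda>c. (c - d) * u c"] insert.prems(1) by blast
    then have S: "\<forall>c\<in>S. u c = 0" using insert.hyps by auto
    then have "matrix_scale (u d) (v d) = 0" using insert.prems(2) insert.hyps by simp
    then have "u d = 0" using v(1)[of d] insert.prems(1) by (simp only: mat.scale_eq_0_iff) blast
    with S show ?case by simp
  qed simp
  obtain S where S: "S \<subseteq> E" "finite S" "card S = Suc (mat.dim (UNIV :: ('k^'n^'n) set))"
    using infinite_arbitrarily_large[OF inf] by metis
  have "inj_on v S" using inj S(1) by (rule inj_on_subset)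
  have "mat.independent (v ` S)"
  proof (rule mat.independent_if_scalars_zero)
    fix u x assume "(\<Sum>x\<in>v ` S. matrix_scale (u x) x) = 0" "x \<in> v ` S"
    then show "u x = 0"
      using zero[of S "\<lambda>c. u (v c)"] S \<open>inj_on v S\<close> by (auto simp: sum.reindex)
  qed (use S in simp)
  then have "card (v ` S) \<le> mat.dim (UNIV :: ('k^'n^'n) set)"
    by (intro mat.independent_card_le_dim) auto
  then show False using S \<open>inj_on v S\<close> by (simp add: card_image)
qed

text \<open>
  If \<open>H\<close> inverts \<open>F\<close> on a complement \<open>C\<close> of its kernel, then \<open>F x + t G x = 0\<close> with \<open>x \<in> C\<close>
  makes \<open>- 1 / t\<close> an eigenvalue of \<open>H \<circ> G\<close>, which excludes all but finitely many \<open>t\<close>.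
\<close>

lemma kernel_dim_semicontinuous:
  fixes F G :: "'k::field_char_0^'n::finite^'n \<Rightarrow> 'k^'n^'n"
  assumes F: "mat_linear F" and G: "mat_linear G"
    and ge: "\<And>t. t \<noteq> 0 \<Longrightarrow> d \<le> mat.dim {x. F x + matrix_scale t (G x) = 0}"
  shows "d \<le> mat.dim {x. F x = 0}"
proof -
  obtain H where H: "mat_linear H" "\<And>v. v \<in> range F \<Longrightarrow> F (H v) = v"
    using mats.linear_exists_right_inverse_on[OF F mat.subspace_UNIV] by blast
  let ?C = "H ` range F"
  have C: "mat.subspace ?C"
    by (intro mats.linear_subspace_image H F mat.subspace_UNIV)
  have HF: "H (F x) = x" if "x \<in> ?C" for x
  proof -
    from that obtain z where "x = H (F z)" by blast
    then show ?thesis using H(2)[of "F z"] by simp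
  qed
  have "F ` ?C = range F"
  proof -
    have "F ` ?C = (\<lambda>v. F (H v)) ` range F" by (simp add: image_comp comp_def)
    also have "\<dots> = range F" using H(2) by simp
    finally show ?thesis .
  qed
  then have dimC: "mat.dim (range F) \<le> mat.dim ?C"
    using mats.dim_image_le[OF F, of ?C] by simp
  have "mat_linear (H \<circ> G)" using G H(1) Vector_Spaces.linear_compose by blast
  then have "finite {c. \<exists>x. x \<noteq> 0 \<and> (H \<circ> G) x = matrix_scale c x}"
    by (rule mat_linear_eigenvalues_finite)
  then have "\<exists>s. s \<notin> insert 0 {c. \<exists>x. x \<noteq> 0 \<and> (H \<circ> G) x = matrix_scale c x}"
    by (intro ex_new_if_finite[OF infinite_UNIV_char_0] finite.insertI)
  then obtain s where "s \<notin> insert 0 {c. \<exists>x. x \<noteq> 0 \<and> (H \<circ> G) x = matrix_scale c x}"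
    by (elim exE)
  then have s: "s \<noteq> 0" "\<And>x. (H \<circ> G) x = matrix_scale s x \<Longrightarrow> x = 0"
    by simp_all blast
  define t where "t = - (1 / s)"
  have t: "t \<noteq> 0" "1 + t * s = 0" using s(1) by (auto simp: t_def)
  let ?K = "{x. F x + matrix_scale t (G x) = 0}"
  have "mat_linear (\<lambda>x. F x + matrix_scale t (G x))"
    by (intro mats.linear_compose_add mats.linear_compose_scale_right F G)
  then have K: "mat.subspace ?K" by (rule mat_linear_kernel)
  have "?C \<inter> ?K \<subseteq> {0}"
  proof
    fix x assume x: "x \<in> ?C \<inter> ?K"
    then have "H (F x + matrix_scale t (G x)) = 0" using H(1) by (simp add: mat_linear_0)
    then have "x + matrix_scale t (H (G x)) = 0"
      using x HF by (simp add: mat_linear_add[OF H(1)] mat_linear_scale[OF H(1)])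
    then have "matrix_scale s (x + matrix_scale t (H (G x))) = matrix_scale s 0" by (rule arg_cong)
    then have "matrix_scale s x + matrix_scale (s * t) (H (G x)) = 0"
      unfolding mat.scale_right_distrib mat.scale_scale mat.scale_zero_right .
    moreover have "s * t = - 1" using s(1) by (simp add: t_def)
    ultimately have "H (G x) = matrix_scale s x" by simp
    then show "x \<in> {0}" using s(2)[of x] by simp
  qed
  then have int: "mat.dim (?C \<inter> ?K) = 0" by simp
  \<comment> \<open>\<open>?C\<close> has at least the dimension of the range of \<open>F\<close>
    and meets \<open>?K\<close> only in 0, so \<open>?K\<close> is no larger than the kernel of
    \<open>F\<close>; the assumed bound on \<open>?K\<close> passes to that kernel.\<close>
  have "mat.dim ?C + mat.dim ?K \<le> mat.dim (UNIV :: ('k^'n^'n) set)"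
    using mat.dim_sums_Int[OF C K, unfolded int]
      mat.dim_subset[OF subset_UNIV, of "{x + y |x y. x \<in> ?C \<and> y \<in> ?K}"] by linarith
  moreover have "mat.dim (UNIV :: ('k^'n^'n) set) = mat.dim (range F) + mat.dim {x. F x = 0}"
    using mat_rank_nullity[OF F mat.subspace_UNIV] by simp
  ultimately show ?thesis using dimC ge[OF t(1)] by linarith
qed

section \<open>Contracted matrix product\<close>

text \<open>The wrap-around count: for weights at least 0 and below \<open>m\<close>, the residue of
  \<open>a j - a k\<close> modulo \<open>m\<close> is \<open>a j - a k + m * wt a j k\<close>. It is
  also the degree of a matrix unit in the splitting into parabolic (degree 0) and opposite
  nilradical (degree 1).\<close>

definition wt :: "('n \<Rightarrow> int) \<Rightarrow> 'n \<Rightarrow> 'n \<Rightarrow> nat" where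
  "wt a j k = (if a j < a k then 1 else 0)"

text \<open>The defect \<open>wt a j k + wt a k l - wt a j l\<close> takes only the values 0 and 1.
  Its vanishing is therefore all that has to be recorded, and the deformation that undoes the
  contraction is linear in its parameter.\<close>

definition survives :: "('n \<Rightarrow> int) \<Rightarrow> 'n \<Rightarrow> 'n \<Rightarrow> 'n \<Rightarrow> bool" where
  "survives a j k l \<longleftrightarrow> wt a j k + wt a k l = wt a j l"

text \<open>The contraction is performed on the associative product of all matrices. The Jacobi
  identity then comes from associativity, and the scalar matrices remain available when the index is
  computed.\<close>

definition cmult :: "('n::finite \<Rightarrow> int) \<Rightarrow> 'k::field^'n^'n \<Rightarrow> 'k^'n^'n \<Rightarrow> 'k^'n^'n" where
  "cmult a X Y = (\<chi> j l. \<Sum>k\<in>UNIV. if survives a j k l then X $ j $ k * Y $ k $ l else 0)"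

definition cbracket :: "('n::finite \<Rightarrow> int) \<Rightarrow> 'k::field^'n^'n \<Rightarrow> 'k^'n^'n \<Rightarrow> 'k^'n^'n" where
  "cbracket a X Y = cmult a X Y - cmult a Y X"

definition contraction :: "('n::finite \<Rightarrow> int) \<Rightarrow> ('k::field, 'k^'n^'n) lie_struct" where
  "contraction a = special_linear\<lparr>lbracket := cbracket a\<rparr>"

lemma special_linear_simps [simp]:
  "lcarrier special_linear = {A :: 'k::field^'n^'n. trace A = 0}"
  "lscale special_linear = matrix_scale"
  "lbracket special_linear A B = A ** B - B ** A"
  by (simp_all add: special_linear_def)

lemma contraction_simps [simp]:
  "lcarrier (contraction a) = {A :: 'k::field^'n::finite^'n. trace A = 0}"
  "lscale (contraction a) = matrix_scale"
  "lbracket (contraction a) = cbracket a"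
  by (simp_all add: contraction_def)

lemma cmult_nth:
  "cmult a X Y $ j $ l = (\<Sum>k\<in>UNIV. if survives a j k l then X $ j $ k * Y $ k $ l else 0)"
  by (simp add: cmult_def)

lemma cmult_add_left: "cmult a (X + Y) Z = cmult a X Z + cmult a Y Z"
  and cmult_add_right: "cmult a Z (X + Y) = cmult a Z X + cmult a Z Y"
  by (auto simp: vec_eq_iff cmult_nth distrib_left distrib_right simp flip: sum.distrib
      intro!: sum.cong)

lemma cmult_diff_left: "cmult a (X - Y) Z = cmult a X Z - cmult a Y Z"
  and cmult_diff_right: "cmult a Z (X - Y) = cmult a Z X - cmult a Z Y"
  by (auto simp: vec_eq_iff cmult_nth left_diff_distrib right_diff_distrib simp flip: sum_subtractf
      intro!: sum.cong)

lemma cmult_scale_left: "cmult a (matrix_scale c X) Y = matrix_scale c (cmult a X Y)"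
  and cmult_scale_right: "cmult a X (matrix_scale c Y) = matrix_scale c (cmult a X Y)"
  by (auto simp: vec_eq_iff cmult_nth sum_distrib_left intro!: sum.cong)

text \<open>Defects are nonnegative, so either bracketing keeps the path from \<open>j\<close> to
  \<open>p\<close> through \<open>k\<close> and \<open>l\<close> exactly when the three weights
  along it add up to \<open>wt a j p\<close>.\<close>

lemma cmult_assoc: "cmult a (cmult a X Y) Z = cmult a X (cmult a Y Z)"
proof -
  have "cmult a (cmult a X Y) Z $ j $ p = cmult a X (cmult a Y Z) $ j $ p" for j p
  proof -
    have cocycle: "survives a j l p \<and> survives a j k l \<longleftrightarrow> survives a j k p \<and> survives a k l p" for k l
      by (auto simp: survives_def wt_def)
    have "cmult a (cmult a X Y) Z $ j $ p = (\<Sum>l\<in>UNIV. \<Sum>k\<in>UNIV.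
        if survives a j l p \<and> survives a j k l then X $ j $ k * Y $ k $ l * Z $ l $ p else 0)"
      unfolding cmult_nth by (intro sum.cong refl) (auto simp: sum_distrib_right intro!: sum.cong)
    also have "\<dots> = (\<Sum>k\<in>UNIV. \<Sum>l\<in>UNIV.
        if survives a j k p \<and> survives a k l p then X $ j $ k * Y $ k $ l * Z $ l $ p else 0)"
      unfolding cocycle by (rule sum.swap)
    also have "\<dots> = cmult a X (cmult a Y Z) $ j $ p"
      unfolding cmult_nth
      by (intro sum.cong refl) (auto simp: sum_distrib_left mult.assoc intro!: sum.cong)
    finally show ?thesis .
  qed
  then show ?thesis by (simp add: vec_eq_iff)
qed

text \<open>A closed path through \<open>j\<close> and \<open>k\<close> survives exactly when
  \<open>a j = a k\<close>, a condition symmetric in the two indices.\<close>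

lemma trace_cmult_commute: "trace (cmult a X Y) = trace (cmult a Y X)"
proof -
  have comm: "survives a j k j \<longleftrightarrow> survives a k j k" for j k
    by (auto simp: survives_def wt_def)
  have "trace (cmult a X Y) = (\<Sum>j\<in>UNIV. \<Sum>k\<in>UNIV. if survives a j k j then X $ j $ k * Y $ k $ j else 0)"
    by (simp add: trace_def cmult_nth)
  also have "\<dots> = (\<Sum>k\<in>UNIV. \<Sum>j\<in>UNIV. if survives a j k j then X $ j $ k * Y $ k $ j else 0)"
    by (rule sum.swap)
  also have "\<dots> = trace (cmult a Y X)"
    unfolding trace_def cmult_nth by (intro sum.cong refl) (simp add: comm mult.commute)
  finally show ?thesis .
qed

text \<open>\<open>wt a j j\<close> is 0, so a product with a diagonal unit is never dropped when it
  is nonzero, and scalar matrices act as before.\<close>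

lemma cmult_mat_left: "cmult a (mat c) Y = matrix_scale c Y"
proof -
  have "(\<Sum>k\<in>UNIV. if survives a j k l then mat c $ j $ k * Y $ k $ l else 0)
      = (\<Sum>k\<in>UNIV. if k = j then c * Y $ j $ l else 0)" for j l
    by (intro sum.cong) (auto simp: mat_def survives_def wt_def)
  then show ?thesis by (simp add: vec_eq_iff cmult_nth)
qed

lemma cmult_mat_right: "cmult a Y (mat c) = matrix_scale c Y"
proof -
  have "(\<Sum>k\<in>UNIV. if survives a j k l then Y $ j $ k * mat c $ k $ l else 0)
      = (\<Sum>k\<in>UNIV. if k = l then c * Y $ j $ l else 0)" for j l
    by (intro sum.cong) (auto simp: mat_def survives_def wt_def)
  then show ?thesis by (simp add: vec_eq_iff cmult_nth)
qed

lemma cbracket_mat: "cbracket a (mat c) Y = 0" "cbracket a Y (mat c) = 0"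
  by (simp_all add: cbracket_def cmult_mat_left cmult_mat_right)

lemma cbracket_self: "cbracket a X X = 0"
  by (simp add: cbracket_def)

lemma trace_cbracket: "trace (cbracket a X Y) = 0"
  by (simp add: cbracket_def trace_sub trace_cmult_commute[of a X Y])

lemma cbracket_linear:
  "cbracket a (X + Y) Z = cbracket a X Z + cbracket a Y Z"
  "cbracket a Z (X + Y) = cbracket a Z X + cbracket a Z Y"
  "cbracket a (matrix_scale c X) Y = matrix_scale c (cbracket a X Y)"
  "cbracket a X (matrix_scale c Y) = matrix_scale c (cbracket a X Y)"
  by (simp_all add: cbracket_def cmult_add_left cmult_add_right cmult_scale_left cmult_scale_right
      mat.scale_right_diff_distrib)

lemma cbracket_const: "cbracket (\<lambda>_. c) X Y = X ** Y - Y ** X"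
  by (simp add: cbracket_def cmult_def survives_def wt_def matrix_matrix_mult_def)

text \<open>Makes the index of the uncontracted algebra an instance of the general
  computation.\<close>

lemma contraction_const: "contraction (\<lambda>_. c)
    = (special_linear :: ('k::field, 'k^'n::finite^'n) lie_struct)"
  by (simp add: contraction_def special_linear_def cbracket_const fun_eq_iff)

lemma trace_matrix_scale: "trace (matrix_scale c A) = c * trace (A :: 'k::field^'n::finite^'n)"
  by (simp add: trace_def sum_distrib_left)

lemma subspace_trace_zero: "mat.subspace {A :: 'k::field^'n::finite^'n. trace A = 0}"
  by (auto simp: mat.subspace_def trace_0[simplified] trace_add trace_matrix_scale)

lemma lie_algebra_contraction:
  "lie_algebra (contraction a :: ('k::field, 'k^'n::finite^'n) lie_struct)"
proof
  fix x y z :: "'k^'n^'n"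
  show "lbracket (contraction a) x (lbracket (contraction a) y z)
      + lbracket (contraction a) y (lbracket (contraction a) z x)
      + lbracket (contraction a) z (lbracket (contraction a) x y) = 0"
    by (simp add: cbracket_def cmult_diff_left cmult_diff_right cmult_assoc)
qed (simp_all add: cbracket_linear trace_cbracket mat.vector_space_axioms subspace_trace_zero
    cbracket_self
      mat.scale_right_distrib mat.scale_left_distrib)

section \<open>Coordinate subalgebras of the special linear Lie algebra\<close>

text \<open>Parabolic subalgebras, their nilradicals and Levi parts, and the bounds for the terms of
  the derived and lower central series all have this form; brackets between them then reduce to
  composing relations.\<close>

definition supp_sl :: "('n::finite \<Rightarrow> 'n \<Rightarrow> bool) \<Rightarrow> ('k::field^'n^'n) set" where
  "supp_sl R = {A. trace A = 0 \<and> (\<forall>j k. A $ j $ k \<noteq> 0 \<longrightarrow> R j k)}"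

lemma supp_slD: "A \<in> supp_sl R \<Longrightarrow> A $ j $ k \<noteq> 0 \<Longrightarrow> R j k"
  by (simp add: supp_sl_def)

lemma supp_sl_trace: "A \<in> supp_sl R \<Longrightarrow> trace A = 0"
  by (simp add: supp_sl_def)

lemma supp_slI: "trace A = 0 \<Longrightarrow> (\<And>j k. A $ j $ k \<noteq> 0 \<Longrightarrow> R j k) \<Longrightarrow> A \<in> supp_sl R"
  by (simp add: supp_sl_def)

lemma supp_sl_mono: "(\<And>j k. R j k \<Longrightarrow> S j k) \<Longrightarrow> supp_sl R \<subseteq> supp_sl S"
  by (auto simp: supp_sl_def)

lemma subspace_supp_sl: "mat.subspace (supp_sl R :: ('k::field^'n::finite^'n) set)"
proof -
  have "supp_sl R = {A :: 'k^'n^'n. trace A = 0} \<inter> coord_space {(j, k). R j k}"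
    by (auto simp: supp_sl_def coord_space_def)
  then show ?thesis
    using mat.subspace_inter[OF subspace_trace_zero coord_space_subspace] by metis
qed

lemma zero_in_supp_sl: "0 \<in> supp_sl R"
  using mat.subspace_0[OF subspace_supp_sl] .

lemma matrix_mult_supp:
  fixes X Y :: "'k::field^'n::finite^'n"
  assumes "(X ** Y) $ j $ l \<noteq> 0"
  obtains k where "X $ j $ k \<noteq> 0" "Y $ k $ l \<noteq> 0"
proof -
  have "\<exists>k. X $ j $ k * Y $ k $ l \<noteq> 0"
  proof (rule ccontr)
    assume "\<not> ?thesis"
    then have "(\<Sum>k\<in>UNIV. X $ j $ k * Y $ k $ l) = 0" by (intro sum.neutral) blast
    then show False using assms by (simp add: matrix_matrix_mult_def)
  qed
  then show ?thesis using that by auto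
qed

lemma trace_commutator: "trace (X ** Y - Y ** X :: 'k::field^'n::finite^'n) = 0"
  by (simp add: trace_sub trace_mul_sym[of X Y])

lemma commutator_supp:
  assumes X: "X \<in> supp_sl R" and Y: "Y \<in> supp_sl S"
    and "\<And>j k l. R j k \<Longrightarrow> S k l \<Longrightarrow> T j l" "\<And>j k l. S j k \<Longrightarrow> R k l \<Longrightarrow> T j l"
  shows "X ** Y - Y ** X \<in> supp_sl T"
proof (rule supp_slI[OF trace_commutator])
  fix j l assume "(X ** Y - Y ** X) $ j $ l \<noteq> 0"
  then have "(X ** Y) $ j $ l \<noteq> 0 \<or> (Y ** X) $ j $ l \<noteq> 0" by auto
  then show "T j l"
  proof
    assume "(X ** Y) $ j $ l \<noteq> 0"
    then obtain k where "X $ j $ k \<noteq> 0" "Y $ k $ l \<noteq> 0" by (rule matrix_mult_supp)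
    then show ?thesis using assms(3) X Y by (meson supp_slD)
  next
    assume "(Y ** X) $ j $ l \<noteq> 0"
    then obtain k where "Y $ j $ k \<noteq> 0" "X $ k $ l \<noteq> 0" by (rule matrix_mult_supp)
    then show ?thesis using assms(4) X Y by (meson supp_slD)
  qed
qed

lemma lie_subalgebra_supp_sl:
  assumes "\<And>j k l. R j k \<Longrightarrow> R k l \<Longrightarrow> R j l"
  shows "lie_subalgebra special_linear (supp_sl R :: ('k::field^'n::finite^'n) set)"
proof -
  have "X ** Y - Y ** X \<in> supp_sl R" if "X \<in> supp_sl R" "Y \<in> supp_sl R" for X Y :: "'k^'n^'n"
    by (rule commutator_supp[OF that]) (fact assms)+
  then show ?thesis
    using subspace_supp_sl by (auto simp: lie_subalgebra_def supp_sl_trace)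
qed

section \<open>Derived and lower central series, and an obstruction to solvability\<close>

lemma lie_restrict_simps [simp]:
  "lcarrier (lie_restrict L H) = H" "lscale (lie_restrict L H) = lscale L"
  "lbracket (lie_restrict L H) = lbracket L"
  "lie_restrict (lie_restrict L H) H' = lie_restrict L H'"
  by (simp_all add: lie_restrict_def)

abbreviation sl_bracket_span :: "('k::field^'n::finite^'n) set \<Rightarrow> ('k^'n^'n) set \<Rightarrow> ('k^'n^'n) set" where
  "sl_bracket_span A B \<equiv> mat.span {x ** y - y ** x | x y. x \<in> A \<and> y \<in> B}"

lemma bracket_span_restrict [simp]:
  "bracket_span (lie_restrict special_linear H) A B = sl_bracket_span A B"
  by (simp add: bracket_span_def)

lemma sl_bracket_span_subset:
  assumes "mat.subspace V" "\<And>x y. x \<in> A \<Longrightarrow> y \<in> B \<Longrightarrow> x ** y - y ** x \<in> V"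
  shows "sl_bracket_span A B \<subseteq> V"
  by (rule mat.span_minimal) (use assms in auto)

lemma sl_bracket_span_base: "x \<in> A \<Longrightarrow> y \<in> B \<Longrightarrow> x ** y - y ** x \<in> sl_bracket_span A B"
  by (rule mat.span_base) auto

lemma sl_bracket_span_mono: "A \<subseteq> A' \<Longrightarrow> B \<subseteq> B' \<Longrightarrow> sl_bracket_span A B \<subseteq> sl_bracket_span A' B'"
  by (rule mat.span_mono) auto

lemma sl_derived_series_decreasing:
  assumes "lie_subalgebra special_linear H"
  shows "derived_series (lie_restrict special_linear H) (Suc n)
    \<subseteq> derived_series (lie_restrict special_linear H) n"
proof (induction n)
  case 0
  have "sl_bracket_span H H \<subseteq> H"
    by (rule sl_bracket_span_subset) (use assms in \<open>auto simp: lie_subalgebra_def\<close>)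
  then show ?case by simp
next
  case (Suc n)
  show ?case
    using sl_bracket_span_mono[OF Suc Suc] by (simp only: derived_series.simps bracket_span_restrict)
qed

lemma sl_series_zero:
  assumes "lie_subalgebra special_linear H"
  shows "0 \<in> derived_series (lie_restrict special_linear H) n"
    "0 \<in> lower_central_series (lie_restrict special_linear H) n"
  by (cases n; use assms in \<open>auto simp: lie_subalgebra_def mat.subspace_0 mat.span_zero\<close>)+

lemma nilpotent_imp_solvable_sl:
  assumes H: "lie_subalgebra special_linear H"
    and nil: "lie_nilpotent (lie_restrict special_linear H)"
  shows "lie_solvable (lie_restrict special_linear H)"
proof -
  let ?L = "lie_restrict special_linear H"
  have sub: "derived_series ?L n \<subseteq> H" for n
  proof (induction n)
    case (Suc n)
    then show ?case using sl_derived_series_decreasing[OF H, of n] by blast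
  qed simp
  have "derived_series ?L n \<subseteq> lower_central_series ?L n" for n
  proof (induction n)
    case (Suc n)
    show ?case
      using sl_bracket_span_mono[OF sub Suc]
      by (simp only: derived_series.simps lower_central_series.simps
          bracket_span_restrict lie_restrict_simps)
  qed simp
  then show ?thesis
    using nil sl_series_zero[OF H] unfolding lie_solvable_def lie_nilpotent_def by blast
qed

lemma munit_mult_left: "(munit p q ** A) $ i $ j = (if i = p then A $ q $ j else 0)"
proof -
  have "(\<Sum>k\<in>UNIV. munit p q $ i $ k * A $ k $ j)
      = (\<Sum>k\<in>UNIV. if k = q then (if i = p then A $ q $ j else 0) else 0)"
    by (intro sum.cong) (auto simp: munit_nth)
  then show ?thesis by (simp add: matrix_matrix_mult_def)
qed

lemma munit_mult_right: "(A ** munit p q) $ i $ j = (if j = q then A $ i $ p else 0)"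
proof -
  have "(\<Sum>k\<in>UNIV. A $ i $ k * munit p q $ k $ j)
      = (\<Sum>k\<in>UNIV. if k = p then (if j = q then A $ i $ p else 0) else 0)"
    by (intro sum.cong) (auto simp: munit_nth)
  then show ?thesis by (simp add: matrix_matrix_mult_def)
qed

lemma trace_munit: "p \<noteq> q \<Longrightarrow> trace (munit p q) = 0"
  unfolding trace_def by (rule sum.neutral) (simp add: munit_nth)

text \<open>A substitute for an sl_2 triple in which the opposite element \<open>A\<close> may have
  arbitrary further entries. Bracketing twice with \<open>e\<close> returns a multiple of
  \<open>e\<close>, and bracketing \<open>h\<close> with \<open>A\<close> returns a matrix whose
  entry at \<open>(j, k)\<close> is again nonzero if that of \<open>A\<close> is and the
  characteristic is 0.\<close>

lemma munit_double_bracket: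
  fixes A :: "'k::field^'n::finite^'n"
  assumes "j \<noteq> k"
  defines "e \<equiv> munit k j :: 'k^'n^'n"
  defines "h \<equiv> e ** A - A ** e"
  shows "e ** h - h ** e = matrix_scale (- 2 * A $ j $ k) e"
    and "(h ** A - A ** h) $ j $ k = - 2 * (A $ j $ k)\<^sup>2"
proof -
  show "e ** h - h ** e = matrix_scale (- 2 * A $ j $ k) e"
    using assms(1) by (auto simp: vec_eq_iff e_def h_def munit_mult_left munit_mult_right munit_nth)
  have h: "h $ p $ q = (if p = k then A $ j $ q else 0) - (if q = j then A $ p $ k else 0)" for p q
    by (simp add: h_def e_def munit_mult_left munit_mult_right)
  have "(\<Sum>i\<in>UNIV. h $ j $ i * A $ i $ k) = (\<Sum>i\<in>UNIV. if i = j then - (A $ j $ k * A $ j $ k) else 0)"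
    using assms(1) by (intro sum.cong) (auto simp: h)
  moreover have "(\<Sum>i\<in>UNIV. A $ j $ i * h $ i $ k)
      = (\<Sum>i\<in>UNIV. if i = k then A $ j $ k * A $ j $ k else 0)"
    using assms(1) by (intro sum.cong) (auto simp: h)
  ultimately show "(h ** A - A ** h) $ j $ k = - 2 * (A $ j $ k)\<^sup>2"
    by (simp add: power2_eq_square matrix_matrix_mult_def)
qed

text \<open>The unit \<open>munit k j\<close>, together with some matrix having a nonzero entry at
  \<open>(j, k)\<close>, reappears in every term of the derived series.\<close>

lemma not_solvable_sl:
  fixes H :: "('k::field_char_0^'n::finite^'n) set"
  assumes H: "lie_subalgebra special_linear H" and "j \<noteq> k"
    and e: "munit k j \<in> H" and A: "A \<in> H" "A $ j $ k \<noteq> 0"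
  shows "\<not> lie_solvable (lie_restrict special_linear H)"
proof -
  let ?D = "derived_series (lie_restrict special_linear H)"
  have "munit k j \<in> ?D n \<and> (\<exists>A\<in>?D n. A $ j $ k \<noteq> 0)" for n
  proof (induction n)
    case 0
    then show ?case using e A by auto
  next
    case (Suc n)
    let ?e = "munit k j :: 'k^'n^'n"
    obtain A where A: "A \<in> ?D n" "A $ j $ k \<noteq> 0" and e: "?e \<in> ?D n" using Suc by blast
    define h where "h = ?e ** A - A ** ?e"
    have "h \<in> ?D (Suc n)" unfolding h_def using A e by (auto intro: sl_bracket_span_base)
    \<comment> \<open>\<open>h\<close> already lies one term further down. As the series decreases,
      it may be used in the current term, so two successive brackets cost only one step.\<close>
    then have h: "h \<in> ?D n" using sl_derived_series_decreasing[OF H] by blast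
    have "?e ** h - h ** ?e \<in> ?D (Suc n)" using e h by (auto intro: sl_bracket_span_base)
    moreover define c where "c = - 2 * A $ j $ k"
    have "?e ** h - h ** ?e = matrix_scale c ?e"
      unfolding h_def c_def by (rule munit_double_bracket(1)[OF assms(2)])
    ultimately have "matrix_scale c ?e \<in> ?D (Suc n)" by simp
    then have "matrix_scale (1 / c) (matrix_scale c ?e) \<in> ?D (Suc n)"
      unfolding derived_series.simps bracket_span_restrict by (rule mat.span_scale)
    moreover have "c \<noteq> 0" using A(2) by (simp add: c_def)
    ultimately have "?e \<in> ?D (Suc n)" by (simp add: mat.scale_scale del: derived_series.simps)
    moreover have "h ** A - A ** h \<in> ?D (Suc n)" using A h by (auto intro: sl_bracket_span_base)
    moreover have "(h ** A - A ** h) $ j $ k \<noteq> 0"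
      using munit_double_bracket(2)[OF assms(2), of A] A(2) by (simp add: h_def)
    ultimately show ?case using \<open>?e \<in> ?D (Suc n)\<close> by blast
  qed
  moreover have "(munit k j :: 'k^'n^'n) \<noteq> 0"
    by (auto simp: vec_eq_iff munit_nth)
  ultimately show ?thesis unfolding lie_solvable_def by blast
qed

section \<open>Parabolic subalgebras of the special linear Lie algebra\<close>

definition parabolic_sl :: "('n::finite \<Rightarrow> int) \<Rightarrow> ('k::field^'n^'n) set" where
  "parabolic_sl a = supp_sl (\<lambda>j k. a k \<le> a j)"

text \<open>Negating the weights gives the opposite side: \<open>nil_sl (\<lambda>j. - a j)\<close>
  lives on the positions where \<open>wt a\<close> equals 1.\<close>

definition nil_sl :: "('n::finite \<Rightarrow> int) \<Rightarrow> ('k::field^'n^'n) set" where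
  "nil_sl a = supp_sl (\<lambda>j k. a k < a j)"

lemma munit_in_supp_sl: "p \<noteq> q \<Longrightarrow> R p q \<Longrightarrow> munit p q \<in> supp_sl R"
  by (rule supp_slI[OF trace_munit]) (auto simp: munit_nth split: if_splits)

lemma supp_sl_empty: "(\<And>j k. \<not> R j k) \<Longrightarrow> supp_sl R = {0}"
  using zero_in_supp_sl[of R] by (auto simp: supp_sl_def vec_eq_iff)

lemma weight_difference_bound:
  fixes a :: "'n::finite \<Rightarrow> int"
  obtains K :: nat where "\<And>j k. a j - a k < int K"
proof
  fix j k
  have "a j - a k \<le> Max ((\<lambda>(j, k). a j - a k) ` UNIV)"
    by (rule Max_ge) (auto intro!: rev_image_eqI[of "(j, k)"])
  then show "a j - a k < int (nat (Max ((\<lambda>(j, k). a j - a k) ` UNIV)) + 1)" by linarith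
qed

lemma lie_subalgebra_parabolic: "lie_subalgebra special_linear (parabolic_sl a)"
  unfolding parabolic_sl_def by (rule lie_subalgebra_supp_sl) auto

lemma lie_ideal_nil:
  "lie_ideal (lie_restrict special_linear (parabolic_sl a)) (nil_sl a :: ('k::field^'n::finite^'n) set)"
proof -
  have "x ** y - y ** x \<in> nil_sl a" if "x \<in> parabolic_sl a" "y \<in> nil_sl a" for x y :: "'k^'n^'n"
    using that unfolding parabolic_sl_def nil_sl_def by (rule commutator_supp) auto
  moreover have "nil_sl a \<subseteq> (parabolic_sl a :: ('k^'n^'n) set)"
    unfolding parabolic_sl_def nil_sl_def by (rule supp_sl_mono) simp
  ultimately show ?thesis
    unfolding lie_ideal_def lie_restrict_simps special_linear_simps
    by (simp add: nil_sl_def subspace_supp_sl)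
qed

text \<open>Every further bracket raises the lower bound for the integer \<open>a j - a k\<close> on
  the support by one, and these differences are bounded.\<close>

lemma lie_nilpotent_nil:
  "lie_nilpotent (lie_restrict special_linear (nil_sl a :: ('k::field^'n::finite^'n) set))"
proof -
  let ?L = "lie_restrict special_linear (nil_sl a :: ('k^'n^'n) set)"
  have lcs: "lower_central_series ?L n \<subseteq> supp_sl (\<lambda>j k. a j - a k > int n)" for n
  proof (induction n)
    case 0
    then show ?case by (auto simp: nil_sl_def intro: supp_sl_mono[THEN subsetD])
  next
    case (Suc n)
    have "sl_bracket_span (nil_sl a) (lower_central_series ?L n)
        \<subseteq> supp_sl (\<lambda>j k. a j - a k > int (Suc n))"
    proof (rule sl_bracket_span_subset[OF subspace_supp_sl])
      fix x y :: "'k^'n^'n" assume x: "x \<in> nil_sl a" and "y \<in> lower_central_series ?L n"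
      then have y: "y \<in> supp_sl (\<lambda>j k. a j - a k > int n)" using Suc by blast
      show "x ** y - y ** x \<in> supp_sl (\<lambda>j k. a j - a k > int (Suc n))"
        using x y unfolding nil_sl_def by (rule commutator_supp) auto
    qed
    then show ?case by simp
  qed
  obtain K :: nat where K: "\<And>j k. a j - a k < int K"
    using weight_difference_bound[of a] by blast
  have "supp_sl (\<lambda>j k. a j - a k > int K) = ({0} :: ('k^'n^'n) set)"
    by (rule supp_sl_empty) (simp add: K not_less less_imp_le)
  moreover have "lie_subalgebra special_linear (nil_sl a :: ('k^'n^'n) set)"
    unfolding nil_sl_def by (rule lie_subalgebra_supp_sl) auto
  ultimately have "lower_central_series ?L K = {0}"
    using lcs[of K] sl_series_zero(2)[of "nil_sl a" K] by auto
  then show ?thesis unfolding lie_nilpotent_def by blast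
qed

text \<open>A nonzero off-diagonal entry inside a Levi block would put the transposed unit into
  \<open>I\<close> and contradict solvability. The diagonal of \<open>A\<close> is then constant,
  because iterated brackets with \<open>A\<close> multiply the entry of a unit by a difference of
  diagonal entries and must die out. Trace zero in characteristic 0 makes it vanish.\<close>

lemma nilpotent_ideal_subset_nil:
  fixes I :: "('k::field_char_0^'n::finite^'n) set"
  assumes ideal: "lie_ideal (lie_restrict special_linear (parabolic_sl a)) I"
    and nil: "lie_nilpotent (lie_restrict special_linear I)"
  shows "I \<subseteq> nil_sl a"
proof
  fix A assume A: "A \<in> I"
  have sub: "I \<subseteq> parabolic_sl a" "mat.subspace I"
    and br: "\<And>x y. x \<in> parabolic_sl a \<Longrightarrow> y \<in> I \<Longrightarrow> x ** y - y ** x \<in> I"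
    using ideal by (auto simp: lie_ideal_def)
  have alg: "lie_subalgebra special_linear I"
    using sub br by (auto simp: lie_subalgebra_def parabolic_sl_def supp_sl_trace subset_iff)
  have solv: "lie_solvable (lie_restrict special_linear I)"
    using nilpotent_imp_solvable_sl[OF alg nil] .
  have supp: "a k \<le> a j" if "A $ j $ k \<noteq> 0" for j k
    using A sub(1) that unfolding parabolic_sl_def by (meson subsetD supp_slD)
  have off: "A $ j $ k = 0" if "j \<noteq> k" "a j = a k" for j k
  proof (rule ccontr)
    assume nz: "A $ j $ k \<noteq> 0"
    let ?e = "munit k j :: 'k^'n^'n"
    have e: "?e \<in> parabolic_sl a"
      using that unfolding parabolic_sl_def by (intro munit_in_supp_sl) auto
    define h where "h = ?e ** A - A ** ?e"
    have "h \<in> I" unfolding h_def using e A by (rule br)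
    then have "?e ** h - h ** ?e \<in> I" using e by (intro br)
    moreover define c where "c = - 2 * A $ j $ k"
    have "?e ** h - h ** ?e = matrix_scale c ?e"
      unfolding h_def c_def by (rule munit_double_bracket(1)[OF that(1)])
    ultimately have "matrix_scale (1 / c) (matrix_scale c ?e) \<in> I"
      using sub(2) by (metis mat.subspace_scale)
    moreover have "c \<noteq> 0" using nz by (simp add: c_def)
    ultimately have "?e \<in> I" by (simp add: mat.scale_scale)
    then show False using not_solvable_sl[OF alg that(1) _ A nz] solv by blast
  qed
  have diag: "A $ j $ j = A $ k $ k" if jk: "j \<noteq> k" "a k \<le> a j" for j k
  proof -
    \<comment> \<open>\<open>R\<close> is chosen so that brackets with \<open>A\<close> stay inside
      it while the entry \<open>(j, k)\<close> is fed only by itself: any other contribution would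
      pass through an off-diagonal entry of a Levi block.\<close>
    define R where "R p q \<longleftrightarrow> a j \<le> a p \<and> a q \<le> a k" for p q
    let ?C = "lower_central_series (lie_restrict special_linear I)"
    have step: "A ** X - X ** A \<in> supp_sl R"
      "(A ** X - X ** A) $ j $ k = (A $ j $ j - A $ k $ k) * X $ j $ k" if X: "X \<in> supp_sl R" for X
    proof -
      have "A \<in> supp_sl (\<lambda>j k. a k \<le> a j)" using A sub(1) by (auto simp: parabolic_sl_def)
      then show "A ** X - X ** A \<in> supp_sl R"
        using X by (rule commutator_supp) (auto simp: R_def)
      have prod1: "A $ j $ i * X $ i $ k = (if i = j then A $ j $ j * X $ j $ k else 0)" for i
      proof (cases "A $ j $ i = 0 \<or> X $ i $ k = 0")
        case False
        then have "a i \<le> a j" "R i k" using supp X by (auto dest: supp_slD)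
        then have "a i = a j" by (simp add: R_def)
        then show ?thesis using off[of j i] False by auto
      qed auto
      have prod2: "X $ j $ i * A $ i $ k = (if i = k then X $ j $ k * A $ k $ k else 0)" for i
      proof (cases "A $ i $ k = 0 \<or> X $ j $ i = 0")
        case False
        then have "a k \<le> a i" "R j i" using supp X by (auto dest: supp_slD)
        then have "a i = a k" by (simp add: R_def)
        then show ?thesis using off[of i k] False by auto
      qed auto
      have "(A ** X) $ j $ k = A $ j $ j * X $ j $ k"
        unfolding matrix_matrix_mult_def vec_lambda_beta by (subst sum.cong[OF refl prod1]) simp_all
      moreover have "(X ** A) $ j $ k = X $ j $ k * A $ k $ k"
        unfolding matrix_matrix_mult_def vec_lambda_beta by (subst sum.cong[OF refl prod2]) simp_all
      ultimately show "(A ** X - X ** A) $ j $ k = (A $ j $ j - A $ k $ k) * X $ j $ k"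
        by (simp add: algebra_simps)
    qed
    \<comment> \<open>The unit itself need not lie in \<open>I\<close>, but its bracket with
      \<open>A\<close> does; hence the exponent starts at one.\<close>
    have chain: "\<exists>X \<in> ?C n. X \<in> supp_sl R \<and> X $ j $ k = (A $ j $ j - A $ k $ k) ^ Suc n" for n
    proof (induction n)
      case 0
      let ?e = "munit j k :: 'k^'n^'n"
      have e: "?e \<in> parabolic_sl a" "?e \<in> supp_sl R"
        using jk by (auto simp: parabolic_sl_def R_def intro!: munit_in_supp_sl)
      have "?e ** A - A ** ?e \<in> I" using e(1) A by (rule br)
      then have "matrix_scale (- 1) (?e ** A - A ** ?e) \<in> I" using sub(2)
        by (rule mat.subspace_scale[rotated])
      then have "A ** ?e - ?e ** A \<in> I" by simp
      then show ?case using step[OF e(2)] by (auto simp: munit_nth)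
    next
      case (Suc n)
      then obtain X where X: "X \<in> ?C n" "X \<in> supp_sl R" "X $ j $ k = (A $ j $ j - A $ k $ k) ^ Suc n"
        by blast
      have "A ** X - X ** A \<in> ?C (Suc n)"
        using A X(1) by (simp add: sl_bracket_span_base)
      then show ?case using step[OF X(2)] X(3) by (intro bexI[of _ "A ** X - X ** A"]) auto
    qed
    obtain n where "?C n = {0}" using nil unfolding lie_nilpotent_def by blast
    then have "(A $ j $ j - A $ k $ k) ^ Suc n = 0" using chain[of n] by force
    then show ?thesis by auto
  qed
  have diag0: "A $ j $ j = 0" for j
  proof -
    have eq: "A $ k $ k = A $ j $ j" for k
    proof (cases "k = j")
      case False
      then show ?thesis
        using diag[of j k] diag[of k j] linear[of "a j" "a k"] by metis
    qed simp
    have "trace A = (\<Sum>k\<in>(UNIV :: 'n set). A $ j $ j)" unfolding trace_def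
      by (rule sum.cong[OF refl eq])
    then have "trace A = of_nat CARD('n) * A $ j $ j" by simp
    moreover have "trace A = 0" using A alg by (auto simp: lie_subalgebra_def)
    ultimately show ?thesis by simp
  qed
  show "A \<in> nil_sl a"
    unfolding nil_sl_def
  proof (rule supp_slI)
    show "trace A = 0" using A alg by (auto simp: lie_subalgebra_def)
    fix j k assume nz: "A $ j $ k \<noteq> 0"
    then show "a k < a j" using supp[OF nz] off[of j k] diag0[of j] by (cases "j = k") force+
  qed
qed

lemma is_nilradical_nil:
  "is_nilradical (lie_restrict special_linear (parabolic_sl a))
    (nil_sl a :: ('k::field_char_0^'n::finite^'n) set)"
  unfolding is_nilradical_def lie_restrict_simps
  using lie_ideal_nil lie_nilpotent_nil nilpotent_ideal_subset_nil by blast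

text \<open>Distinct weights make the algebra triangular: the first derived term loses the diagonal,
  and each later one widens the gap \<open>b j - b k\<close>. For maximality, a forbidden nonzero
  entry faces a matrix unit that the algebra already contains, which excludes solvability.\<close>

lemma borel_parabolic_sl:
  assumes inj: "inj b"
  shows "borel_subalgebra special_linear (parabolic_sl b :: ('k::field_char_0^'n::finite^'n) set)"
proof -
  let ?B = "parabolic_sl b :: ('k^'n^'n) set"
  let ?D = "derived_series (lie_restrict special_linear ?B)"
  have D: "?D (Suc n) \<subseteq> supp_sl (\<lambda>j k. b j - b k > int n)" for n
  proof (induction n)
    case 0
    have "sl_bracket_span ?B ?B \<subseteq> supp_sl (\<lambda>j k. b j - b k > int 0)"
    proof (rule sl_bracket_span_subset[OF subspace_supp_sl])
      fix x y :: "'k^'n^'n" assume x: "x \<in> ?B" and y: "y \<in> ?B"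
      have "x ** y - y ** x \<in> supp_sl (\<lambda>j k. b k \<le> b j)"
        using x y unfolding parabolic_sl_def by (rule commutator_supp) auto
      moreover have "(x ** y - y ** x) $ j $ j = 0" for j
      proof -
        have prod: "u $ j $ k * v $ k $ j = (if k = j then u $ j $ j * v $ j $ j else 0)"
          if "u \<in> ?B" "v \<in> ?B" for u v k
        proof (cases "u $ j $ k = 0 \<or> v $ k $ j = 0")
          case False
          then have "b k = b j"
            using that unfolding parabolic_sl_def by (meson order_antisym supp_slD)
          then show ?thesis using inj by (simp add: inj_eq)
        qed auto
        have "(x ** y) $ j $ j = x $ j $ j * y $ j $ j"
          unfolding matrix_matrix_mult_def vec_lambda_beta
            by (subst sum.cong[OF refl prod[OF x y]]) simp_all
        moreover have "(y ** x) $ j $ j = y $ j $ j * x $ j $ j"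
          unfolding matrix_matrix_mult_def vec_lambda_beta
            by (subst sum.cong[OF refl prod[OF y x]]) simp_all
        ultimately show ?thesis by (simp add: mult.commute)
      qed
      ultimately show "x ** y - y ** x \<in> supp_sl (\<lambda>j k. b j - b k > int 0)"
        using inj by (auto simp: supp_sl_def inj_eq order_less_le)
    qed
    then show ?case by simp
  next
    case (Suc n)
    have "sl_bracket_span (?D (Suc n)) (?D (Suc n)) \<subseteq> supp_sl (\<lambda>j k. b j - b k > int (Suc n))"
    proof (rule sl_bracket_span_subset[OF subspace_supp_sl])
      fix x y assume "x \<in> ?D (Suc n)" "y \<in> ?D (Suc n)"
      then have "x \<in> supp_sl (\<lambda>j k. b j - b k > int n)" "y \<in> supp_sl (\<lambda>j k. b j - b k > int n)"
        using Suc by blast+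
      then show "x ** y - y ** x \<in> supp_sl (\<lambda>j k. b j - b k > int (Suc n))"
        by (rule commutator_supp) auto
    qed
    then show ?case by (simp only: derived_series.simps bracket_span_restrict)
  qed
  obtain K :: nat where K: "\<And>j k. b j - b k < int K"
    using weight_difference_bound[of b] by blast
  have "supp_sl (\<lambda>j k. b j - b k > int K) = ({0} :: ('k^'n^'n) set)"
    by (rule supp_sl_empty) (simp add: K not_less less_imp_le)
  then have "?D (Suc K) = {0}"
    using D[of K] sl_series_zero(1)[OF lie_subalgebra_parabolic, of b "Suc K"] by blast
  then have "lie_solvable (lie_restrict special_linear ?B)"
    unfolding lie_solvable_def by blast
  moreover have "H = ?B"
    if H: "lie_subalgebra special_linear H" "lie_solvable (lie_restrict special_linear H)" "?B \<subseteq> H"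
      for H
  proof
    show "H \<subseteq> ?B"
    proof
      fix A assume A: "A \<in> H"
      have "b k \<le> b j" if nz: "A $ j $ k \<noteq> 0" for j k
      proof (rule ccontr)
        assume less: "\<not> b k \<le> b j"
        then have "j \<noteq> k" by auto
        moreover have "munit k j \<in> H"
          using less H(3) \<open>j \<noteq> k\<close> unfolding parabolic_sl_def
          by (intro subsetD[OF H(3)[unfolded parabolic_sl_def]] munit_in_supp_sl) auto
        ultimately show False using not_solvable_sl[OF H(1) _ _ A nz] H(2) by blast
      qed
      moreover have "trace A = 0" using A H(1) by (auto simp: lie_subalgebra_def)
      ultimately show "A \<in> ?B" by (simp add: parabolic_sl_def supp_sl_def)
    qed
  qed (fact H(3))
  ultimately show ?thesis
    unfolding borel_subalgebra_def using lie_subalgebra_parabolic by blast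
qed

lemma parabolic_subalgebra_parabolic_sl:
  "parabolic_subalgebra special_linear (parabolic_sl a :: ('k::field_char_0^'n::finite^'n) set)"
proof -
  obtain f :: "'n \<Rightarrow> nat" and N :: nat where f: "f ` UNIV = {i. i < N}" "inj f"
    using finite_imp_inj_to_nat_seg[of "UNIV :: 'n set"] by auto
  then have lt: "f j < N" for j by auto
  \<comment> \<open>Multiplying by \<open>N\<close> leaves room for \<open>f\<close>, whose values
    are below \<open>N\<close>, to break ties without changing the order between different weights
    of \<open>a\<close>. The resulting Borel subalgebra lies in the given parabolic.\<close>
  define b where "b j = a j * int N + int (f j)" for j
  have mono: "a k \<le> a j" if "b k \<le> b j" for j k
  proof (rule ccontr)
    assume "\<not> a k \<le> a j"
    then have "(a j + 1) * int N \<le> a k * int N" by (intro mult_right_mono) auto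
    then show False using that lt[of j] by (simp add: b_def algebra_simps)
  qed
  have "inj b"
  proof (rule injI)
    fix j k assume "b j = b k"
    then have "a j = a k" using mono[of j k] mono[of k j] by simp
    with \<open>b j = b k\<close> show "j = k" using f(2) by (simp add: b_def inj_eq)
  qed
  then have "borel_subalgebra special_linear (parabolic_sl b :: ('k^'n^'n) set)"
    by (rule borel_parabolic_sl)
  moreover have "parabolic_sl b \<subseteq> (parabolic_sl a :: ('k^'n^'n) set)"
    unfolding parabolic_sl_def by (rule supp_sl_mono) (rule mono)
  ultimately show ?thesis
    unfolding parabolic_subalgebra_def using lie_subalgebra_parabolic by blast
qed

definition mrestrict :: "('n::finite \<Rightarrow> 'n \<Rightarrow> bool) \<Rightarrow> 'k::field^'n^'n \<Rightarrow> 'k^'n^'n" where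
  "mrestrict R A = (\<chi> j k. if R j k then A $ j $ k else 0)"

lemma mrestrict_nth [simp]: "mrestrict R A $ j $ k = (if R j k then A $ j $ k else 0)"
  by (simp add: mrestrict_def)

lemma trace_mrestrict_irreflexive: "(\<And>j. \<not> R j j) \<Longrightarrow> trace (mrestrict R A) = 0"
  and trace_mrestrict_reflexive: "(\<And>j. R j j) \<Longrightarrow> trace (mrestrict R A) = trace A"
  by (simp_all add: trace_def)

lemma levi_parabolic_sl:
  "levi_of_parabolic special_linear (parabolic_sl a :: ('k::field_char_0^'n::finite^'n) set)
    (parabolic_sl a \<inter> parabolic_sl (\<lambda>j. - a j))"
proof -
  let ?M = "parabolic_sl a \<inter> parabolic_sl (\<lambda>j. - a j) :: ('k^'n^'n) set"
  have M: "?M = supp_sl (\<lambda>j k. a j = a k)"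
    by (auto simp: parabolic_sl_def supp_sl_def intro: order_antisym)
  have "lie_subalgebra special_linear ?M" unfolding M by (rule lie_subalgebra_supp_sl) auto
  moreover have "?M \<inter> nil_sl a = {0}"
  proof -
    have "?M \<inter> nil_sl a = supp_sl (\<lambda>j k. a j = a k \<and> a k < a j)"
      unfolding M by (auto simp: nil_sl_def supp_sl_def)
    then show ?thesis by (simp add: supp_sl_empty)
  qed
  moreover have "parabolic_sl a = {x + u | x u. x \<in> ?M \<and> u \<in> nil_sl a}"
  proof (intro subset_antisym subsetI)
    fix A :: "'k^'n^'n" assume A: "A \<in> parabolic_sl a"
    have "A = mrestrict (\<lambda>j k. a j = a k) A + mrestrict (\<lambda>j k. a k < a j) A"
      using A by (force simp: vec_eq_iff parabolic_sl_def supp_sl_def)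
    moreover have "mrestrict (\<lambda>j k. a j = a k) A \<in> ?M" "mrestrict (\<lambda>j k. a k < a j) A \<in> nil_sl a"
      using A by (auto simp: M nil_sl_def parabolic_sl_def supp_sl_def
          trace_mrestrict_reflexive trace_mrestrict_irreflexive)
    ultimately show "A \<in> {x + u | x u. x \<in> ?M \<and> u \<in> nil_sl a}" by blast
  next
    fix A :: "'k^'n^'n" assume "A \<in> {x + u | x u. x \<in> ?M \<and> u \<in> nil_sl a}"
    then obtain x u where "A = x + u" "x \<in> parabolic_sl a" "u \<in> nil_sl a" by blast
    moreover have "nil_sl a \<subseteq> (parabolic_sl a :: ('k^'n^'n) set)"
      unfolding parabolic_sl_def nil_sl_def by (rule supp_sl_mono) simp
    moreover have "mat.subspace (parabolic_sl a :: ('k^'n^'n) set)"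
      unfolding parabolic_sl_def by (rule subspace_supp_sl)
    ultimately show "A \<in> parabolic_sl a" by (metis mat.subspace_add subsetD)
  qed
  ultimately show ?thesis
    unfolding levi_of_parabolic_def using is_nilradical_nil by blast
qed

lemma opposite_parabolics_sl:
  "opposite_parabolics special_linear (parabolic_sl a :: ('k::field_char_0^'n::finite^'n) set)
    (parabolic_sl (\<lambda>j. - a j))"
  unfolding opposite_parabolics_def
  using parabolic_subalgebra_parabolic_sl levi_parabolic_sl[of a] levi_parabolic_sl[of "\<lambda>j. - a j"]
  by (simp only: Int_commute minus_minus) blast

section \<open>The semidirect product and the contracted bracket\<close>

lemma proj_along_sl:
  fixes z :: "'k::field^'n::finite^'n"
  assumes "trace z = 0"
  shows "proj_along (parabolic_sl a) (nil_sl (\<lambda>j. - a j)) z = mrestrict (\<lambda>j k. a j < a k) z"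
  unfolding proj_along_def
proof (rule the_equality)
  show "mrestrict (\<lambda>j k. a j < a k) z \<in> nil_sl (\<lambda>j. - a j)
      \<and> z - mrestrict (\<lambda>j k. a j < a k) z \<in> parabolic_sl a"
    using assms by (auto simp: nil_sl_def parabolic_sl_def supp_sl_def trace_sub
        trace_mrestrict_irreflexive split: if_splits)
  fix u assume u: "u \<in> nil_sl (\<lambda>j. - a j) \<and> z - u \<in> parabolic_sl a"
  have "u $ j $ k = mrestrict (\<lambda>j k. a j < a k) z $ j $ k" for j k
  proof (cases "a j < a k")
    case True
    then have "(z - u) $ j $ k = 0" using u by (force simp: parabolic_sl_def supp_sl_def)
    then show ?thesis using True by simp
  next
    case False
    then show ?thesis using u by (force simp: nil_sl_def supp_sl_def)
  qed
  then show "u = mrestrict (\<lambda>j k. a j < a k) z" by (simp add: vec_eq_iff)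
qed

text \<open>Two factors of degree 0 always survive, a mixed pair survives exactly where the product
  has degree 1, and two factors of degree 1 never do because \<open>wt\<close> is at most 1. The
  middle case is the action on the quotient by the parabolic.\<close>

lemma cmult_parabolic_nil:
  fixes x y u v :: "'k::field^'n::finite^'n"
  assumes x: "x \<in> parabolic_sl a" and y: "y \<in> parabolic_sl a"
    and u: "u \<in> nil_sl (\<lambda>j. - a j)" and v: "v \<in> nil_sl (\<lambda>j. - a j)"
  shows "cmult a (x + u) (y + v) = x ** y + mrestrict (\<lambda>j k. a j < a k) (x ** v + u ** y)"
proof -
  have P: "z $ j $ k = 0" if "z \<in> parabolic_sl a" "a j < a k" for z :: "'k^'n^'n" and j k
    using that by (force simp: parabolic_sl_def supp_sl_def)
  have N: "z $ j $ k = 0" if "z \<in> nil_sl (\<lambda>j. - a j)" "\<not> a j < a k" for z :: "'k^'n^'n" and j k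
    using that by (force simp: nil_sl_def supp_sl_def)
  have "cmult a x y = x ** y"
    unfolding vec_eq_iff cmult_nth matrix_matrix_mult_def
    by (auto simp: survives_def wt_def intro!: sum.cong P[OF x] P[OF y])
  moreover have "cmult a x v = mrestrict (\<lambda>j k. a j < a k) (x ** v)"
    unfolding vec_eq_iff cmult_nth matrix_matrix_mult_def mrestrict_nth
    by (auto simp: survives_def wt_def intro!: sum.cong sum.neutral P[OF x] N[OF v])
  moreover have "cmult a u y = mrestrict (\<lambda>j k. a j < a k) (u ** y)"
    unfolding vec_eq_iff cmult_nth matrix_matrix_mult_def mrestrict_nth
    by (auto simp: survives_def wt_def intro!: sum.cong sum.neutral P[OF y] N[OF u])
  moreover have "cmult a u v = 0"
    unfolding vec_eq_iff cmult_nth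
    by (auto simp: survives_def wt_def intro!: sum.neutral N[OF u] N[OF v])
  ultimately show ?thesis
    by (simp add: cmult_add_left cmult_add_right vec_eq_iff)
qed

lemma lie_iso_parabolic_semidirect:
  "lie_iso (parabolic_semidirect special_linear (parabolic_sl a :: ('k::field^'n::finite^'n) set)
      (nil_sl (\<lambda>j. - a j))) (contraction a) (\<lambda>(x, u). x + u)"
proof -
  let ?P = "parabolic_sl a :: ('k^'n^'n) set" and ?N = "nil_sl (\<lambda>j. - a j) :: ('k^'n^'n) set"
  let ?r = "mrestrict (\<lambda>j k. a j < a k) :: 'k^'n^'n \<Rightarrow> _"
    and ?s = "mrestrict (\<lambda>j k. a k \<le> a j) :: 'k^'n^'n \<Rightarrow> _"
  have tr: "trace x = 0" if "x \<in> ?P \<or> x \<in> ?N" for x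
    using that by (auto simp: parabolic_sl_def nil_sl_def supp_sl_def)
  have r: "?r (x + u) = u" and s: "?s (x + u) = x" if "x \<in> ?P" "u \<in> ?N" for x u
    using that by (force simp: vec_eq_iff parabolic_sl_def nil_sl_def supp_sl_def)+
  have "bij_betw (\<lambda>(x, u). x + u) (?P \<times> ?N) {A. trace A = 0}"
  proof (rule bij_betw_byWitness[where f' = "\<lambda>A. (?s A, ?r A)"])
    show "(\<lambda>A. (?s A, ?r A)) ` {A. trace A = 0} \<subseteq> ?P \<times> ?N"
      by (auto simp: parabolic_sl_def nil_sl_def supp_sl_def
          trace_mrestrict_reflexive trace_mrestrict_irreflexive split: if_splits)
  qed (auto simp: r s tr trace_add vec_eq_iff)
  moreover have "x ** y - y ** x + (?r (x ** v - v ** x) - ?r (y ** u - u ** y))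
      = cbracket a (x + u) (y + v)"
    if "x \<in> ?P" "y \<in> ?P" "u \<in> ?N" "v \<in> ?N" for x y u v
    unfolding cbracket_def cmult_parabolic_nil[OF that] cmult_parabolic_nil[OF that(2,1,4,3)]
    by (simp add: vec_eq_iff)
  ultimately show ?thesis
    unfolding lie_iso_def parabolic_semidirect_def
    by (auto simp: proj_along_sl trace_commutator mat.scale_right_distrib)
qed

lemma lie_iso_compose:
  assumes "lie_iso L M f" "lie_iso M N g"
  shows "lie_iso L N (g \<circ> f)"
proof -
  have "f x \<in> lcarrier M" if "x \<in> lcarrier L" for x
    using assms(1) that by (auto simp: lie_iso_def bij_betw_def)
  then show ?thesis
    using assms by (auto simp: lie_iso_def intro: bij_betw_trans)
qed

lemma is_parabolic_contraction_of_iso: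
  fixes Q :: "('k::field_char_0, 'w::ab_group_add) lie_struct"
  assumes "lie_algebra Q" "lie_iso (contraction a :: ('k, 'k^'n::finite^'n) lie_struct) Q f"
  shows "is_parabolic_contraction (special_linear :: ('k, 'k^'n^'n) lie_struct) Q"
  unfolding is_parabolic_contraction_def
  using assms opposite_parabolics_sl is_nilradical_nil
    lie_iso_compose[OF lie_iso_parabolic_semidirect assms(2)] by blast

section \<open>Triangular form and centralisers\<close>

definition poly_act :: "'k::field poly \<Rightarrow> 'k^'n::finite^'n \<Rightarrow> 'k^'n \<Rightarrow> 'k^'n" where
  "poly_act p M v = (\<Sum>i\<le>degree p. coeff p i *s ((*v) M ^^ i) v)"

lemma poly_act_eq:
  assumes "degree p < N"
  shows "poly_act p M v = (\<Sum>i<N. coeff p i *s ((*v) M ^^ i) v)"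
  unfolding poly_act_def
  by (rule sum.mono_neutral_left) (use assms in \<open>auto simp: coeff_eq_0\<close>)

lemma poly_act_linear_factor:
  "poly_act ([:- c, 1:] * q) M v = poly_act q M (M *v v - c *s v)"
proof -
  define N where "N = Suc (Suc (degree q))"
  let ?p = "[:- c, 1:] * q"
  have pq: "?p = pCons 0 q - smult c q" by simp
  have "degree ?p < N"
    using degree_mult_le[of "[:- c, 1:]" q] unfolding N_def by simp
  then have "poly_act ?p M v = (\<Sum>i<N. coeff ?p i *s ((*v) M ^^ i) v)" by (rule poly_act_eq)
  also have "\<dots> = (\<Sum>i<N. coeff (pCons 0 q) i *s ((*v) M ^^ i) v)
      - c *s (\<Sum>i<N. coeff q i *s ((*v) M ^^ i) v)"
    unfolding pq by (simp add: vec.scale_left_diff_distrib sum_subtractf vec.scale_sum_right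
        vec.scale_scale)
  also have "(\<Sum>i<N. coeff (pCons 0 q) i *s ((*v) M ^^ i) v)
      = (\<Sum>i<Suc (degree q). coeff q i *s ((*v) M ^^ i) (M *v v))"
    unfolding N_def by (subst sum.lessThan_Suc_shift) (simp add: funpow_swap1)
  also have "(\<Sum>i<N. coeff q i *s ((*v) M ^^ i) v) = (\<Sum>i<Suc (degree q). coeff q i *s ((*v) M ^^ i) v)"
    unfolding N_def by (simp add: coeff_eq_0)
  finally have "poly_act ?p M v
      = (\<Sum>i<Suc (degree q). coeff q i *s (((*v) M ^^ i) (M *v v) - c *s ((*v) M ^^ i) v))"
    by (simp only: vec.scale_right_diff_distrib sum_subtractf vec.scale_sum_right
        vec.scale_scale mult.commute)
  moreover have "((*v) M ^^ i) (u - c *s w) = ((*v) M ^^ i) u - c *s ((*v) M ^^ i) w" for i u w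
    by (induction i) (simp_all add: vec.diff vec.scale)
  moreover have "poly_act q M w = (\<Sum>i<Suc (degree q). coeff q i *s ((*v) M ^^ i) w)" for w
    by (rule poly_act_eq) simp
  ultimately show ?thesis by simp
qed

text \<open>For a root \<open>c\<close> of \<open>p\<close>, either \<open>v\<close> is already an
  eigenvector modulo \<open>W\<close> for \<open>c\<close>, or \<open>M *v v - c *s v\<close> lies
  outside \<open>W\<close> and is sent into \<open>W\<close> by a factor of smaller degree. Working
  modulo \<open>W\<close> replaces the passage to a quotient space.\<close>

lemma eigenvector_mod_subspace_aux:
  fixes M :: "'k::alg_closed_field^'n::finite^'n"
  assumes "p \<noteq> 0" "poly_act p M v \<in> W" "v \<notin> W" and W: "vec.subspace W"
  shows "\<exists>u c. u \<notin> W \<and> M *v u - c *s u \<in> W"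
  using assms(1-3)
proof (induction "degree p" arbitrary: p v)
  case 0
  then obtain b where b: "p = [:b:]" by (metis degree_eq_zeroE)
  then have "b *s v \<in> W" "b \<noteq> 0" using 0 by (auto simp: poly_act_def)
  then have "(1 / b) *s (b *s v) \<in> W" using W by (metis vec.subspace_scale)
  then show ?case using 0 \<open>b \<noteq> 0\<close> by (simp add: vec.scale_scale)
next
  case (Suc d)
  then obtain c where "poly p c = 0" using alg_closed_imp_poly_has_root[of p] by auto
  then obtain q where q: "p = [:- c, 1:] * q" by (metis poly_eq_0_iff_dvd dvdE)
  then have "q \<noteq> 0" using Suc.prems by auto
  then have "degree p = Suc (degree q)" unfolding q by (subst degree_mult_eq) auto
  then have "d = degree q" using Suc.hyps(2) by simp
  show ?case
  proof (cases "M *v v - c *s v \<in> W")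
    case False
    moreover have "poly_act q M (M *v v - c *s v) \<in> W"
      using Suc.prems(2) unfolding q poly_act_linear_factor .
    ultimately show ?thesis using Suc.hyps(1)[OF \<open>d = degree q\<close> \<open>q \<noteq> 0\<close>] by blast
  qed (use Suc.prems in blast)
qed

lemma annihilating_polynomial_vector:
  fixes M :: "'k::field^'n::finite^'n"
  shows "\<exists>p. p \<noteq> 0 \<and> poly_act p M v = 0"
proof -
  let ?f = "\<lambda>i. ((*v) M ^^ i) v" and ?N = "Suc CARD('n)"
  show ?thesis
  proof (cases "inj_on ?f {..<?N}")
    case True
    then have "card (?f ` {..<?N}) = ?N" by (simp add: card_image)
    moreover have "vec.dim (?f ` {..<?N}) \<le> CARD('n)" by (rule dim_subset_UNIV_cart_gen)
    ultimately have "vec.dependent (?f ` {..<?N})" by (intro vec.dependent_biggerset_general) simp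
    then obtain S u x where S: "finite S" "S \<subseteq> ?f ` {..<?N}" "(\<Sum>x\<in>S. u x *s x) = 0" "x \<in> S" "u x \<noteq> 0"
      unfolding vec.dependent_explicit by blast
    define I where "I = {i. i < ?N \<and> ?f i \<in> S}"
    have img: "?f ` I = S" using S(2) by (auto simp: I_def)
    have injI: "inj_on ?f I" using True by (rule inj_on_subset) (auto simp: I_def)
    have finI: "finite I" by (simp add: I_def)
    define p where "p = (\<Sum>i\<in>I. monom (u (?f i)) i)"
    have cp: "coeff p i = (if i \<in> I then u (?f i) else 0)" for i
      unfolding p_def coeff_sum coeff_monom using finI by (simp add: sum.delta)
    obtain i where i: "i \<in> I" "x = ?f i" using S(4) img by blast
    then have "coeff p i \<noteq> 0" using S(5) cp by simp
    then have "p \<noteq> 0" by auto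
    have deg: "degree p < ?N"
      by (intro le_imp_less_Suc degree_le) (auto simp: cp I_def)
    have "poly_act p M v = (\<Sum>i<?N. coeff p i *s ?f i)" by (rule poly_act_eq[OF deg])
    also have "\<dots> = (\<Sum>i\<in>I. u (?f i) *s ?f i)"
      by (rule sum.mono_neutral_cong_right) (auto simp: cp I_def)
    also have "\<dots> = (\<Sum>x\<in>S. u x *s x)" unfolding img[symmetric] by (simp add: sum.reindex[OF injI])
    finally show ?thesis using S(3) \<open>p \<noteq> 0\<close> by auto
  next
    \<comment> \<open>A repetition among the iterates can make their image set too small for the
      dimension count, but then a difference of two monomials annihilates \<open>v\<close>.\<close>
    case False
    then obtain i j where ij: "?f i = ?f j" "i < ?N" "j < ?N" "i \<noteq> j" by (auto simp: inj_on_def)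
    define p where "p = monom (1 :: 'k) i - monom 1 j"
    have cp: "coeff p k = (if k = i then 1 else 0) - (if k = j then 1 else 0)" for k
      by (auto simp: p_def)
    have "coeff p i \<noteq> 0" using ij by (simp add: cp)
    then have "p \<noteq> 0" by auto
    have deg: "degree p < ?N"
      using ij by (intro le_imp_less_Suc degree_le) (auto simp: cp)
    have "poly_act p M v = (\<Sum>i<?N. coeff p i *s ?f i)" by (rule poly_act_eq[OF deg])
    also have "\<dots> = (\<Sum>k<?N. if k = i then ?f i else 0) - (\<Sum>k<?N. if k = j then ?f j else 0)"
      unfolding sum_subtractf[symmetric]
      by (intro sum.cong) (auto simp: cp)
    also have "\<dots> = 0" using ij by simp
    finally show ?thesis using \<open>p \<noteq> 0\<close> by auto
  qed
qed

lemma eigenvector_mod_subspace: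
  fixes M :: "'k::alg_closed_field^'n::finite^'n"
  assumes "vec.subspace W" "W \<noteq> UNIV"
  obtains u c where "u \<notin> W" "M *v u - c *s u \<in> W"
proof -
  obtain v where "v \<notin> W" using assms(2) by blast
  moreover obtain p where "p \<noteq> 0" "poly_act p M v = 0" using annihilating_polynomial_vector by blast
  moreover have "0 \<in> W" using assms(1) by (rule vec.subspace_0)
  ultimately show ?thesis
    using eigenvector_mod_subspace_aux[of p M v W] assms(1) that by auto
qed

text \<open>Each step adjoins an eigenvector of \<open>M\<close> modulo the span of the vectors
  chosen so far.\<close>

lemma invariant_flag:
  fixes M :: "'k::alg_closed_field^'n::finite^'n"
  assumes "k \<le> CARD('n)"
  shows "\<exists>u :: nat \<Rightarrow> 'k^'n. vec.dim (u ` {..<k}) = k \<and> (\<forall>i<k. M *v u i \<in> vec.span (u ` {..i}))"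
  using assms
proof (induction k)
  case (Suc k)
  then obtain u :: "nat \<Rightarrow> 'k^'n" where u: "vec.dim (u ` {..<k})
      = k" "\<forall>i<k. M *v u i \<in> vec.span (u ` {..i})"
    by auto
  let ?W = "vec.span (u ` {..<k})"
  have "vec.dim ?W \<noteq> vec.dim (UNIV :: ('k^'n) set)" unfolding vec_dim_card vec.dim_span
    using u(1) Suc.prems by linarith
  then have "?W \<noteq> UNIV" by metis
  then obtain x c where x: "x \<notin> ?W" "M *v x - c *s x \<in> ?W"
    using eigenvector_mod_subspace[OF vec.subspace_span] by metis
  define w where "w = u(k := x)"
  have w: "w k = x" "w ` {..<Suc k} = insert x (u ` {..<k})"
    by (auto simp: w_def lessThan_Suc)
  have wi: "w ` {..i} = u ` {..i}" "w i = u i" if "i < k" for i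
    using that by (auto simp: w_def lessThan_Suc)
  have "vec.dim (insert x (u ` {..<k})) = Suc k"
    using x(1) u(1) by (simp add: vec.dim_insert)
  then have "vec.dim (w ` {..<Suc k}) = Suc k" by (simp only: w(2))
  moreover have "M *v w i \<in> vec.span (w ` {..i})" if "i < Suc k" for i
  proof (cases "i = k")
    case True
    have "M *v x - c *s x \<in> vec.span (w ` {..k})"
      using x(2) w(2) by (metis lessThan_Suc_atMost subsetD subset_insertI vec.span_mono)
    moreover have "x \<in> vec.span (w ` {..k})"
      using w(1) by (auto intro: vec.span_base)
    ultimately have "(M *v x - c *s x) + c *s x \<in> vec.span (w ` {..k})"
      by (intro vec.span_add vec.span_scale)
    then show ?thesis using True w(1) by simp
  qed (use that wi u(2) in simp)
  ultimately show ?case by blast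
qed simp

text \<open>The index type carries no order, so triangularity is expressed through an injective
  numbering \<open>f\<close> of the indices. The columns of \<open>S\<close> are a basis adapted to
  an invariant flag.\<close>

lemma triangular_form:
  fixes M :: "'k::alg_closed_field^'n::finite^'n"
  obtains S S' C :: "'k^'n^'n" and f :: "'n \<Rightarrow> nat"
  where "S ** S' = mat 1" "S' ** S = mat 1" "M ** S = S ** C" "inj f"
    "\<And>i j. C $ i $ j \<noteq> 0 \<Longrightarrow> f i \<le> f j"
proof -
  let ?n = "CARD('n)"
  obtain u :: "nat \<Rightarrow> 'k^'n" where u: "vec.dim (u ` {..<?n})
      = ?n" "\<And>i. i < ?n \<Longrightarrow> M *v u i \<in> vec.span (u ` {..i})"
    using invariant_flag[of ?n M] by auto
  obtain f :: "'n \<Rightarrow> nat" where f: "bij_betw f UNIV {..<?n}"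
    using ex_bij_betw_finite_nat[of "UNIV :: 'n set"] by (auto simp: atLeast0LessThan)
  have f_img: "\<exists>j. i = f j" if "i < ?n" for i
    using f that unfolding bij_betw_def by blast
  have f_lt: "f j < ?n" for j using f unfolding bij_betw_def by blast
  have inj: "inj f" using f by (simp add: bij_betw_def)
  define S where "S = (\<chi> i j. u (f j) $ i)"
  have Sv: "S *v c = (\<Sum>j\<in>UNIV. c $ j *s u (f j))" for c
    by (simp add: vec_eq_iff S_def matrix_vector_mult_def mult.commute)
  have span: "\<exists>c. x = S *v c \<and> (\<forall>i. c $ i \<noteq> 0 \<longrightarrow> f i \<le> m)" if x: "x \<in> vec.span (u ` {..m})"
    and m: "m < ?n" for x m
    using x
  proof (induction rule: vec.span_induct_alt)
    case base
    show ?case by (rule exI[of _ 0]) simp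
  next
    case (step b x y)
    then obtain c i where c: "y = S *v c" "\<forall>i. c $ i \<noteq> 0 \<longrightarrow> f i \<le> m" and i: "x = u i" "i \<le> m" by auto
    then obtain j where j: "i = f j" using f_img m by fastforce
    have "S *v axis j b = b *s x"
      unfolding Sv by (subst sum.remove[of _ j]) (auto simp: axis_def i j intro!: sum.neutral)
    then have "b *s x + y = S *v (axis j b + c)" using c by (simp add: matrix_vector_right_distrib)
    moreover have "(axis j b + c) $ i \<noteq> 0 \<longrightarrow> f i \<le> m" for i
      using c(2) i j by (auto simp: axis_def)
    ultimately show ?case by blast
  qed
  have span_all: "vec.span (u ` {..<?n}) = UNIV"
    using u(1) by (intro vec.dim_eq_full[THEN iffD1]) (simp add: vec.dimension_def
        flip: vec.dim_UNIV vec_dim_card)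
  have n: "?n > 0" by simp
  have "{..?n - 1} = {..<?n}" using n by (auto simp del: zero_less_card_finite)
  then have full: "x \<in> vec.span (u ` {..?n - 1})" for x
    using span_all by (simp only: UNIV_I)
  have "\<exists>c. x = S *v c" for x
    using span[OF full[of x] diff_less[OF zero_less_one n]] by blast
  then have "surj ((*v) S)" unfolding surj_def by (rule allI)
  then obtain S' where S': "S ** S' = mat 1"
    using matrix_right_invertible_surjective by blast
  then have S'': "S' ** S = mat 1" by (rule matrix_left_right_inverse1)
  define C where "C = S' ** (M ** S)"
  have MS: "M ** S = S ** C"
    unfolding C_def matrix_mul_assoc S' by simp
  have "f i \<le> f j" if nz: "C $ i $ j \<noteq> 0" for i j
  proof -
    obtain c where c: "M *v u (f j) = S *v c" "\<forall>i. c $ i \<noteq> 0 \<longrightarrow> f i \<le> f j"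
      using span[OF u(2)[OF f_lt[of j]] f_lt[of j]] by auto
    have "C *v axis j 1 = S' *v (M *v (S *v axis j 1))"
      by (simp add: C_def matrix_vector_mul_assoc matrix_mul_assoc)
    also have "S *v axis j 1 = u (f j)"
      unfolding Sv by (subst sum.remove[of _ j]) (auto simp: axis_def intro!: sum.neutral)
    also have "S' *v (M *v u (f j)) = c"
      unfolding c(1) matrix_vector_mul_assoc S'' by simp
    finally have "C *v axis j 1 = c" .
    moreover have "(C *v axis j 1) $ i = C $ i $ j"
      unfolding matrix_vector_mult_def by (simp add: axis_def if_distrib cong: if_cong)
    ultimately show ?thesis using nz c(2) by auto
  qed
  then show ?thesis using that[OF S' S'' MS inj] by blast
qed

lemma mat_linear_mult: "mat_linear (\<lambda>X. A ** X ** B)"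
proof (rule mat_linearI)
  fix X Y c
  show "A ** (X + Y) ** B = A ** X ** B + A ** Y ** B"
    by (simp add: matrix_add_ldistrib vec_eq_iff matrix_matrix_mult_def sum.distrib algebra_simps)
  show "A ** matrix_scale c X ** B = matrix_scale c (A ** X ** B)"
    by (auto simp: vec_eq_iff matrix_matrix_mult_def sum_distrib_left sum_distrib_right algebra_simps intro!: sum.cong)
qed

lemma mat_dim_le_of_inj:
  fixes f :: "'k::field^'n::finite^'n \<Rightarrow> 'k^'n^'n"
  assumes "mat_linear f" "inj f" "f ` V \<subseteq> W"
  shows "mat.dim V \<le> mat.dim W"
  using mats.dim_image_eq[OF assms(1) inj_on_subset[OF assms(2) subset_UNIV], of V]
    mat.dim_subset[OF assms(3)] by simp

text \<open>
  The commutator with an upper triangular matrix maps the upper triangular matrices to the strictly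
  upper triangular ones, and the two spaces differ in dimension by \<open>n\<close>.
\<close>

lemma centraliser_dim_ge:
  fixes M :: "'k::alg_closed_field^'n::finite^'n"
  shows "CARD('n) \<le> mat.dim {X. M ** X = X ** M}"
proof -
  obtain S S' C :: "'k^'n^'n" and f :: "'n \<Rightarrow> nat"
    where S: "S ** S' = mat 1" "S' ** S = mat 1" and MS: "M ** S = S ** C" and inj: "inj f"
      and C: "\<And>i j. C $ i $ j \<noteq> 0 \<Longrightarrow> f i \<le> f j"
    using triangular_form[of M] by blast
  let ?T = "{(i, j). f i \<le> f j}" and ?T' = "{(i, j). f i < f j}"
  let ?U = "coord_space ?T :: ('k^'n^'n) set"
  let ?ad = "\<lambda>X. C ** X - X ** C"
  have lin: "mat_linear ?ad"
    using mats.linear_compose_sub[OF mat_linear_mult[of C "mat 1"] mat_linear_mult[of "mat 1" C]]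
      by simp
  have "?ad ` ?U \<subseteq> coord_space ?T'"
  proof
    fix Y assume "Y \<in> ?ad ` ?U"
    then obtain X where X: "\<And>i j. X $ i $ j \<noteq> 0 \<Longrightarrow> f i \<le> f j" and Y: "Y = C ** X - X ** C"
      by (auto simp: coord_space_def)
    have prod: "A $ i $ k * B $ k $ i = (if k = i then A $ i $ i * B $ i $ i else 0)"
      if A: "\<And>i j. A $ i $ j \<noteq> 0 \<Longrightarrow> f i \<le> f j" and B: "\<And>i j. B $ i $ j \<noteq> 0 \<Longrightarrow> f i \<le> f j"
      for A B :: "'k^'n^'n" and i k
    proof (cases "A $ i $ k = 0 \<or> B $ k $ i = 0")
      case False
      then have "f i = f k" using A B by (meson order_antisym)
      then show ?thesis using inj by (simp add: inj_eq)
    qed auto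
    have mul: "(A ** B) $ i $ i = A $ i $ i * B $ i $ i"
      if A: "\<And>i j. A $ i $ j \<noteq> 0 \<Longrightarrow> f i \<le> f j" and B: "\<And>i j. B $ i $ j \<noteq> 0 \<Longrightarrow> f i \<le> f j"
      for A B :: "'k^'n^'n" and i
      unfolding matrix_matrix_mult_def vec_lambda_beta
        by (subst sum.cong[OF refl prod[OF A B]]) simp_all
    have "Y $ i $ i = 0" for i
    proof -
      have "(C ** X) $ i $ i = C $ i $ i * X $ i $ i" by (rule mul) (fact C X)+
      moreover have "(X ** C) $ i $ i = X $ i $ i * C $ i $ i" by (rule mul) (fact C X)+
      ultimately show ?thesis by (simp add: Y mult.commute)
    qed
    moreover have "f i \<le> f j" if "Y $ i $ j \<noteq> 0" for i j
    proof -
      have "(C ** X) $ i $ j \<noteq> 0 \<or> (X ** C) $ i $ j \<noteq> 0" using that Y by auto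
      then show ?thesis by (elim disjE matrix_mult_supp) (meson C X order_trans)+
    qed
    ultimately have "f i < f j" if "Y $ i $ j \<noteq> 0" for i j
      using that inj by (metis inj_eq order_le_less)
    then show "Y \<in> coord_space ?T'" by (simp add: coord_space_def)
  qed
  from mat.dim_subset[OF this] have "mat.dim (?ad ` ?U) \<le> card ?T'"
    by (simp only: dim_coord_space)
  moreover have "card ?T = card ?T' + CARD('n)"
  proof -
    have "?T = ?T' \<union> (\<lambda>i. (i, i)) ` UNIV" using inj by (auto simp: order_le_less inj_eq)
    moreover have "?T' \<inter> (\<lambda>i. (i, i)) ` UNIV = {}" by auto
    moreover have "card ((\<lambda>i :: 'n. (i, i)) ` UNIV) = CARD('n)" by (simp add: card_image inj_on_def)
    ultimately show ?thesis by (simp add: card_Un_disjoint)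
  qed
  moreover have "card ?T = mat.dim (?ad ` ?U) + mat.dim {X \<in> ?U. ?ad X = 0}"
    using mat_rank_nullity[OF lin coord_space_subspace, of ?T] by (simp only: dim_coord_space)
  ultimately have "CARD('n) \<le> mat.dim {X \<in> ?U. ?ad X = 0}" by linarith
  \<comment> \<open>Conjugation by \<open>S\<close> leads injectively from the upper triangular part
    of the centraliser of \<open>C\<close> into the full centraliser of \<open>M\<close>.\<close>
  also have "\<dots> \<le> mat.dim {X. M ** X = X ** M}"
  proof (rule mat_dim_le_of_inj)
    show "mat_linear (\<lambda>X. S ** X ** S')" by (rule mat_linear_mult)
    show "inj (\<lambda>X. S ** X ** S')"
    proof (rule inj_on_inverseI[where g = "\<lambda>X. S' ** X ** S"])
      fix X
      have "S' ** (S ** X ** S') ** S = (S' ** S) ** X ** (S' ** S)" by (simp add: matrix_mul_assoc)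
      then show "S' ** (S ** X ** S') ** S = X" by (simp add: S)
    qed
    show "(\<lambda>X. S ** X ** S') ` {X \<in> ?U. ?ad X = 0} \<subseteq> {X. M ** X = X ** M}"
    proof clarify
      fix X assume "?ad X = 0"
      then have CX: "C ** X = X ** C" by simp
      have "M ** (S ** X ** S') = S ** (C ** X) ** S'" by (simp add: matrix_mul_assoc MS)
      also have "\<dots> = S ** X ** (C ** S')" by (simp add: CX matrix_mul_assoc)
      also have "C ** S' = S' ** (S ** C) ** S'" by (simp add: matrix_mul_assoc S)
      also have "\<dots> = S' ** M" unfolding MS[symmetric] by (simp add: S flip: matrix_mul_assoc)
      finally show "M ** (S ** X ** S') = S ** X ** S' ** M" by (simp add: matrix_mul_assoc)
    qed
  qed
  finally show ?thesis .
qed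

section \<open>The index of the contracted Lie algebra\<close>

text \<open>Let \<open>M\<close> stand for the linear form given by the trace against
  \<open>M\<close>. The value of that form on \<open>cbracket a X Y\<close>, as a functional of
  \<open>Y\<close>, is again represented through the trace, by this matrix. For constant weights it
  is the commutator of \<open>M\<close> and \<open>X\<close>.\<close>

definition form :: "('n::finite \<Rightarrow> int) \<Rightarrow> 'k::field^'n^'n \<Rightarrow> 'k^'n^'n \<Rightarrow> 'k^'n^'n" where
  "form a M X = (\<chi> l k. (\<Sum>j\<in>UNIV. if survives a j k l then M $ l $ j * X $ j $ k else 0)
    - (\<Sum>j\<in>UNIV. if survives a k l j then M $ j $ k * X $ l $ j else 0))"

text \<open>The terms that the contraction drops, so that \<open>form a M X + coform a M X\<close>
  is the full commutator.\<close>

definition coform :: "('n::finite \<Rightarrow> int) \<Rightarrow> 'k::field^'n^'n \<Rightarrow> 'k^'n^'n \<Rightarrow> 'k^'n^'n" where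
  "coform a M X = (\<chi> l k. (\<Sum>j\<in>UNIV. if survives a j k l then 0 else M $ l $ j * X $ j $ k)
    - (\<Sum>j\<in>UNIV. if survives a k l j then 0 else M $ j $ k * X $ l $ j))"

lemma form_nth: "form a M X $ l $ k = (\<Sum>j\<in>UNIV. if survives a j k l then M $ l $ j * X $ j $ k else 0)
    - (\<Sum>j\<in>UNIV. if survives a k l j then M $ j $ k * X $ l $ j else 0)"
  by (simp add: form_def)

lemma mat_linear_form: "mat_linear (form a (M :: 'k::field^'n::finite^'n))"
proof (rule mat_linearI)
  fix X Y :: "'k^'n^'n" and c
  have *: "(if P then m * (x + y) else 0) = (if P then m * x else 0) + (if P then m * y else 0)"
    and **: "(if P then m * (c * x) else 0) = c * (if P then m * x else 0)" for P and m x y :: 'k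
    by (auto simp: algebra_simps)
  show "form a M (X + Y) = form a M X + form a M Y"
    unfolding form_def vec_eq_iff vec_lambda_beta vector_add_component * sum.distrib by simp
  show "form a M (matrix_scale c X) = matrix_scale c (form a M X)"
    unfolding form_def vec_eq_iff vec_lambda_beta matrix_scale_nth ** sum_distrib_left[symmetric]
      right_diff_distrib by simp
qed

lemma mat_linear_coform: "mat_linear (coform a (M :: 'k::field^'n::finite^'n))"
proof (rule mat_linearI)
  fix X Y :: "'k^'n^'n" and c
  have *: "(if P then 0 else m * (x + y)) = (if P then 0 else m * x) + (if P then 0 else m * y)"
    and **: "(if P then 0 else m * (c * x)) = c * (if P then 0 else m * x)" for P and m x y :: 'k
    by (auto simp: algebra_simps)
  show "coform a M (X + Y) = coform a M X + coform a M Y"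
    unfolding coform_def vec_eq_iff vec_lambda_beta vector_add_component * sum.distrib by simp
  show "coform a M (matrix_scale c X) = matrix_scale c (coform a M X)"
    unfolding coform_def vec_eq_iff vec_lambda_beta matrix_scale_nth ** sum_distrib_left[symmetric]
      right_diff_distrib by simp
qed

lemma trace_form:
  "trace (M ** cbracket a X Y) = (\<Sum>l\<in>UNIV. \<Sum>k\<in>UNIV. form a M X $ l $ k * Y $ k $ l)"
proof -
  have "trace (M ** cmult a X Y)
      = (\<Sum>l\<in>UNIV. \<Sum>j\<in>UNIV. \<Sum>k\<in>UNIV.
        if survives a j k l then M $ l $ j * X $ j $ k * Y $ k $ l else 0)"
    unfolding trace_def matrix_matrix_mult_def cmult_def vec_lambda_beta sum_distrib_left
    by (intro sum.cong refl) (simp add: mult.assoc)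
  also have "\<dots> = (\<Sum>l\<in>UNIV. \<Sum>k\<in>UNIV. \<Sum>j\<in>UNIV. if survives a j k l then M $ l $ j * X $ j $ k * Y $ k $ l else 0)"
    by (intro sum.cong refl sum.swap)
  also have "\<dots> = (\<Sum>l\<in>UNIV. \<Sum>k\<in>UNIV.
      (\<Sum>j\<in>UNIV. if survives a j k l then M $ l $ j * X $ j $ k else 0) * Y $ k $ l)"
    unfolding sum_distrib_right by (intro sum.cong refl) simp
  finally have 1: "trace (M ** cmult a X Y) = \<dots>" .
  have "trace (M ** cmult a Y X)
      = (\<Sum>k\<in>UNIV. \<Sum>j\<in>UNIV. \<Sum>l\<in>UNIV.
        if survives a j l k then M $ k $ j * X $ l $ k * Y $ j $ l else 0)"
    unfolding trace_def matrix_matrix_mult_def cmult_def vec_lambda_beta sum_distrib_left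
    by (intro sum.cong refl) (simp add: mult_ac)
  also have "\<dots> = (\<Sum>k\<in>UNIV. \<Sum>l\<in>UNIV. \<Sum>j\<in>UNIV. if survives a j l k then M $ k $ j * X $ l $ k * Y $ j $ l else 0)"
    by (intro sum.cong refl sum.swap)
  also have "\<dots> = (\<Sum>l\<in>UNIV. \<Sum>k\<in>UNIV. \<Sum>j\<in>UNIV. if survives a j l k then M $ k $ j * X $ l $ k * Y $ j $ l else 0)"
    by (rule sum.swap)
  also have "\<dots> = (\<Sum>l\<in>UNIV. \<Sum>j\<in>UNIV. \<Sum>k\<in>UNIV. if survives a j l k then M $ k $ j * X $ l $ k * Y $ j $ l else 0)"
    by (intro sum.cong refl sum.swap)
  also have "\<dots> = (\<Sum>l\<in>UNIV. \<Sum>k\<in>UNIV.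
      (\<Sum>j\<in>UNIV. if survives a k l j then M $ j $ k * X $ l $ j else 0) * Y $ k $ l)"
    unfolding sum_distrib_right by (intro sum.cong refl) simp
  finally have 2: "trace (M ** cmult a Y X) = \<dots>" .
  have "M ** cbracket a X Y = M ** cmult a X Y - M ** cmult a Y X"
    unfolding cbracket_def
    by (simp add: vec_eq_iff matrix_matrix_mult_def right_diff_distrib sum_subtractf)
  then show ?thesis
    by (simp only: trace_sub 1 2 form_nth left_diff_distrib sum_subtractf)
qed

text \<open>
  For \<open>t \<noteq> 0\<close> the rescaling \<open>E\<^sub>j\<^sub>k \<mapsto> t^(wt a j k) E\<^sub>j\<^sub>k\<close> carries the form \<open>form a M + t coform a M\<close> to
  a commutator with a rescaled matrix, so that the bound on centralisers applies; then let \<open>t \<rightarrow> 0\<close>.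
\<close>

lemma dim_form_kernel_ge:
  fixes M :: "'k::{alg_closed_field, field_char_0}^'n::finite^'n"
  shows "CARD('n) \<le> mat.dim {X. form a M X = 0}"
proof (rule kernel_dim_semicontinuous[OF mat_linear_form mat_linear_coform[of a M]])
  fix t :: 'k assume t: "t \<noteq> 0"
  \<comment> \<open>\<open>M\<close> is dual to the matrix variable: its entry \<open>(l, j)\<close>
    pairs with position \<open>(j, l)\<close>, hence the exponent with the indices
    exchanged.\<close>
  define M' where "M' = (\<chi> l j. M $ l $ j / t ^ wt a j l)"
  define \<psi> where "\<psi> X = (\<chi> j k. X $ j $ k / t ^ wt a j k)" for X :: "'k^'n^'n"
  have lin: "mat_linear \<psi>"
    by (rule mat_linearI) (simp_all add: \<psi>_def vec_eq_iff add_divide_distrib)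
  have inj: "inj \<psi>"
  proof (rule injI)
    fix X Y assume "\<psi> X = \<psi> Y"
    then show "X = Y" using t by (simp add: \<psi>_def vec_eq_iff)
  qed
  \<comment> \<open>With defect 0 the powers of \<open>t\<close> match as they stand; with defect 1
    the extra factor \<open>t\<close> makes up for the missing power.\<close>
  have first: "(if survives a j k l then M $ l $ j * \<psi> X $ j $ k else 0)
      + t * (if survives a j k l then 0 else M $ l $ j * \<psi> X $ j $ k)
      = t ^ wt a k l * (M' $ l $ j * X $ j $ k)" for X j k l
    using t by (auto simp: M'_def \<psi>_def survives_def wt_def power2_eq_square)
  have second: "(if survives a k l j then M $ j $ k * \<psi> X $ l $ j else 0)
      + t * (if survives a k l j then 0 else M $ j $ k * \<psi> X $ l $ j)
      = t ^ wt a k l * (X $ l $ j * M' $ j $ k)" for X j k l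
    using t by (auto simp: M'_def \<psi>_def survives_def wt_def power2_eq_square)
  have "\<psi> ` {X. M' ** X = X ** M'} \<subseteq> {X. form a M X + matrix_scale t (coform a M X) = 0}"
  proof clarify
    fix X assume comm: "M' ** X = X ** M'"
    have "(form a M (\<psi> X) + matrix_scale t (coform a M (\<psi> X))) $ l $ k
        = t ^ wt a k l * ((M' ** X) $ l $ k - (X ** M') $ l $ k)" for l k
    proof -
      have "(form a M (\<psi> X) + matrix_scale t (coform a M (\<psi> X))) $ l $ k
        = (\<Sum>j\<in>UNIV. (if survives a j k l then M $ l $ j * \<psi> X $ j $ k else 0)
            + t * (if survives a j k l then 0 else M $ l $ j * \<psi> X $ j $ k))
        - (\<Sum>j\<in>UNIV. (if survives a k l j then M $ j $ k * \<psi> X $ l $ j else 0)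
            + t * (if survives a k l j then 0 else M $ j $ k * \<psi> X $ l $ j))"
        unfolding sum.distrib sum_distrib_left[symmetric]
          by (simp add: form_def coform_def algebra_simps)
      then show ?thesis
        unfolding first second
        by (simp add: matrix_matrix_mult_def right_diff_distrib sum_distrib_left)
    qed
    then show "form a M (\<psi> X) + matrix_scale t (coform a M (\<psi> X)) = 0"
      using comm by (simp add: vec_eq_iff)
  qed
  then show "CARD('n) \<le> mat.dim {X. form a M X + matrix_scale t (coform a M X) = 0}"
    using mat_dim_le_of_inj[OF lin inj] centraliser_dim_ge[of M'] order_trans by blast
qed

section \<open>Ranks, cyclic rows and the upper bound for the kernel\<close>

definition rank_in :: "('n \<Rightarrow> 'b::linorder) \<Rightarrow> 'n set \<Rightarrow> 'n \<Rightarrow> nat" where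
  "rank_in g C i = card {x \<in> C. g x < g i}"

lemma rank_in_less_iff:
  assumes "finite C" "inj_on g C" "i \<in> C" "j \<in> C"
  shows "rank_in g C i < rank_in g C j \<longleftrightarrow> g i < g j"
proof -
  have mono: "rank_in g C i < rank_in g C j" if "g i < g j" "i \<in> C" for i j
    unfolding rank_in_def using that assms(1) by (intro psubset_card_mono) (auto intro: less_trans)
  show ?thesis
  proof
    assume less: "rank_in g C i < rank_in g C j"
    show "g i < g j"
    proof (rule ccontr)
      assume "\<not> g i < g j"
      then consider "g i = g j" | "g j < g i" by fastforce
      then show False
      proof cases
        case 1
        then show ?thesis using less by (simp add: rank_in_def)
      next
        case 2
        then show ?thesis using mono[of j i] less assms by simp
      qed
    qed
  qed (use mono assms in blast)
qed

lemma rank_in_bij: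
  assumes "finite C" "inj_on g C"
  shows "bij_betw (rank_in g C) C {..<card C}"
proof -
  have inj: "inj_on (rank_in g C) C"
  proof (rule inj_onI)
    fix i j assume ij: "i \<in> C" "j \<in> C" "rank_in g C i = rank_in g C j"
    then have "\<not> g i < g j" "\<not> g j < g i" using rank_in_less_iff[OF assms] by fastforce+
    then show "i = j" using ij assms(2) by (auto dest: inj_onD)
  qed
  have "rank_in g C i < card C" if "i \<in> C" for i
    unfolding rank_in_def using that assms(1) by (intro psubset_card_mono) auto
  then have "rank_in g C ` C \<subseteq> {..<card C}" by auto
  then have "rank_in g C ` C = {..<card C}"
    using card_image[OF inj] by (intro card_subset_eq) auto
  then show ?thesis using inj by (simp add: bij_betw_def)
qed

text \<open>This is the condition \<open>survives\<close> for a cyclic shift by one among ranks, at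
  any intermediate \<open>q\<close>. No natural number lies strictly between \<open>p\<close> and
  \<open>Suc p\<close>, so exactly one inequality holds on the left; at the wrap-around
  \<open>p\<close> is largest and its successor is 0, so neither does.\<close>

lemma cyclic_rank_cases:
  fixes p q l :: nat
  assumes "p < l" "q < l"
  shows "(if p < q then 1 else 0 :: nat) + (if q < Suc p mod l then 1 else 0)
      = (if p < Suc p mod l then 1 else 0)"
proof (cases "Suc p = l")
  case False
  then have "Suc p mod l = Suc p" using assms by simp
  then show ?thesis by simp
qed (use assms in auto)

text \<open>
  Think of the basis vectors of weight \<open>i\<close> as a column of boxes in position \<open>i\<close>, bottom aligned.
  Then \<open>\<rho>\<close> is the height of a box, and \<open>\<pi>\<close> moves each box to the next one at the same height,
  cyclically. Without the closing arrows this is the diagram of a Richardson element.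
\<close>

lemma cyclic_row_permutation:
  fixes a :: "'n::finite \<Rightarrow> int"
  obtains \<rho> :: "'n \<Rightarrow> nat" and \<pi> \<tau> :: "'n \<Rightarrow> 'n" and e :: "'n \<Rightarrow> nat"
  where "inj \<pi>" "\<And>j. \<rho> (\<pi> j) = \<rho> j" "\<And>j k. \<rho> j \<le> \<rho> k \<Longrightarrow> survives a j k (\<pi> j)"
    "\<And>j. (\<pi> ^^ e j) (\<tau> j) = j" "\<And>j k. \<rho> j = \<rho> k \<Longrightarrow> \<tau> j = \<tau> k" "\<And>j. \<rho> (\<tau> j) = \<rho> j"
proof -
  obtain f :: "'n \<Rightarrow> nat" where f: "inj f"
    using finite_imp_inj_to_nat_seg[of "UNIV :: 'n set"] by auto
  define col where "col k = {i. a i = a k}" for k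
  define \<rho> where "\<rho> j = rank_in f (col j) j" for j
  define row where "row h = {i. \<rho> i = h}" for h
  have col_bij: "bij_betw \<rho> (col k) {..<card (col k)}" for k
  proof -
    have "bij_betw (rank_in f (col k)) (col k) {..<card (col k)}"
      using inj_on_subset[OF f] by (intro rank_in_bij) auto
    moreover have "rank_in f (col k) i = \<rho> i" if "i \<in> col k" for i
      using that by (simp add: \<rho>_def col_def)
    ultimately show ?thesis using bij_betw_cong by blast
  qed
  have inj_row: "inj_on a (row h)" for h
  proof (rule inj_onI)
    fix i j assume "i \<in> row h" "j \<in> row h" "a i = a j"
    then have "i \<in> col j" "j \<in> col j" "\<rho> i = \<rho> j" by (auto simp: row_def col_def)
    then show "i = j" using col_bij[of j] by (meson bij_betw_def inj_onD)
  qed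
  define r where "r j = rank_in a (row (\<rho> j)) j" for j
  define el where "el h q = inv_into (row h) r q" for h q
  have row_bij: "bij_betw r (row h) {..<card (row h)}" for h
  proof -
    have "bij_betw (rank_in a (row h)) (row h) {..<card (row h)}"
      using inj_row by (intro rank_in_bij) auto
    moreover have "rank_in a (row h) i = r i" if "i \<in> row h" for i
      using that by (simp add: r_def row_def)
    ultimately show ?thesis using bij_betw_cong by blast
  qed
  have r_lt: "r j < card (row (\<rho> j))" for j
    using row_bij[of "\<rho> j"] by (auto simp: bij_betw_def row_def)
  have el: "\<rho> (el h q) = h" "r (el h q) = q" if "q < card (row h)" for h q
  proof -
    have "q \<in> r ` row h" using row_bij[of h] that by (simp add: bij_betw_def)
    then show "\<rho> (el h q) = h" "r (el h q) = q"
      unfolding el_def using inv_into_into[of q r "row h"] f_inv_into_f[of q r "row h"]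
        by (auto simp: row_def)
  qed
  have eqI: "i = j" if "\<rho> i = \<rho> j" "r i = r j" for i j
    using row_bij[of "\<rho> j"] that unfolding bij_betw_def inj_on_def by (simp add: row_def)
  define \<pi> where "\<pi> j = el (\<rho> j) (Suc (r j) mod card (row (\<rho> j)))" for j
  define \<tau> where "\<tau> j = el (\<rho> j) 0" for j
  have pos: "0 < card (row (\<rho> j))" for j using r_lt[of j] by linarith
  have \<pi>: "\<rho> (\<pi> j) = \<rho> j" "r (\<pi> j) = Suc (r j) mod card (row (\<rho> j))" for j
    unfolding \<pi>_def using el pos by simp_all
  have \<tau>: "\<rho> (\<tau> j) = \<rho> j" "r (\<tau> j) = 0" for j
    unfolding \<tau>_def using el pos by simp_all
  have "inj \<pi>"
  proof (rule injI)
    fix i j assume eq: "\<pi> i = \<pi> j"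
    then have \<rho>: "\<rho> i = \<rho> j" using \<pi>(1) by metis
    then have "Suc (r i) mod card (row (\<rho> j)) = Suc (r j) mod card (row (\<rho> j))"
      using eq \<pi>(2) by metis
    moreover have "r i < card (row (\<rho> j))" "r j < card (row (\<rho> j))" using r_lt \<rho> by metis+
    ultimately have "r i = r j"
      by (cases "Suc (r i) = card (row (\<rho> j))"; cases "Suc (r j) = card (row (\<rho> j))") auto
    then show "i = j" using \<rho> eqI by blast
  qed
  moreover have "survives a j k (\<pi> j)" if "\<rho> j \<le> \<rho> k" for j k
  proof -
    \<comment> \<open>The column of \<open>k\<close> reaches height \<open>\<rho> j\<close>, so it
      has a box in the row of \<open>j\<close>. That box has the same weight as \<open>k\<close> and
      stands in for it, which turns the claim into a comparison of ranks within one row.\<close>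
    have "\<rho> k < card (col k)" using col_bij[of k] by (auto simp: bij_betw_def col_def)
    then have "\<rho> j \<in> \<rho> ` col k" using col_bij[of k] that by (simp add: bij_betw_def)
    then obtain i where i: "a i = a k" "\<rho> i = \<rho> j" by (auto simp: col_def)
    have a_iff: "a x < a y \<longleftrightarrow> r x < r y" if "\<rho> x = \<rho> j" "\<rho> y = \<rho> j" for x y
      using rank_in_less_iff[OF _ inj_row[of "\<rho> j"], of x y] that by (simp add: r_def row_def)
    have "r i < card (row (\<rho> j))" using r_lt[of i] i by simp
    then show ?thesis
      unfolding survives_def wt_def i(1)[symmetric]
      using cyclic_rank_cases[OF r_lt[of j]] by (simp add: a_iff i(2) \<pi>)
  qed
  moreover have "(\<pi> ^^ r j) (\<tau> j) = j" for j
  proof -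
    have "\<rho> ((\<pi> ^^ q) (\<tau> j)) = \<rho> j \<and> r ((\<pi> ^^ q) (\<tau> j)) = q" if "q < card (row (\<rho> j))" for q
      using that by (induction q) (simp_all add: \<pi> \<tau>)
    then show ?thesis using r_lt[of j] eqI by blast
  qed
  moreover have "\<tau> j = \<tau> k" if "\<rho> j = \<rho> k" for j k using that by (simp add: \<tau>_def)
  ultimately show ?thesis using that \<pi>(1) \<tau>(1) by blast
qed

text \<open>Each kernel equation compares \<open>X $ j $ k\<close> with the entry moved by
  \<open>\<pi>\<close> in both indices. Across different rows of the diagram a nonzero entry would
  return to itself multiplied by a factor other than 1. Within one row the entries are constant
  along orbits, and every orbit contains an entry whose first index is the representative
  \<open>\<tau>\<close> of that row; there is one such entry for each second index.\<close>

lemma dim_form_kernel_le: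
  fixes a :: "'n::finite \<Rightarrow> int"
  shows "\<exists>M :: 'k::field_char_0^'n^'n. mat.dim {X. form a M X = 0} \<le> CARD('n)"
proof -
  obtain \<rho> :: "'n \<Rightarrow> nat" and \<pi> \<tau> e
    where inj: "inj \<pi>" and \<rho>\<pi>: "\<And>j. \<rho> (\<pi> j) = \<rho> j"
      and surv: "\<And>j k. \<rho> j \<le> \<rho> k \<Longrightarrow> survives a j k (\<pi> j)"
      and orbit: "\<And>j. (\<pi> ^^ e j) (\<tau> j) = j" and \<tau>: "\<And>j k. \<rho> j = \<rho> k \<Longrightarrow> \<tau> j = \<tau> k" "\<And>j. \<rho> (\<tau> j) = \<rho> j"
    by (rule cyclic_row_permutation[of a]) (rule that; assumption)
  define M :: "'k^'n^'n" where "M = (\<chi> l j. if l = \<pi> j then 2 ^ \<rho> j else 0)"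
  let ?K = "{X. form a M X = 0}"
  have \<rho>_pow: "\<rho> ((\<pi> ^^ m) j) = \<rho> j" for m j by (induction m) (simp_all add: \<rho>\<pi>)
  have key: "(if survives a j k (\<pi> j) then 2 ^ \<rho> j * X $ j $ k else 0)
      = (if survives a k (\<pi> j) (\<pi> k) then 2 ^ \<rho> k * X $ \<pi> j $ \<pi> k else 0)" if X: "X \<in> ?K" for X j k
  proof -
    have "(\<Sum>i\<in>UNIV. if survives a i k (\<pi> j) then M $ \<pi> j $ i * X $ i $ k else 0)
        = (\<Sum>i\<in>UNIV. if i = j then (if survives a j k (\<pi> j) then 2 ^ \<rho> j * X $ j $ k else 0) else 0)"
      using inj by (intro sum.cong) (auto simp: M_def inj_eq)
    moreover have "(\<Sum>i\<in>UNIV. if survives a k (\<pi> j) i then M $ i $ k * X $ \<pi> j $ i else 0)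
        = (\<Sum>i\<in>UNIV.
          if i = \<pi> k then (if survives a k (\<pi> j) (\<pi> k) then 2 ^ \<rho> k * X $ \<pi> j $ \<pi> k else 0) else 0)"
      by (intro sum.cong) (auto simp: M_def)
    moreover have "form a M X $ \<pi> j $ k = 0" using X by simp
    ultimately show ?thesis by (simp add: form_nth)
  qed
  have pow2: "(2 :: 'k) ^ q = 2 ^ (q - p) * 2 ^ p" if "p \<le> q" for p q :: nat
    using that by (simp flip: power_add)
  \<comment> \<open>In general only the term whose path starts in the lower of the two diagram rows
    is certain to survive. If the other term is dropped, the entry in the surviving term is 0;
    otherwise the two entries are proportional. Hence one direction for each ordering of the
    rows.\<close>
  have less: "X $ j $ k = 0 \<or> X $ j $ k = 2 ^ (\<rho> k - \<rho> j) * X $ \<pi> j $ \<pi> k"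
    if X: "X \<in> ?K" and le: "\<rho> j \<le> \<rho> k" for X j k
  proof -
    have "2 ^ \<rho> j * X $ j $ k = (if survives a k (\<pi> j) (\<pi> k) then 2 ^ \<rho> k * X $ \<pi> j $ \<pi> k else 0)"
      using key[OF X, of j k] surv[OF le] by simp
    then show ?thesis
      unfolding pow2[OF le] by (simp add: mult.assoc mult.left_commute split: if_splits)
  qed
  have greater: "X $ \<pi> j $ \<pi> k = 0 \<or> X $ \<pi> j $ \<pi> k = 2 ^ (\<rho> j - \<rho> k) * X $ j $ k"
    if X: "X \<in> ?K" and le: "\<rho> k \<le> \<rho> j" for X j k
  proof -
    have "2 ^ \<rho> k * X $ \<pi> j $ \<pi> k = (if survives a j k (\<pi> j) then 2 ^ \<rho> j * X $ j $ k else 0)"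
      using key[OF X, of j k] surv[of k "\<pi> j"] le \<rho>\<pi>[of j] by simp
    then show ?thesis
      unfolding pow2[OF le] by (simp add: mult.assoc mult.left_commute split: if_splits)
  qed
  \<comment> \<open>A common period of both indices lets the proportionality be followed until it
    returns to the same entry.\<close>
  have period: "\<exists>N>0. (\<pi> ^^ N) j = j \<and> (\<pi> ^^ N) k = k" for j k
  proof -
    let ?\<sigma> = "map_prod \<pi> \<pi>"
    have "inj ?\<sigma>" using inj by (rule prod.inj_map[OF inj])
    then obtain N where "N > 0" "(?\<sigma> ^^ N) (j, k) = (j, k)"
      by (rule funpow_inj_finite) simp
    moreover have "(?\<sigma> ^^ N) (j, k) = ((\<pi> ^^ N) j, (\<pi> ^^ N) k)" for N by (induction N) simp_all
    ultimately show ?thesis by auto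
  qed
  have two: "(2 ^ d) ^ N \<noteq> (1 :: 'k)" if "d > 0" "N > 0" for d N :: nat
  proof
    assume "(2 ^ d) ^ N = (1 :: 'k)"
    then have "of_nat (2 ^ (d * N)) = (of_nat 1 :: 'k)" by (simp add: power_mult)
    then have "(2 :: nat) ^ (d * N) = 1" by (simp only: of_nat_eq_iff)
    then show False using that by simp
  qed
  have off: "X $ j $ k = 0" if X: "X \<in> ?K" and ne: "\<rho> j \<noteq> \<rho> k" for X j k
  proof -
    obtain N where N: "N > 0" "(\<pi> ^^ N) j = j" "(\<pi> ^^ N) k = k" using period by blast
    show ?thesis
    proof (cases "\<rho> j < \<rho> k")
      case True
      have "X $ j $ k = 0 \<or> X $ j $ k = (2 ^ (\<rho> k - \<rho> j)) ^ m * X $ (\<pi> ^^ m) j $ (\<pi> ^^ m) k" for m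
      proof (induction m)
        case (Suc m)
        then show ?case
          using less[OF X, of "(\<pi> ^^ m) j" "(\<pi> ^^ m) k"] True by (auto simp: \<rho>_pow)
      qed simp
      from this[of N] show ?thesis using N two[of "\<rho> k - \<rho> j" N] True by simp
    next
      case False
      have "X $ (\<pi> ^^ m) j $ (\<pi> ^^ m) k = 0
          \<or> X $ (\<pi> ^^ m) j $ (\<pi> ^^ m) k = (2 ^ (\<rho> j - \<rho> k)) ^ m * X $ j $ k" for m
      proof (induction m)
        case (Suc m)
        then show ?case
          using greater[OF X, of "(\<pi> ^^ m) k" "(\<pi> ^^ m) j"] False by (auto simp: \<rho>_pow)
      qed simp
      from this[of N] show ?thesis using N two[of "\<rho> j - \<rho> k" N] False ne by simp
    qed
  qed
  have same: "X $ \<pi> j $ \<pi> k = X $ j $ k" if "X \<in> ?K" "\<rho> j = \<rho> k" for X j k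
    using key[OF that(1), of j k] surv[of j k] surv[of k "\<pi> j"] that(2) \<rho>\<pi>[of j] by simp
  define \<Phi> :: "'k^'n^'n \<Rightarrow> 'k^'n" where "\<Phi> X = (\<chi> k. X $ \<tau> k $ k)" for X
  have lin: "Vector_Spaces.linear matrix_scale (*s) \<Phi>"
    by unfold_locales (simp_all add: \<Phi>_def vec_eq_iff)
  have K: "mat.subspace ?K" by (rule mat_linear_kernel[OF mat_linear_form])
  have zero: "X = 0" if X: "X \<in> ?K" and "\<Phi> X = 0" for X
  proof -
    have \<Phi>0: "X $ \<tau> k $ k = 0" for k using \<open>\<Phi> X = 0\<close> by (simp add: \<Phi>_def vec_eq_iff)
    have pow: "X $ (\<pi> ^^ m) j $ (\<pi> ^^ m) k = X $ j $ k" if "\<rho> j = \<rho> k" for m j k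
    proof (induction m)
      case (Suc m)
      then show ?case using same[OF X, of "(\<pi> ^^ m) j" "(\<pi> ^^ m) k"] that by (simp add: \<rho>_pow)
    qed simp
    have "X $ j $ k = 0" if eq: "\<rho> j = \<rho> k" for j k
    proof -
      have "surj (\<pi> ^^ e j)" using inj by (simp add: finite_UNIV_inj_surj inj_fn)
      then obtain i where i: "k = (\<pi> ^^ e j) i" by (rule surjE)
      have "\<rho> i = \<rho> j" using eq by (simp add: i \<rho>_pow)
      then have "X $ j $ k = X $ \<tau> j $ i" using pow[of "\<tau> j" i "e j"] by (simp add: orbit i \<tau>(2))
      also have "\<tau> j = \<tau> i" using \<open>\<rho> i = \<rho> j\<close> \<tau>(1) by metis
      finally show ?thesis using \<Phi>0 by simp
    qed
    then show ?thesis using off[OF X] by (metis vec_eq_iff zero_index)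
  qed
  have "inj_on \<Phi> ?K"
  proof (rule inj_onI)
    fix X Y assume "X \<in> ?K" "Y \<in> ?K" "\<Phi> X = \<Phi> Y"
    then have "X - Y \<in> ?K" "\<Phi> (X - Y) = 0"
      using mat.subspace_diff[OF K] matvec.linear_diff[OF lin] by auto
    then show "X = Y" using zero[of "X - Y"] by simp
  qed
  moreover have "mat.span ?K = ?K" using K by (rule mat.span_eq_iff[THEN iffD2])
  ultimately have "inj_on \<Phi> (mat.span ?K)" by (simp only:)
  then have "mat.dim ?K = vec.dim (\<Phi> ` ?K)" by (rule matvec.dim_image_eq[OF lin, symmetric])
  also have "\<dots> \<le> CARD('n)" by (rule dim_subset_UNIV_cart_gen)
  finally show ?thesis by blast
qed

section \<open>Linear forms, their stabilisers and the value of the index\<close>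

lemma dual_space_contraction_trace:
  fixes a :: "'n::finite \<Rightarrow> int"
  assumes \<xi>: "\<xi> \<in> dual_space (contraction a :: ('k::field_char_0, 'k^'n^'n) lie_struct)"
  obtains M where "\<And>X. trace X = 0 \<Longrightarrow> \<xi> X = trace (M ** X)"
proof
  define n where "n = (of_nat CARD('n) :: 'k)"
  have n: "n \<noteq> 0" by (simp add: n_def)
  \<comment> \<open>A linear form is only controlled on traceless matrices, so each unit is
    corrected by a scalar matrix of the same trace. For traceless \<open>X\<close> the corrections
    add up to zero and \<open>X\<close> keeps its coordinates.\<close>
  define E where "E x = munit (fst x) (snd x) - mat (trace (munit (fst x) (snd x) :: 'k^'n^'n) / n)"
    for x :: "'n \<times> 'n"
  define M where "M = (\<chi> k j. \<xi> (E (j, k)))"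
  have trace_mat: "trace (mat c :: 'k^'n^'n) = n * c" for c
    by (simp add: trace_def mat_def n_def)
  have E: "trace (E x) = 0" for x using n by (simp add: E_def trace_sub trace_mat)
  have add: "\<xi> (X + Y) = \<xi> X + \<xi> Y" if "trace X = 0" "trace Y = 0" for X Y
    using \<xi> that by (simp add: dual_space_def)
  have scale: "\<xi> (matrix_scale c X) = c * \<xi> X" if "trace X = 0" for c X
    using \<xi> that by (simp add: dual_space_def)
  have zero: "\<xi> 0 = 0" using scale[of 0 0] by (simp add: trace_0[simplified])
  have sum: "\<xi> (\<Sum>x\<in>T. matrix_scale (c x) (E x)) = (\<Sum>x\<in>T. c x * \<xi> (E x))
      \<and> trace (\<Sum>x\<in>T. matrix_scale (c x) (E x)) = 0" if "finite T" for T c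
    using that
    by (induction T rule: finite_induct) (simp_all add: zero add scale E trace_add trace_matrix_scale trace_0[simplified])
  fix X :: "'k^'n^'n" assume X: "trace X = 0"
  have X_sum: "X = (\<Sum>x\<in>UNIV. matrix_scale (X $ fst x $ snd x) (munit (fst x) (snd x)))"
    by (simp add: vec_eq_iff munit_sum_nth[of "\<lambda>j k. X $ j $ k"])
  have mat_sum: "matrix_scale b (mat c) = mat (b * c :: 'k)" for b c
    by (simp add: vec_eq_iff mat_def)
  have "(\<Sum>x\<in>UNIV. matrix_scale (X $ fst x $ snd x) (E x))
      = X - (\<Sum>x\<in>UNIV. matrix_scale (X $ fst x $ snd x * trace (munit (fst x) (snd x) :: 'k^'n^'n)) (mat (1 / n)))"
    unfolding E_def mat.scale_right_diff_distrib sum_subtractf X_sum[symmetric]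
    by (simp add: mat_sum)
  also have "(\<Sum>x\<in>UNIV. matrix_scale (X $ fst x $ snd x * trace (munit (fst x) (snd x) :: 'k^'n^'n)) (mat (1 / n)))
      = matrix_scale (\<Sum>x\<in>UNIV. X $ fst x $ snd x * trace (munit (fst x) (snd x) :: 'k^'n^'n)) (mat (1 / n))"
    by (rule mat.scale_sum_left[symmetric])
  also have "(\<Sum>x\<in>UNIV. X $ fst x $ snd x * trace (munit (fst x) (snd x) :: 'k^'n^'n)) = trace X"
  proof -
    have "trace (\<Sum>x\<in>T. f x) = (\<Sum>x\<in>T. trace (f x))" for f :: "'n \<times> 'n \<Rightarrow> 'k^'n^'n" and T
      by (simp add: trace_def sum.swap[of _ T])
    then show ?thesis
      by (subst X_sum) (simp add: trace_matrix_scale)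
  qed
  finally have "X = (\<Sum>x\<in>UNIV. matrix_scale (X $ fst x $ snd x) (E x))" using X by simp
  then have "\<xi> X = (\<Sum>x\<in>UNIV. X $ fst x $ snd x * \<xi> (E x))"
    using sum[of UNIV "\<lambda>x. X $ fst x $ snd x"] by simp
  also have "\<dots> = (\<Sum>j\<in>UNIV. \<Sum>k\<in>UNIV. X $ j $ k * \<xi> (E (j, k)))"
    unfolding sum.cartesian_product by (simp add: case_prod_beta)
  also have "\<dots> = (\<Sum>k\<in>UNIV. \<Sum>j\<in>UNIV. X $ j $ k * \<xi> (E (j, k)))" by (rule sum.swap)
  also have "\<dots> = trace (M ** X)"
    by (simp add: trace_def matrix_matrix_mult_def M_def mult.commute)
  finally show "\<xi> X = trace (M ** X)" .
qed

lemma form_mat: "form a M (mat c) = 0"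
proof -
  have "(\<Sum>j\<in>UNIV. if survives a j k l then M $ l $ j * mat c $ j $ k else 0)
      = (\<Sum>j\<in>UNIV. if j = k then M $ l $ k * c else 0)" for l k
    by (intro sum.cong) (auto simp: mat_def survives_def wt_def)
  moreover have "(\<Sum>j\<in>UNIV. if survives a k l j then M $ j $ k * mat c $ l $ j else 0)
      = (\<Sum>j\<in>UNIV. if j = l then M $ l $ k * c else 0)" for l k
    by (intro sum.cong) (auto simp: mat_def survives_def wt_def)
  ultimately show ?thesis by (simp add: vec_eq_iff form_nth)
qed

text \<open>Testing on traceless \<open>Y\<close> is as good as testing on all matrices, since
  scalar matrices are central for the contracted bracket; then nondegeneracy of the trace pairing
  applies.\<close>

lemma coadjoint_stabiliser_contraction:
  fixes a :: "'n::finite \<Rightarrow> int" and M :: "'k::field_char_0^'n^'n"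
  assumes \<xi>: "\<And>X. trace X = 0 \<Longrightarrow> \<xi> X = trace (M ** X)"
  shows "coadjoint_stabiliser (contraction a) \<xi> = {X. trace X = 0 \<and> form a M X = 0}"
proof -
  have "(\<forall>Y. trace Y = 0 \<longrightarrow> \<xi> (cbracket a X Y) = 0) \<longleftrightarrow> form a M X = 0" for X
  proof
    assume 0: "\<forall>Y. trace Y = 0 \<longrightarrow> \<xi> (cbracket a X Y) = 0"
    have all: "trace (M ** cbracket a X Y) = 0" for Y
    proof -
      define c where "c = trace Y / of_nat CARD('n)"
      have "trace (mat c :: 'k^'n^'n) = trace Y" by (simp add: trace_def mat_def c_def)
      then have "trace (Y - mat c) = 0" by (simp add: trace_sub)
      then have "trace (M ** cbracket a X (Y - mat c)) = 0"
        using 0 \<xi>[OF trace_cbracket] by metis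
      moreover have "cbracket a X Y = cbracket a X ((Y - mat c) + mat c)" by simp
      then have "cbracket a X Y = cbracket a X (Y - mat c)"
        by (simp only: cbracket_linear cbracket_mat add_0_right)
      ultimately show ?thesis by simp
    qed
    have "form a M X $ l $ k = 0" for l k
    proof -
      have "(\<Sum>l'\<in>UNIV. \<Sum>k'\<in>UNIV. form a M X $ l' $ k' * munit k l $ k' $ l')
          = (\<Sum>l'\<in>UNIV. \<Sum>k'\<in>UNIV. if k' = k then (if l' = l then form a M X $ l $ k else 0) else 0)"
        by (intro sum.cong) (auto simp: munit_nth)
      then show ?thesis using all[of "munit k l"] by (simp add: trace_form)
    qed
    then show "form a M X = 0" by (simp add: vec_eq_iff)
  next
    assume "form a M X = 0"
    then show "\<forall>Y. trace Y = 0 \<longrightarrow> \<xi> (cbracket a X Y) = 0"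
      by (simp add: \<xi> trace_cbracket trace_form)
  qed
  then show ?thesis by (simp add: coadjoint_stabiliser_def coadjoint_def)
qed

text \<open>The identity matrix is central and accounts for the difference between the two kernels.\<close>

lemma dim_form_kernel_traceless:
  fixes M :: "'k::field_char_0^'n::finite^'n"
  shows "mat.dim {X. form a M X = 0} = Suc (mat.dim {X. trace X = 0 \<and> form a M X = 0})"
proof -
  let ?K = "{X. form a M X = 0}" and ?T = "{X. trace X = 0 \<and> form a M X = 0}"
  have K: "mat.subspace ?K" by (rule mat_linear_kernel[OF mat_linear_form])
  have K0: "mat.subspace ?T"
  proof -
    have "?T = {X. trace X = 0} \<inter> ?K" by (intro set_eqI) simp
    moreover have "mat.subspace ({X. trace X = 0} \<inter> ?K)"
      by (rule mat.subspace_inter[OF subspace_trace_zero K])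
    ultimately show ?thesis by (simp only:)
  qed
  have tr: "trace (mat c :: 'k^'n^'n) = of_nat CARD('n) * c" for c by (simp add: trace_def mat_def)
  have span0: "mat.span ?T = ?T" using K0 by (rule mat.span_eq_iff[THEN iffD2])
  have "mat.dim (insert (mat 1) ?T) = Suc (mat.dim ?T)"
    unfolding mat.dim_insert span0 by (simp add: tr)
  moreover have "mat.span (insert (mat 1) ?T) = ?K"
  proof
    show "mat.span (insert (mat 1) ?T) \<subseteq> ?K"
      by (rule mat.span_minimal[OF _ K]) (auto simp: form_mat)
    show "?K \<subseteq> mat.span (insert (mat 1) ?T)"
    proof
      fix X assume X: "X \<in> ?K"
      define c where "c = trace X / of_nat CARD('n)"
      have "matrix_scale c (mat 1) = (mat c :: 'k^'n^'n)" by (simp add: vec_eq_iff mat_def)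
      moreover have "trace (X - mat c) = 0" by (simp add: trace_sub tr c_def)
      moreover have "X - mat c \<in> ?K" using mat.subspace_diff[OF K X] form_mat by blast
      ultimately have "X - matrix_scale c (mat 1) \<in> mat.span ?T"
        unfolding span0 by simp
      then show "X \<in> mat.span (insert (mat 1) ?T)"
        unfolding mat.span_breakdown_eq by blast
    qed
  qed
  then have "mat.dim (insert (mat 1) ?T) = mat.dim ?K"
    using mat.dim_span[of "insert (mat 1) ?T"] by (simp only:)
  ultimately show ?thesis by simp
qed

lemma lie_index_contraction:
  fixes a :: "'n::finite \<Rightarrow> int"
  shows "lie_index (contraction a :: ('k::{alg_closed_field, field_char_0}, 'k^'n^'n) lie_struct)
      = CARD('n) - 1"
proof -
  let ?L = "contraction a :: ('k, 'k^'n^'n) lie_struct"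
  let ?d = "\<lambda>\<xi>. mat.dim (coadjoint_stabiliser ?L \<xi>)"
  have ge: "CARD('n) - 1 \<le> ?d \<xi>" if \<xi>: "\<xi> \<in> dual_space ?L" for \<xi>
  proof -
    obtain M where M: "\<And>X. trace X = 0 \<Longrightarrow> \<xi> X = trace (M ** X)"
      using dual_space_contraction_trace[OF \<xi>] by blast
    have stab: "coadjoint_stabiliser ?L \<xi> = {X. trace X = 0 \<and> form a M X = 0}"
      using M by (rule coadjoint_stabiliser_contraction)
    show ?thesis
      using dim_form_kernel_ge[of a M] unfolding stab dim_form_kernel_traceless by linarith
  qed
  obtain M :: "'k^'n^'n" where M: "mat.dim {X. form a M X = 0} \<le> CARD('n)"
    using dim_form_kernel_le by blast
  define \<xi> where "\<xi> X = trace (M ** X)" for X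
  have lin: "M ** (X + Y) = M ** X + M ** Y" "M ** matrix_scale c X = matrix_scale c (M ** X)"
    for X Y c
    using mat_linear_add[OF mat_linear_mult[of M "mat 1"]] mat_linear_scale[OF mat_linear_mult[of M "mat 1"]]
    by simp_all
  have dual: "\<xi> \<in> dual_space ?L"
    by (simp add: dual_space_def \<xi>_def lin trace_add trace_matrix_scale)
  have stab: "coadjoint_stabiliser ?L \<xi> = {X. trace X = 0 \<and> form a M X = 0}"
    using \<xi>_def by (rule coadjoint_stabiliser_contraction)
  have "?d \<xi> \<le> CARD('n) - 1"
    using M unfolding stab dim_form_kernel_traceless by linarith
  then have "?d \<xi> = CARD('n) - 1" using ge[OF dual] by simp
  then have "(INF \<xi>\<in>dual_space ?L. ?d \<xi>) = CARD('n) - 1"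
    using ge dual by (intro cInf_eq_minimum) (auto intro: rev_image_eqI)
  then show ?thesis by (simp add: lie_index_def)
qed

section \<open>Invariance of the index under isomorphism\<close>

lemma dual_stabiliser_transport:
  fixes L M :: "('k::field, 'k^'n::finite^'n) lie_struct"
  assumes sc: "lscale L = matrix_scale" "lscale M = matrix_scale"
    and f: "mat_linear f" "inj f" and g: "mat_linear g"
    and fg: "\<And>x. g (f x) = x" "\<And>y. f (g y) = y"
    and carrier: "f ` lcarrier L = lcarrier M"
    and br: "\<And>x y. x \<in> lcarrier L \<Longrightarrow> y \<in> lcarrier L \<Longrightarrow> f (lbracket L x y) = lbracket M (f x) (f y)"
  shows "(\<lambda>\<xi>. mat.dim (coadjoint_stabiliser L \<xi>)) ` dual_space L
    \<subseteq> (\<lambda>\<xi>. mat.dim (coadjoint_stabiliser M \<xi>)) ` dual_space M"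
proof
  fix d assume "d \<in> (\<lambda>\<xi>. mat.dim (coadjoint_stabiliser L \<xi>)) ` dual_space L"
  then obtain \<xi> where \<xi>: "\<xi> \<in> dual_space L" "d = mat.dim (coadjoint_stabiliser L \<xi>)" by blast
  have gc: "g y \<in> lcarrier L" if "y \<in> lcarrier M" for y
    using that unfolding carrier[symmetric] by (auto simp: fg)
  have dual: "\<xi> \<circ> g \<in> dual_space M"
    using \<xi>(1) gc unfolding dual_space_def sc mem_Collect_eq comp_def
    by (simp add: mat_linear_add[OF g] mat_linear_scale[OF g])
  have "coadjoint_stabiliser M (\<xi> \<circ> g) = f ` coadjoint_stabiliser L \<xi>"
  proof -
    have "f x \<in> coadjoint_stabiliser M (\<xi> \<circ> g) \<longleftrightarrow> x \<in> coadjoint_stabiliser L \<xi>"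
      if x: "x \<in> lcarrier L" for x
    proof -
      have fx: "f x \<in> lcarrier M" using x carrier by blast
      have "g (lbracket M (f x) (f y)) = lbracket L x y" if "y \<in> lcarrier L" for y
        using br[OF x that] fg(1) by metis
      then show ?thesis
        using x fx unfolding coadjoint_stabiliser_def coadjoint_def carrier[symmetric] by auto
    qed
    moreover have "coadjoint_stabiliser M (\<xi> \<circ> g) \<subseteq> f ` lcarrier L"
      unfolding carrier coadjoint_stabiliser_def by blast
    moreover have "coadjoint_stabiliser L \<xi> \<subseteq> lcarrier L" unfolding coadjoint_stabiliser_def by blast
    ultimately show ?thesis by blast
  qed
  moreover have "mat.dim (f ` coadjoint_stabiliser L \<xi>) = mat.dim (coadjoint_stabiliser L \<xi>)"
    by (rule mats.dim_image_eq[OF f(1) inj_on_subset[OF f(2) subset_UNIV]])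
  ultimately show "d \<in> (\<lambda>\<xi>. mat.dim (coadjoint_stabiliser M \<xi>)) ` dual_space M"
    using dual \<xi>(2) by (intro image_eqI[of _ _ "\<xi> \<circ> g"]) simp_all
qed

text \<open>Precomposition with the inverse matches linear forms and \<open>f\<close> matches their
  stabilisers, so both algebras have the same set of stabiliser dimensions; the two inclusions come
  from \<open>f\<close> and \<open>g\<close>.\<close>

lemma lie_index_transport:
  fixes L M :: "('k::field, 'k^'n::finite^'n) lie_struct"
  assumes sc: "lscale L = matrix_scale" "lscale M = matrix_scale"
    and f: "mat_linear f" and g: "mat_linear g"
    and fg: "\<And>x. g (f x) = x" "\<And>y. f (g y) = y"
    and carrier: "f ` lcarrier L = lcarrier M"
    and br: "\<And>x y. x \<in> lcarrier L \<Longrightarrow> y \<in> lcarrier L \<Longrightarrow> f (lbracket L x y) = lbracket M (f x) (f y)"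
  shows "lie_index L = lie_index M"
proof -
  have carrier': "g ` lcarrier M = lcarrier L" unfolding carrier[symmetric] image_image fg by simp
  have br': "g (lbracket M x y) = lbracket L (g x) (g y)" if "x \<in> lcarrier M" "y \<in> lcarrier M" for x y
  proof -
    have "g x \<in> lcarrier L" "g y \<in> lcarrier L" using that carrier' by blast+
    from br[OF this] show ?thesis unfolding fg(2) by (metis fg(1))
  qed
  have "inj f" "inj g" using fg by (metis injI)+
  then have "(\<lambda>\<xi>. mat.dim (coadjoint_stabiliser L \<xi>)) ` dual_space L
    = (\<lambda>\<xi>. mat.dim (coadjoint_stabiliser M \<xi>)) ` dual_space M"
    using dual_stabiliser_transport[OF sc f _ g fg carrier br]
      dual_stabiliser_transport[OF sc(2,1) g _ f fg(2,1) carrier' br'] by (intro subset_antisym)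
  then show ?thesis by (simp only: lie_index_def sc)
qed

section \<open>Inner automorphisms are conjugations\<close>

lemma mat_linear_mult_left: "mat_linear (\<lambda>X. A ** X)"
  and mat_linear_mult_right: "mat_linear (\<lambda>X. X ** A)"
  using mat_linear_mult[of A "mat 1"] mat_linear_mult[of "mat 1" A] by simp_all

lemmas mmult_linear =
  mat_linear_add[OF mat_linear_mult_left] mat_linear_add[OF mat_linear_mult_right]
  mat_linear_scale[OF mat_linear_mult_left] mat_linear_scale[OF mat_linear_mult_right]
  mats.linear_diff[OF mat_linear_mult_left] mats.linear_diff[OF mat_linear_mult_right]
  mats.linear_sum[OF mat_linear_mult_left] mats.linear_sum[OF mat_linear_mult_right]

primrec mpow :: "'k::field^'n::finite^'n \<Rightarrow> nat \<Rightarrow> 'k^'n^'n" where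
  "mpow A 0 = mat 1"
| "mpow A (Suc k) = mpow A k ** A"

lemma mpow_commute: "A ** mpow A k = mpow A k ** A"
  by (induction k) (simp_all add: matrix_mul_assoc)

lemma mpow_add: "mpow A (i + j) = mpow A i ** mpow A j"
  by (induction j) (simp_all add: matrix_mul_assoc)

lemma mpow_zero_mono: "mpow A K = 0 \<Longrightarrow> K \<le> i \<Longrightarrow> mpow A i = 0"
  using mpow_add[of A K "i - K"] by simp

lemma mpow_scale: "mpow (matrix_scale c A) k = matrix_scale (c ^ k) (mpow A k)"
  by (induction k) (simp_all add: mmult_linear mat.scale_scale mult.commute)

lemma mpow_vec: "mpow A k *v v = ((*v) A ^^ k) v"
  by (induction k arbitrary: v) (simp_all add: matrix_vector_mul_assoc[symmetric] funpow_swap1)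

definition ad :: "'k::field^'n::finite^'n \<Rightarrow> 'k^'n^'n \<Rightarrow> 'k^'n^'n" where
  "ad x y = x ** y - y ** x"

lemma lbracket_special_linear: "lbracket special_linear = ad"
  by (simp add: fun_eq_iff ad_def)

lemma mat_linear_ad: "mat_linear (ad x)"
  unfolding ad_def using mats.linear_compose_sub[OF mat_linear_mult_left mat_linear_mult_right] .

lemma mat_mult_commute: "mat c ** y = y ** mat c" for y :: "'k::field^'n::finite^'n"
  using cmult_mat_left[of "\<lambda>_. 0" c y] cmult_mat_right[of "\<lambda>_. 0" y c]
  by (simp add: cmult_def survives_def wt_def matrix_matrix_mult_def)

text \<open>Allows a matrix that is nilpotent only after subtracting a scalar to be exponentiated as
  if it were nilpotent.\<close>

lemma ad_minus_mat: "ad (x - mat c) = ad x"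
  by (simp add: fun_eq_iff ad_def mmult_linear mat_mult_commute[of c])

text \<open>Divided powers turn the binomial formula for powers of \<open>ad x\<close> into a plain
  convolution.\<close>

definition dpow :: "'k::field_char_0^'n::finite^'n \<Rightarrow> nat \<Rightarrow> 'k^'n^'n" where
  "dpow x i = matrix_scale (1 / fact i) (mpow x i)"

lemma dpow_Suc:
  "x ** dpow x i = matrix_scale (of_nat (Suc i)) (dpow x (Suc i))"
  "dpow x i ** x = matrix_scale (of_nat (Suc i)) (dpow x (Suc i))"
proof -
  have "of_nat (Suc i) * (1 / fact (Suc i)) = (1 / fact i :: 'a)"
    by (simp add: divide_simps del: of_nat_Suc)
  then show "x ** dpow x i = matrix_scale (of_nat (Suc i)) (dpow x (Suc i))"
    "dpow x i ** x = matrix_scale (of_nat (Suc i)) (dpow x (Suc i))"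
    by (simp_all add: dpow_def mmult_linear mpow_commute mat.scale_scale del: of_nat_Suc fact_Suc)
qed

text \<open>The homogeneous parts of \<open>exp (ad x) y = exp x y exp (- x)\<close>.\<close>

lemma ad_pow_divided:
  "matrix_scale (1 / fact k) ((ad x ^^ k) y) = (\<Sum>i\<le>k. dpow x i ** y ** dpow (- x) (k - i))"
proof (induction k)
  case 0
  then show ?case by (simp add: dpow_def)
next
  case (Suc k)
  define h where "h i j = dpow x i ** y ** dpow (- x) j" for i j
  have h1: "x ** h i j = matrix_scale (of_nat (Suc i)) (h (Suc i) j)" for i j
    unfolding h_def matrix_mul_assoc dpow_Suc(1) by (simp add: mmult_linear)
  have h2: "h i j ** x = - matrix_scale (of_nat (Suc j)) (h i (Suc j))" for i j
  proof -
    have "h i j ** (- x) = dpow x i ** y ** (dpow (- x) j ** (- x))"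
      by (simp add: h_def matrix_mul_assoc)
    also have "\<dots> = matrix_scale (of_nat (Suc j)) (h i (Suc j))"
      unfolding dpow_Suc(2) by (simp add: mmult_linear h_def)
    finally have "- (h i j ** x) = matrix_scale (of_nat (Suc j)) (h i (Suc j))"
      using mats.linear_neg[OF mat_linear_mult_left[of "h i j"], of x] by simp
    then show ?thesis by (metis minus_minus)
  qed
  have "matrix_scale (1 / fact k) ((ad x ^^ Suc k) y) = ad x (\<Sum>i\<le>k. h i (k - i))"
    using Suc.IH by (simp add: h_def mat_linear_scale[OF mat_linear_ad, symmetric])
  also have "\<dots> = (\<Sum>i\<le>k. matrix_scale (of_nat (Suc i)) (h (Suc i) (k - i)))
      + (\<Sum>i\<le>k. matrix_scale (of_nat (Suc (k - i))) (h i (Suc (k - i))))"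
    unfolding ad_def mmult_linear by (simp add: h1 h2 sum_negf del: of_nat_Suc)
  also have "(\<Sum>i\<le>k. matrix_scale (of_nat (Suc i)) (h (Suc i) (k - i)))
      = (\<Sum>i\<le>Suc k. matrix_scale (of_nat i) (h i (Suc k - i)))"
    by (subst sum.atMost_Suc_shift) simp
  also have "(\<Sum>i\<le>k. matrix_scale (of_nat (Suc (k - i))) (h i (Suc (k - i))))
      = (\<Sum>i\<le>Suc k. matrix_scale (of_nat (Suc k - i)) (h i (Suc k - i)))"
    by (simp only: sum.atMost_Suc diff_self_eq_0 of_nat_0 mat.scale_zero_left add_0_right)
      (intro sum.cong refl, simp only: atMost_iff Suc_diff_le)
  \<comment> \<open>The coefficients \<open>i\<close> and \<open>Suc k - i\<close> of the two
    shifted sums add up to \<open>Suc k\<close>, which the new factorial absorbs.\<close>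
  also have "(\<Sum>i\<le>Suc k. matrix_scale (of_nat i) (h i (Suc k - i)))
      + (\<Sum>i\<le>Suc k. matrix_scale (of_nat (Suc k - i)) (h i (Suc k - i)))
      = (\<Sum>i\<le>Suc k. matrix_scale (of_nat (Suc k)) (h i (Suc k - i)))"
    unfolding sum.distrib[symmetric] mat.scale_left_distrib[symmetric] of_nat_add[symmetric]
    by (intro sum.cong) auto
  finally have eq: "matrix_scale (1 / fact k) ((ad x ^^ Suc k) y)
      = (\<Sum>i\<le>Suc k. matrix_scale (of_nat (Suc k)) (h i (Suc k - i)))" .
  have "1 / fact (Suc k) = 1 / of_nat (Suc k) * (1 / fact k :: 'a)" by (simp del: of_nat_Suc)
  then have "matrix_scale (1 / fact (Suc k)) ((ad x ^^ Suc k) y)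
      = matrix_scale (1 / of_nat (Suc k)) (matrix_scale (1 / fact k) ((ad x ^^ Suc k) y))"
    by (simp only: mat.scale_scale)
  also have "\<dots> = (\<Sum>i\<le>Suc k. h i (Suc k - i))"
    unfolding eq mat.scale_sum_right mat.scale_scale
    by (intro sum.cong refl) (simp del: of_nat_Suc)
  finally show ?case by (simp only: h_def)
qed

text \<open>The scalar shift is invisible to \<open>ad\<close>, and after it both exponential series
  are finite sums. Evaluating the conjugation at the identity matrix, which \<open>ad\<close> kills,
  gives \<open>h ** h' = mat 1\<close>.\<close>

lemma exp_ad_conjugation:
  fixes z :: "'k::field_char_0^'n::finite^'n"
  assumes nil: "mpow (z - mat c) K = 0"
  obtains h h' where "h ** h' = mat 1" "\<And>y. exp_ad special_linear z y = h ** y ** h'"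
proof -
  define x where "x = z - mat c"
  define h where "h = (\<Sum>i<K. dpow x i)"
  define h' where "h' = (\<Sum>i<K. dpow (- x) i)"
  have neg: "- x = matrix_scale (- 1) x" by simp
  have z1: "dpow x i = 0" and z2: "dpow (- x) i = 0" if "K \<le> i" for i
    using mpow_zero_mono[OF nil that]
      by (simp_all add: dpow_def x_def[symmetric] neg mpow_scale del: mat.scale_minus_left)
  define T where "T k y = matrix_scale (1 / fact k) ((ad x ^^ k) y)" for k y
  have T: "T k y = (\<Sum>i\<le>k. dpow x i ** y ** dpow (- x) (k - i))" for k y
    unfolding T_def by (rule ad_pow_divided)
  have T_zero: "T k y = 0" if "2 * K \<le> k" for k y
    unfolding T
  proof (rule sum.neutral, rule ballI)
    fix i assume "i \<in> {..k}"
    then have "K \<le> i \<or> K \<le> k - i" using that by auto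
    then show "dpow x i ** y ** dpow (- x) (k - i) = 0" using z1 z2 by auto
  qed
  have sum_T: "(\<Sum>k<2 * K. T k y) = h ** y ** h'" for y
  proof -
    \<comment> \<open>Sorted by both exponents, the triangle below \<open>2 * K\<close> contains the
      square below \<open>K\<close>, and outside the square one of the divided powers is
      zero.\<close>
    have "(\<Sum>k<2 * K. T k y) = (\<Sum>(i, j) \<in> {(i, j). i + j < 2 * K}. dpow x i ** y ** dpow (- x) j)"
      unfolding T by (rule sum.triangle_reindex[symmetric])
    also have "\<dots> = (\<Sum>(i, j) \<in> {..<K} \<times> {..<K}. dpow x i ** y ** dpow (- x) j)"
    proof (rule sum.mono_neutral_right)
      show "finite {(i, j). i + j < 2 * K}"
        by (rule finite_subset[of _ "{..2 * K} \<times> {..2 * K}"]) auto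
      show "\<forall>p\<in>{(i, j). i + j < 2 * K}
          - {..<K} \<times> {..<K}. (case p of (i, j) \<Rightarrow> dpow x i ** y ** dpow (- x) j) = 0"
      proof
        fix p assume "p \<in> {(i, j). i + j < 2 * K} - {..<K} \<times> {..<K}"
        then have "K \<le> fst p \<or> K \<le> snd p" by auto
        then show "(case p of (i, j) \<Rightarrow> dpow x i ** y ** dpow (- x) j) = 0"
          using z1 z2 by (auto simp: case_prod_beta)
      qed
    qed auto
    also have "\<dots> = (\<Sum>i<K. \<Sum>j<K. dpow x i ** y ** dpow (- x) j)"
      by (rule sum.cartesian_product[symmetric])
    also have "\<dots> = h ** y ** h'"
      unfolding h_def h'_def mmult_linear by (rule sum.swap)
    finally show ?thesis .
  qed
  have "exp_ad special_linear z y = h ** y ** h'" for y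
  proof -
    have ne: "matrix_scale (1 / fact k) ((ad x ^^ k) y) = 0 \<longleftrightarrow> (ad x ^^ k) y = 0" for k
      by (simp only: mat.scale_eq_0_iff) simp
    have "exp_ad special_linear z y = (\<Sum>k | (ad x ^^ k) y \<noteq> 0. T k y)"
      unfolding exp_ad_def lbracket_special_linear special_linear_simps x_def ad_minus_mat T_def ..
    also have "\<dots> = (\<Sum>k<2 * K. T k y)"
    proof (rule sum.mono_neutral_left)
      show "{k. (ad x ^^ k) y \<noteq> 0} \<subseteq> {..<2 * K}"
        using T_zero[of _ y] ne unfolding T_def by (auto simp: not_less[symmetric])
    qed (auto simp: T_def)
    finally show ?thesis using sum_T by simp
  qed
  moreover have "h ** h' = mat 1"
  proof -
    have "(mat 1 :: 'k^'n^'n) \<noteq> 0"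
    proof
      assume "(mat 1 :: 'k^'n^'n) = 0"
      then have "(mat 1 :: 'k^'n^'n) $ i $ i = 0" for i by simp
      then show False by (simp add: mat_def)
    qed
    then have "K \<noteq> 0" using nil by (cases K) auto
    have ad1: "ad x (mat 1) = 0" by (simp add: ad_def)
    have "(ad x ^^ Suc k) (mat 1) = 0" for k
      by (induction k) (simp_all add: ad1 mat_linear_0[OF mat_linear_ad])
    then have "T k (mat 1) = (if k = 0 then mat 1 else 0)" for k
      by (cases k) (simp_all add: T_def del: funpow.simps(2))
    then have "(\<Sum>k<2 * K. T k (mat 1)) = mat 1" using \<open>K \<noteq> 0\<close> by simp
    then show ?thesis using sum_T[of "mat 1"] by simp
  qed
  ultimately show ?thesis using that by blast
qed

text \<open>
  If \<open>x u = 0\<close> for some nonzero column vector \<open>u\<close>, then \<open>(ad x)^k\<close> maps \<open>u w\<close> to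
  \<open>(-1)^k u w x^k\<close> for every row vector \<open>w\<close>.
\<close>

lemma ad_nilpotent_imp_shift_nilpotent:
  fixes z :: "'k::{alg_closed_field, field_char_0}^'n::finite^'n"
  assumes "ad_nilpotent special_linear z"
  obtains c K where "mpow (z - mat c) K = 0"
proof -
  obtain N where N: "\<And>y. trace y = 0 \<Longrightarrow> (ad z ^^ N) y = 0"
    using assms unfolding ad_nilpotent_def lbracket_special_linear by auto
  \<comment> \<open>Nilpotency is known only on traceless matrices; one extra application of
    \<open>ad z\<close> brings every matrix there.\<close>
  have all: "(ad z ^^ Suc N) y = 0" for y
  proof -
    have "trace (ad z y) = 0" unfolding ad_def by (rule trace_commutator)
    then show ?thesis using N by (simp add: funpow_swap1)
  qed
  have "{0} \<noteq> (UNIV :: ('k^'n) set)"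
  proof
    assume "{0} = (UNIV :: ('k^'n) set)"
    then have "(vec 1 :: 'k^'n) = 0" by blast
    then show False by (simp add: vec_eq_iff)
  qed
  then obtain u c where u: "u \<noteq> 0" "z *v u - c *s u = 0"
    using eigenvector_mod_subspace[of "{0}" z] vec.subspace_single_0 by auto
  define x where "x = z - mat c"
  have "mat c *v u = c *s u"
    by (simp add: vec_eq_iff matrix_vector_mult_def mat_def if_distrib if_distribR cong: if_cong)
  then have xu: "x *v u = 0" using u(2) by (simp add: x_def matrix_vector_mult_diff_rdistrib)
  obtain p where p: "u $ p \<noteq> 0" using u(1) by (auto simp: vec_eq_iff)
  have "mpow x (Suc N) $ i $ q = 0" for i q
  proof -
    \<comment> \<open>The outer product of \<open>u\<close> with the \<open>i\<close>-th unit row.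
      Multiplied by a power of \<open>x\<close>, it shows row \<open>i\<close> of that power in its
      own row \<open>p\<close>, scaled by the nonzero coordinate \<open>u $ p\<close>.\<close>
    define U :: "'k^'n^'n" where "U = (\<chi> r j. if j = i then u $ r else 0)"
    have xU: "x ** U = 0"
    proof -
      have "(x ** U) $ r $ j = (if j = i then (x *v u) $ r else 0)" for r j
        by (simp add: matrix_matrix_mult_def matrix_vector_mult_def U_def)
      then show ?thesis using xu by (simp add: vec_eq_iff)
    qed
    have "(ad x ^^ k) U = matrix_scale ((- 1) ^ k) (U ** mpow x k)" for k
    proof (induction k)
      case (Suc k)
      have "x ** (U ** mpow x k) = 0" by (simp add: matrix_mul_assoc xU)
      then have "ad x (U ** mpow x k) = matrix_scale (- 1) (U ** mpow x (Suc k))"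
        by (simp add: ad_def matrix_mul_assoc)
      then show ?case
        using Suc by (simp add: mat_linear_scale[OF mat_linear_ad] mat.scale_scale del:
            mat.scale_minus_left mpow.simps)
    qed simp
    then have "matrix_scale ((- 1) ^ Suc N) (U ** mpow x (Suc N)) = 0"
      using all[of U] unfolding x_def ad_minus_mat by metis
    then have "U ** mpow x (Suc N) = 0" by (simp only: mat.scale_eq_0_iff) simp
    then have "(U ** mpow x (Suc N)) $ p $ q = 0" by simp
    moreover have "(U ** mpow x (Suc N)) $ p $ q
        = (\<Sum>j\<in>UNIV. if j = i then u $ p * mpow x (Suc N) $ i $ q else 0)"
      unfolding matrix_matrix_mult_def[of U] vec_lambda_beta by (intro sum.cong) (auto simp: U_def)
    ultimately show ?thesis using p by simp
  qed
  then have "mpow x (Suc N) = 0" by (simp add: vec_eq_iff)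
  then show ?thesis using that x_def by blast
qed

lemma inner_group_conjugation:
  fixes \<phi> :: "'k::{alg_closed_field, field_char_0}^'n::finite^'n \<Rightarrow> 'k^'n^'n"
  assumes "inner_group special_linear \<phi>"
  shows "\<exists>g g'. g ** g' = mat 1 \<and> (\<forall>y. trace y = 0 \<longrightarrow> \<phi> y = g ** y ** g')"
  using assms
proof induction
  case (one \<phi>)
  then show ?case by (intro exI[of _ "mat 1"]) simp
next
  case (step \<psi> x \<phi>)
  then obtain g g' where g: "g ** g' = mat 1" "\<And>y. trace y = 0 \<Longrightarrow> \<psi> y = g ** y ** g'" by blast
  obtain c K where "mpow (x - mat c) K = 0"
    using ad_nilpotent_imp_shift_nilpotent[OF step.hyps(3)] by blast
  then obtain h h' where h: "h ** h' = mat 1" "\<And>y. exp_ad special_linear x y = h ** y ** h'"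
    using exp_ad_conjugation by blast
  have "(h ** g) ** (g' ** h') = h ** (g ** g') ** h'" by (simp add: matrix_mul_assoc)
  then have "(h ** g) ** (g' ** h') = mat 1" by (simp add: g h)
  moreover have "\<phi> y = (h ** g) ** y ** (g' ** h')" if "trace y = 0" for y
    using step.hyps(4)[of y] that g(2)[of y] h(2) by (simp add: matrix_mul_assoc)
  ultimately show ?case by blast
qed

section \<open>Diagonalisation of a conjugation of finite order\<close>

text \<open>Commuting with the off-diagonal units alone already forces equal diagonal entries and
  vanishing off-diagonal ones.\<close>

lemma commutes_traceless_imp_scalar:
  fixes G :: "'k::field_char_0^'n::finite^'n"
  assumes "\<And>y. trace y = 0 \<Longrightarrow> G ** y = y ** G"
  obtains c where "G = mat c"
proof -
  have eq: "G $ i $ j = (if i = j then G $ k $ k else 0)" if "j \<noteq> k" for i j k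
  proof -
    have "(G ** munit j k) $ i $ k = (munit j k ** G) $ i $ k"
      using assms[OF trace_munit[OF that]] by simp
    then show ?thesis by (simp add: munit_mult_left munit_mult_right)
  qed
  have off: "G $ i $ j = 0" if "i \<noteq> j" for i j
    using eq[of j i i] that by simp
  have diag: "G $ j $ j = G $ k $ k" for j k
    using eq[of j k j] by (cases "j = k") auto
  obtain k :: 'n where True by blast
  have "G = mat (G $ k $ k)"
    unfolding vec_eq_iff
  proof (intro allI)
    fix i j show "G $ i $ j = mat (G $ k $ k) $ i $ j"
      using off[of i j] diag[of j k] by (cases "i = j") (simp_all add: mat_def)
  qed
  then show ?thesis by (rule that)
qed

text \<open>The vectors \<open>(\<Sum>k<m. \<zeta>^(-i k) A^k v)\<close> are eigenvectors, and they add up to \<open>m v\<close>.\<close>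

lemma root_of_unity_eigenvectors_span:
  fixes A :: "'k::field_char_0^'n::finite^'n"
  assumes A: "mpow A m = mat 1" and \<zeta>: "primitive_root_of_unity m \<zeta>"
  shows "vec.span {v. \<exists>i<m. A *v v = \<zeta> ^ i *s v} = UNIV" (is "vec.span ?E = UNIV")
proof -
  have m: "m > 0" "\<zeta> ^ m = 1" "\<And>k. 0 < k \<Longrightarrow> k < m \<Longrightarrow> \<zeta> ^ k \<noteq> 1"
    using \<zeta> by (auto simp: primitive_root_of_unity_def)
  have nz: "\<zeta> \<noteq> 0" using m by (auto simp: power_0_left)
  define \<omega> where "\<omega> = inverse \<zeta>"
  have \<omega>: "\<omega> ^ m = 1" using m by (simp add: \<omega>_def power_inverse)
  define q where "q i v = (\<Sum>k<m. \<omega> ^ (i * k) *s ((*v) A ^^ k) v)" for i v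
  have q: "q i v \<in> ?E" if "i < m" for i v
  proof -
    define b where "b k = \<omega> ^ (i * k) *s ((*v) A ^^ k) v" for k
    have "((*v) A ^^ m) v = v" using A mpow_vec[of A m v] by simp
    moreover have "\<omega> ^ (i * m) = 1" using \<omega> by (metis mult.commute power_mult power_one)
    ultimately have bm: "b m = b 0" by (simp add: b_def)
    have Ab: "A *v b k = \<zeta> ^ i *s b (Suc k)" for k
    proof -
      have "\<zeta> ^ i * \<omega> ^ (i * Suc k) = \<omega> ^ (i * k)"
        using nz by (simp add: \<omega>_def power_add power_inverse)
      then show ?thesis by (simp add: b_def vec.scale vec.scale_scale)
    qed
    have "(\<Sum>k<m. b (Suc k)) = (\<Sum>k<m. b k)"
    proof -
      have "(\<Sum>k<Suc m. b k) = b 0 + (\<Sum>k<m. b (Suc k))" by (rule sum.lessThan_Suc_shift)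
      then show ?thesis using bm by simp
    qed
    then have "A *v q i v = \<zeta> ^ i *s q i v"
      unfolding q_def b_def[symmetric] vec.sum Ab by (simp flip: vec.scale_sum_right)
    then show ?thesis using that by blast
  qed
  have "v \<in> vec.span ?E" for v
  proof -
    have coeff: "(\<Sum>i<m. \<omega> ^ (i * k)) = (if k = 0 then of_nat m else 0)" if "k < m" for k
    proof (cases "k = 0")
      case False
      have "\<omega> ^ k \<noteq> 1" using m(3)[of k] False that by (simp add: \<omega>_def power_inverse)
      moreover have "(\<omega> ^ k) ^ m = 1" using \<omega> by (metis mult.commute power_mult power_one)
      ultimately have "(\<Sum>i<m. (\<omega> ^ k) ^ i) = 0" by (simp add: geometric_sum)
      then show ?thesis using False by (simp add: power_mult[symmetric] mult.commute)
    qed simp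
    have "(\<Sum>i<m. q i v) = (\<Sum>k<m. \<Sum>i<m. \<omega> ^ (i * k) *s ((*v) A ^^ k) v)"
      unfolding q_def by (rule sum.swap)
    also have "\<dots> = (\<Sum>k<m. (if k = 0 then of_nat m else 0) *s ((*v) A ^^ k) v)"
      by (intro sum.cong refl) (simp add: coeff flip: vec.scale_sum_left)
    also have "\<dots> = (\<Sum>k<m. if k = 0 then of_nat m *s v else 0)"
      by (intro sum.cong) auto
    also have "\<dots> = of_nat m *s v" using m(1) by simp
    finally have "of_nat m *s v \<in> vec.span ?E"
      using q by (metis (no_types, lifting) lessThan_iff vec.span_base vec.span_sum)
    then have "(1 / of_nat m) *s (of_nat m *s v) \<in> vec.span ?E" by (rule vec.span_scale)
    then show ?thesis using m(1) by (simp add: vec.scale_scale)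
  qed
  then show ?thesis by blast
qed

lemma root_of_unity_diagonalise:
  fixes A :: "'k::field_char_0^'n::finite^'n"
  assumes A: "mpow A m = mat 1" and \<zeta>: "primitive_root_of_unity m \<zeta>"
  obtains S S' :: "'k^'n^'n" and w :: "'n \<Rightarrow> nat"
  where "S ** S' = mat 1" "S' ** S = mat 1" "\<And>j. w j < m"
    "A ** S = S ** (\<chi> i j. if i = j then \<zeta> ^ w j else 0)"
proof -
  let ?E = "{v. \<exists>i<m. A *v v = \<zeta> ^ i *s v}"
  obtain B where B: "B \<subseteq> ?E" "vec.independent B" "?E \<subseteq> vec.span B"
    using vec.maximal_independent_subset[of ?E] by blast
  have "vec.span ?E \<subseteq> vec.span B" using B(3) by (intro vec.span_minimal) auto
  then have span: "vec.span B = UNIV" using root_of_unity_eigenvectors_span[OF A \<zeta>] by auto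
  have "finite B" using B(2) by (rule vec.finiteI_independent)
  have "card B = vec.dim (vec.span B)" using B(2) vec.dim_span_eq_card_independent by metis
  then have "card B = CARD('n)" unfolding span by (simp only: vec_dim_card)
  then obtain b :: "'n \<Rightarrow> 'k^'n" where b: "bij_betw b UNIV B"
    using finite_same_card_bij[of "UNIV :: 'n set" B] \<open>finite B\<close> by auto
  then have "\<forall>j. \<exists>i<m. A *v b j = \<zeta> ^ i *s b j" using B(1) by (auto simp: bij_betw_def)
  then obtain w where w: "\<And>j. w j < m" "\<And>j. A *v b j = \<zeta> ^ w j *s b j" by metis
  define S where "S = (\<chi> i j. b j $ i)"
  have "columns S = B" using b
    by (auto simp: columns_def column_def S_def bij_betw_def vec_nth_inverse)
  then obtain S' where S': "S ** S' = mat 1"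
    using matrix_right_invertible_span_columns[of S] span by auto
  have "(A ** S) $ i $ j = (S ** (\<chi> i j. if i = j then \<zeta> ^ w j else 0)) $ i $ j" for i j
  proof -
    have "(A ** S) $ i $ j = (A *v b j) $ i"
      by (simp add: matrix_matrix_mult_def matrix_vector_mult_def S_def)
    also have "\<dots> = (\<Sum>k\<in>UNIV. if k = j then b j $ i * \<zeta> ^ w j else 0)"
      by (simp add: w mult.commute)
    also have "\<dots> = (S ** (\<chi> i j. if i = j then \<zeta> ^ w j else 0)) $ i $ j"
      unfolding matrix_matrix_mult_def S_def vec_lambda_beta by (intro sum.cong) auto
    finally show ?thesis .
  qed
  then have "A ** S = S ** (\<chi> i j. if i = j then \<zeta> ^ w j else 0)" by (simp add: vec_eq_iff)
  then show ?thesis using that S' matrix_left_right_inverse1[OF S'] w(1) by blast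
qed

text \<open>Since \<open>\<theta>\<close> has order \<open>m\<close>, the power
  \<open>mpow g m\<close> commutes with all traceless matrices and is a nonzero scalar. Dividing
  \<open>g\<close> by an m-th root of it leaves the conjugation unchanged and gives a matrix with
  m-th power 1, hence diagonalisable with powers of \<open>\<zeta>\<close> as eigenvalues.\<close>

lemma inner_finite_order_normal_form:
  fixes \<theta> :: "'k::{alg_closed_field, field_char_0}^'n::finite^'n \<Rightarrow> 'k^'n^'n"
  assumes inner: "inner_automorphism special_linear \<theta>" and order: "has_order special_linear \<theta> m"
    and \<zeta>: "primitive_root_of_unity m \<zeta>"
  obtains S S' :: "'k^'n^'n" and w :: "'n \<Rightarrow> nat"
  where "S ** S' = mat 1" "S' ** S = mat 1" "\<forall>j. w j < m"
    "\<And>y i. trace y = 0 \<Longrightarrow> (\<And>j k. y $ j $ k \<noteq> 0 \<Longrightarrow> \<zeta> ^ w j = \<zeta> ^ i * \<zeta> ^ w k)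
      \<Longrightarrow> \<theta> (S ** y ** S') = matrix_scale (\<zeta> ^ i) (S ** y ** S')"
proof -
  obtain g g' where g: "g ** g' = mat 1" "\<And>y. trace y = 0 \<Longrightarrow> \<theta> y = g ** y ** g'"
    using inner_group_conjugation inner unfolding inner_automorphism_def by blast
  have g'': "g' ** g = mat 1" using g(1) by (rule matrix_left_right_inverse1)
  have tr: "trace (P ** y ** P') = trace y" if "P' ** P = mat 1" for P P' y :: "'k^'n^'n"
  proof -
    have "trace (P ** y ** P') = trace (P' ** (P ** y))" by (rule trace_mul_sym)
    then show ?thesis by (simp add: matrix_mul_assoc that)
  qed
  \<comment> \<open>Written without inverse powers of \<open>g\<close>, so that for
    \<open>k = m\<close> it is already a commutation relation.\<close>
  have pow: "(\<theta> ^^ k) y ** mpow g k = mpow g k ** y \<and> trace ((\<theta> ^^ k) y) = 0" if "trace y = 0" for k y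
  proof (induction k)
    case (Suc k)
    then have "\<theta> ((\<theta> ^^ k) y) = g ** (\<theta> ^^ k) y ** g'" using g(2) by blast
    moreover have "g ** (\<theta> ^^ k) y ** g' ** mpow g (Suc k) = mpow g (Suc k) ** y"
    proof -
      have "g ** (\<theta> ^^ k) y ** g' ** mpow g (Suc k) = g ** (\<theta> ^^ k) y ** (g' ** g) ** mpow g k"
        by (simp add: matrix_mul_assoc flip: mpow_commute)
      also have "\<dots> = g ** ((\<theta> ^^ k) y ** mpow g k)" by (simp add: g'' flip: matrix_mul_assoc)
      also have "\<dots> = g ** (mpow g k ** y)" using Suc by simp
      also have "\<dots> = mpow g (Suc k) ** y" by (simp add: matrix_mul_assoc mpow_commute)
      finally show ?thesis .
    qed
    ultimately show ?case using Suc tr[OF g''] by simp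
  qed (simp add: that)
  have m: "m > 0" and "\<And>y :: 'k^'n^'n. trace y = 0 \<Longrightarrow> (\<theta> ^^ m) y = y"
    using order by (auto simp: has_order_def)
  then have "mpow g m ** y = y ** mpow g m" if "trace y = 0" for y
    using pow[OF that, of m] that by simp
  then obtain c where c: "mpow g m = mat c" by (rule commutes_traceless_imp_scalar)
  \<comment> \<open>Invertibility of the power, so that the scalar \<open>c\<close> cannot be
    0.\<close>
  have "mpow g k ** mpow g' k = mat 1" for k
  proof (induction k)
    case (Suc k)
    have "mpow g (Suc k) ** mpow g' (Suc k) = mpow g k ** (g ** g') ** mpow g' k"
      by (simp add: matrix_mul_assoc mpow_commute[of g', symmetric] del: mpow_commute)
    then show ?case using Suc by (simp add: g)
  qed simp
  then have "mat c ** mpow g' m = mat 1" using c by metis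
  have "c \<noteq> 0"
  proof
    assume "c = 0"
    then have "mat c = (0 :: 'k^'n^'n)" by (simp add: vec_eq_iff mat_def)
    with \<open>mat c ** mpow g' m = mat 1\<close> have "(0 :: 'k^'n^'n) = mat 1" by simp
    then have "(0 :: 'k^'n^'n) $ i $ i = mat 1 $ i $ i" for i by simp
    then show False by (simp add: mat_def)
  qed
  obtain d where d: "d ^ m = c" using nth_root_exists[OF m] by blast
  have "d \<noteq> 0" using d \<open>c \<noteq> 0\<close> m by (auto simp: power_0_left)
  define A where "A = matrix_scale (1 / d) g"
  have "mpow A m = matrix_scale (1 / d ^ m) (mat c)"
    by (simp add: A_def mpow_scale c power_one_over)
  also have "\<dots> = mat 1" using \<open>c \<noteq> 0\<close> by (simp add: d vec_eq_iff mat_def)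
  finally obtain S S' :: "'k^'n^'n" and w :: "'n \<Rightarrow> nat"
    where S: "S ** S' = mat 1" "S' ** S = mat 1" and w: "\<forall>j. w j < m"
      and AS: "A ** S = S ** (\<chi> i j. if i = j then \<zeta> ^ w j else 0)"
    using root_of_unity_diagonalise[OF _ \<zeta>, of A] by blast
  define D :: "'k^'n^'n" where "D = (\<chi> i j. if i = j then \<zeta> ^ w j else 0)"
  have Dl: "(D ** y) $ j $ k = \<zeta> ^ w j * y $ j $ k" for y j k
  proof -
    have "(D ** y) $ j $ k = (\<Sum>i\<in>UNIV. if i = j then \<zeta> ^ w j * y $ j $ k else 0)"
      unfolding matrix_matrix_mult_def D_def vec_lambda_beta by (intro sum.cong) auto
    then show ?thesis by simp
  qed
  have Dr: "(y ** D) $ j $ k = \<zeta> ^ w k * y $ j $ k" for y j k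
  proof -
    have "(y ** D) $ j $ k = (\<Sum>i\<in>UNIV. if i = k then \<zeta> ^ w k * y $ j $ k else 0)"
      unfolding matrix_matrix_mult_def D_def vec_lambda_beta by (intro sum.cong) auto
    then show ?thesis by simp
  qed
  have g_eq: "g = matrix_scale d A" using \<open>d \<noteq> 0\<close> by (simp add: A_def mat.scale_scale)
  have "\<theta> (S ** y ** S') = matrix_scale (\<zeta> ^ i) (S ** y ** S')"
    if y: "trace y = 0" and supp: "\<And>j k. y $ j $ k \<noteq> 0 \<Longrightarrow> \<zeta> ^ w j = \<zeta> ^ i * \<zeta> ^ w k" for y i
  proof -
    have "D ** y = matrix_scale (\<zeta> ^ i) (y ** D)"
      unfolding vec_eq_iff matrix_scale_nth Dl Dr
    proof (intro allI)
      fix j k show "\<zeta> ^ w j * y $ j $ k = \<zeta> ^ i * (\<zeta> ^ w k * y $ j $ k)"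
        using supp[of j k] by (cases "y $ j $ k = 0") simp_all
    qed
    have "g ** (S ** y ** S') = matrix_scale d ((A ** S) ** y ** S')"
      by (simp add: g_eq mmult_linear matrix_mul_assoc)
    also have "(A ** S) ** y ** S' = S ** (D ** y) ** S'" by (simp add: AS D_def matrix_mul_assoc)
    also have "\<dots> = matrix_scale (\<zeta> ^ i) (S ** y ** (D ** S'))"
      unfolding \<open>D ** y = _\<close> by (simp add: mmult_linear matrix_mul_assoc)
    also have "D ** S' = S' ** A"
    proof -
      have "D ** S' = S' ** (S ** D) ** S'" by (simp add: matrix_mul_assoc S)
      also have "\<dots> = S' ** A ** (S ** S')"
        unfolding D_def AS[symmetric] by (simp add: matrix_mul_assoc)
      finally show ?thesis by (simp add: S)
    qed
    also have "matrix_scale d (matrix_scale (\<zeta> ^ i) (S ** y ** (S' ** A)))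
        = matrix_scale (\<zeta> ^ i) (S ** y ** S' ** g)"
      by (simp add: g_eq mmult_linear matrix_mul_assoc mat.scale_scale mult.commute)
    finally have "g ** (S ** y ** S') ** g' = matrix_scale (\<zeta> ^ i) (S ** y ** S' ** g) ** g'" by simp
    also have "\<dots> = matrix_scale (\<zeta> ^ i) (S ** y ** S' ** (g ** g'))"
      by (simp add: mmult_linear matrix_mul_assoc)
    finally show ?thesis using g(2)[of "S ** y ** S'"] y tr[OF S(2)] by (simp add: g(1))
  qed
  then show ?thesis by (rule that[OF S w])
qed

section \<open>The periodic contraction\<close>

text \<open>For \<open>w\<close> below \<open>m\<close>, this is the residue of
  \<open>w j - w k\<close> modulo \<open>m\<close>. Over the integers it is \<open>w j - w k\<close>
  plus \<open>m\<close> times \<open>wt\<close>.\<close>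

definition cyclic_degree :: "nat \<Rightarrow> ('n \<Rightarrow> nat) \<Rightarrow> 'n \<Rightarrow> 'n \<Rightarrow> nat" where
  "cyclic_degree m w j k = (if w k \<le> w j then w j - w k else m + w j - w k)"

lemma cyclic_degree_less:
  assumes "\<forall>j. w j < m"
  shows "cyclic_degree m w j k < m"
  using spec[OF assms, of j] spec[OF assms, of k] unfolding cyclic_degree_def
    by (simp split: if_splits) linarith

lemma cyclic_degree_power:
  fixes \<zeta> :: "'k::field"
  assumes "\<zeta> ^ m = 1" "\<forall>j. w j < m"
  shows "\<zeta> ^ w j = \<zeta> ^ cyclic_degree m w j k * \<zeta> ^ w k"
proof (cases "w k \<le> w j")
  case True
  then show ?thesis by (simp add: cyclic_degree_def flip: power_add)
next
  case False
  then have "cyclic_degree m w j k + w k = m + w j" using spec[OF assms(2), of k]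
    by (simp add: cyclic_degree_def)
  then show ?thesis using assms(1)
    by (simp add: power_add flip: power_add[of \<zeta> "cyclic_degree m w j k"])
qed

text \<open>The two degrees add up to the degree of the product plus \<open>m\<close> times the
  defect, and the degree of the product is below \<open>m\<close>; so the bound fails exactly when
  the defect is 1.\<close>

lemma cyclic_degree_survives:
  assumes "\<forall>j. w j < m"
  shows "cyclic_degree m w j k + cyclic_degree m w k l \<le> m - 1 \<longleftrightarrow> survives (\<lambda>j. int (w j)) j k l"
  using spec[OF assms, of j] spec[OF assms, of k] spec[OF assms, of l]
  by (auto simp: cyclic_degree_def survives_def wt_def)

text \<open>A product of the entries at \<open>(p, k)\<close> and \<open>(k, q)\<close> comes from
  exactly one pair of degrees, so the double sum only decides whether that product is kept.\<close>

lemma graded_truncation_cmult: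
  fixes X Y :: "'k::field^'n::finite^'n"
  assumes w: "\<forall>j. w j < m"
  defines "gr \<equiv> \<lambda>i. mrestrict (\<lambda>j k. cyclic_degree m w j k = i) :: 'k^'n^'n \<Rightarrow> 'k^'n^'n"
  shows "(\<Sum>i<m. \<Sum>j<m. if i + j \<le> m - 1 then gr i X ** gr j Y else 0) = cmult (\<lambda>j. int (w j)) X Y"
proof -
  let ?d = "cyclic_degree m w"
  have "(\<Sum>i<m. \<Sum>j<m. if i + j \<le> m - 1 then gr i X ** gr j Y else 0) $ p $ q
      = cmult (\<lambda>j. int (w j)) X Y $ p $ q" for p q
  proof -
    have entry: "(if i + j \<le> m - 1 then gr i X ** gr j Y else 0) $ p $ q = (\<Sum>k\<in>UNIV.
        if i = ?d p k then if j = ?d k q then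
          if i + j \<le> m - 1 then X $ p $ k * Y $ k $ q else 0 else 0 else 0)" for i j
    proof (cases "i + j \<le> m - 1")
      case True
      then show ?thesis
        unfolding matrix_matrix_mult_def gr_def if_P[OF True] vec_lambda_beta mrestrict_nth
          by (intro sum.cong) auto
    qed (simp add: sum.neutral)
    have "(\<Sum>i<m. \<Sum>j<m. if i + j \<le> m - 1 then gr i X ** gr j Y else 0) $ p $ q
      = (\<Sum>i<m. \<Sum>j<m. \<Sum>k\<in>UNIV.
        if i = ?d p k then if j = ?d k q then
          if i + j \<le> m - 1 then X $ p $ k * Y $ k $ q else 0 else 0 else 0)"
      unfolding sum_component entry ..
    also have "\<dots> = (\<Sum>i<m. \<Sum>k\<in>UNIV. \<Sum>j<m.
        if i = ?d p k then if j = ?d k q then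
          if i + j \<le> m - 1 then X $ p $ k * Y $ k $ q else 0 else 0 else 0)"
      by (intro sum.cong refl sum.swap)
    also have "\<dots> = (\<Sum>k\<in>UNIV. \<Sum>i<m. \<Sum>j<m.
        if i = ?d p k then if j = ?d k q then
          if i + j \<le> m - 1 then X $ p $ k * Y $ k $ q else 0 else 0 else 0)"
      by (rule sum.swap)
    also have "\<dots> = (\<Sum>k\<in>UNIV. if ?d p k + ?d k q \<le> m - 1 then X $ p $ k * Y $ k $ q else 0)"
    proof (intro sum.cong refl)
      fix k
      have "(\<Sum>i<m. \<Sum>j<m.
          if i = ?d p k then if j = ?d k q then
            if i + j \<le> m - 1 then X $ p $ k * Y $ k $ q else 0 else 0 else 0)
        = (\<Sum>i<m. if i = ?d p k then \<Sum>j<m. if j = ?d k q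
          then if ?d p k + ?d k q \<le> m - 1 then X $ p $ k * Y $ k $ q else 0 else 0 else 0)"
        by (intro sum.cong refl) (auto intro!: sum.cong)
      also have "\<dots> = (if ?d p k + ?d k q \<le> m - 1 then X $ p $ k * Y $ k $ q else 0)"
        using cyclic_degree_less[OF w] by simp
      finally show "(\<Sum>i<m. \<Sum>j<m.
          if i = ?d p k then if j = ?d k q then
            if i + j \<le> m - 1 then X $ p $ k * Y $ k $ q else 0 else 0 else 0)
        = (if ?d p k + ?d k q \<le> m - 1 then X $ p $ k * Y $ k $ q else 0)" .
    qed
    finally show ?thesis unfolding cmult_nth cyclic_degree_survives[OF w] .
  qed
  then show ?thesis by (simp add: vec_eq_iff)
qed

section \<open>Homogeneous components and transport of structure\<close>

lemma eigen_components_eqI: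
  assumes L: "lie_algebra L" and aut: "lie_automorphism L \<phi>"
    and prim: "primitive_root_of_unity m \<zeta>"
    and c: "\<And>i. i < m \<Longrightarrow> c i \<in> eigen_part L \<phi> \<zeta> i" "\<And>i. m \<le> i \<Longrightarrow> c i = 0" "(\<Sum>i<m. c i) = x"
  shows "eigen_components L \<phi> \<zeta> m x = c"
  unfolding eigen_components_def
proof (rule the_equality)
  interpret lie_algebra L by (rule L)
  interpret V: vector_space "lscale L" by (rule vector_space)
  show "(\<forall>i<m. c i \<in> eigen_part L \<phi> \<zeta> i) \<and> (\<forall>i\<ge>m. c i = 0) \<and> (\<Sum>i<m. c i) = x"
    using c by blast
  fix b assume b: "(\<forall>i<m. b i \<in> eigen_part L \<phi> \<zeta> i) \<and> (\<forall>i\<ge>m. b i = 0) \<and> (\<Sum>i<m. b i) = x"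
  have diff: "u - v \<in> eigen_part L \<phi> \<zeta> j"
    if uv: "u \<in> eigen_part L \<phi> \<zeta> j" "v \<in> eigen_part L \<phi> \<zeta> j" for u v j
  proof -
    have mem: "u \<in> lcarrier L" "v \<in> lcarrier L" "u - v \<in> lcarrier L"
      using uv V.subspace_diff[OF subspace] by (auto simp: eigen_part_def)
    then have "\<phi> ((u - v) + v) = \<phi> (u - v) + \<phi> v"
      using aut unfolding lie_automorphism_def lie_iso_def by blast
    with uv mem show ?thesis
      by (simp add: eigen_part_def V.scale_right_diff_distrib algebra_simps)
  qed
  define e where "e i = b i - c i" for i
  have "e i \<in> eigen_part L \<phi> \<zeta> i" if "i < m" for i
    unfolding e_def using b c(1) that by (intro diff) auto
  moreover have "(\<Sum>i<m. e i) = 0"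
    unfolding e_def sum_subtractf using b c(3) by simp
  ultimately have zero: "b i - c i = 0" if "i < m" for i
    using eigen_parts_independent[OF L aut prim, of m e i] that by (simp add: e_def)
  show "b = c"
  proof
    fix i show "b i = c i" using zero[of i] b c(2)[of i] by (cases "i < m") auto
  qed
qed

text \<open>A parabolic contraction is by definition a Lie algebra, so the axioms are due for the
  periodic contraction too. They are carried over from the matrix model instead of being derived
  from the formula with eigencomponents.\<close>

lemma lie_algebra_transport:
  assumes L: "lie_algebra L" and f: "lie_iso L M f"
    and M: "vector_space (lscale M)" "module.subspace (lscale M) (lcarrier M)"
  shows "lie_algebra M"
proof -
  interpret L: lie_algebra L by (rule L)
  interpret V: vector_space "lscale L" by (rule L.vector_space)
  have add: "\<And>x y. x \<in> lcarrier L \<Longrightarrow> y \<in> lcarrier L \<Longrightarrow> f (x + y) = f x + f y"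
    and scale: "\<And>c x. x \<in> lcarrier L \<Longrightarrow> f (lscale L c x) = lscale M c (f x)"
    and br: "\<And>x y. x \<in> lcarrier L \<Longrightarrow> y \<in> lcarrier L \<Longrightarrow> lbracket M (f x) (f y) = f (lbracket L x y)"
    and img: "lcarrier M = f ` lcarrier L"
    using f by (auto simp: lie_iso_def bij_betw_def)
  have mem: "x + y \<in> lcarrier L" "lscale L c x \<in> lcarrier L" "lbracket L x y \<in> lcarrier L"
    if "x \<in> lcarrier L" "y \<in> lcarrier L" for x y c
    using that L.subspace L.closed by (auto intro: V.subspace_add V.subspace_scale)
  have 0: "0 \<in> lcarrier L" using L.subspace by (rule V.subspace_0)
  have f0: "f 0 = 0" using add[OF 0 0] by simp
  show ?thesis
  proof (rule lie_algebra.intro, unfold img)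
    show "vector_space (lscale M)" by (rule M)
    show "module.subspace (lscale M) (f ` lcarrier L)" using M(2) by (simp only: img)
  next
    fix x y assume "x \<in> f ` lcarrier L" "y \<in> f ` lcarrier L"
    then show "lbracket M x y \<in> f ` lcarrier L" using br mem by auto
  next
    fix x y z assume "x \<in> f ` lcarrier L" "y \<in> f ` lcarrier L" "z \<in> f ` lcarrier L"
    then obtain x' y' z' where *: "x = f x'" "y = f y'" "z = f z'"
      "x' \<in> lcarrier L" "y' \<in> lcarrier L" "z' \<in> lcarrier L" by blast
    show "lbracket M (x + y) z = lbracket M x z + lbracket M y z"
      using * by (simp add: br mem L.add_left flip: add)
    show "lbracket M x (y + z) = lbracket M x y + lbracket M x z"
      using * by (simp add: br mem L.add_right flip: add)
    show "lbracket M x (lbracket M y z)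
        + lbracket M y (lbracket M z x) + lbracket M z (lbracket M x y) = 0"
      using * L.jacobi[of x' y' z'] by (simp add: br mem f0 flip: add)
  next
    fix x y c assume "x \<in> f ` lcarrier L" "y \<in> f ` lcarrier L"
    then obtain x' y' where *: "x = f x'" "y = f y'" "x' \<in> lcarrier L" "y' \<in> lcarrier L" by blast
    show "lbracket M (lscale M c x) y = lscale M c (lbracket M x y)"
      using * by (simp add: br mem L.scale_left flip: scale)
    show "lbracket M x (lscale M c y) = lscale M c (lbracket M x y)"
      using * by (simp add: br mem L.scale_right flip: scale)
  next
    fix x assume "x \<in> f ` lcarrier L"
    then show "lbracket M x x = 0" using br L.alternating f0 by auto
  qed
qed

lemma periodic_contraction_normal_form:
  fixes \<theta> :: "'k::{alg_closed_field, field_char_0}^'n::finite^'n \<Rightarrow> 'k^'n^'n"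
  assumes inner: "inner_automorphism special_linear \<theta>" and order: "has_order special_linear \<theta> m"
    and \<zeta>: "primitive_root_of_unity m \<zeta>"
  obtains S S' :: "'k^'n^'n" and a :: "'n \<Rightarrow> int"
  where "S ** S' = mat 1" "S' ** S = mat 1"
    "\<And>X Y. trace X = 0 \<Longrightarrow> trace Y = 0 \<Longrightarrow>
      lbracket (periodic_contraction special_linear \<theta> \<zeta> m) (S ** X ** S') (S ** Y ** S')
        = S ** cbracket a X Y ** S'"
proof -
  obtain S S' :: "'k^'n^'n" and w :: "'n \<Rightarrow> nat"
    where S: "S ** S' = mat 1" "S' ** S = mat 1" and w: "\<forall>j. w j < m"
      and eig: "\<And>y i. trace y = 0 \<Longrightarrow> (\<And>j k. y $ j $ k \<noteq> 0 \<Longrightarrow> \<zeta> ^ w j = \<zeta> ^ i * \<zeta> ^ w k)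
        \<Longrightarrow> \<theta> (S ** y ** S') = matrix_scale (\<zeta> ^ i) (S ** y ** S')"
    using inner_finite_order_normal_form[OF inner order \<zeta>] by blast
  have aut: "lie_automorphism special_linear \<theta>" using inner by (simp add: inner_automorphism_def)
  have \<zeta>m: "\<zeta> ^ m = 1" "m > 0" using \<zeta> by (auto simp: primitive_root_of_unity_def)
  define gr :: "nat \<Rightarrow> 'k^'n^'n \<Rightarrow> 'k^'n^'n" where
    "gr i X = mrestrict (\<lambda>j k. cyclic_degree m w j k = i) X" for i X
  have tr: "trace (S ** y ** S') = trace y" for y
  proof -
    have "trace (S ** y ** S') = trace (S' ** (S ** y))" by (rule trace_mul_sym)
    then show ?thesis by (simp add: matrix_mul_assoc S)
  qed
  \<comment> \<open>The whole diagonal lies in degree 0, and the other components have zero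
    diagonal.\<close>
  have trgr: "trace (gr i X) = 0" if "trace X = 0" for i X
  proof (cases "i = 0")
    case True
    then show ?thesis using that by (simp add: gr_def trace_mrestrict_reflexive cyclic_degree_def)
  next
    case False
    then show ?thesis by (simp add: gr_def trace_mrestrict_irreflexive cyclic_degree_def)
  qed
  have comp: "eigen_components special_linear \<theta> \<zeta> m (S ** X ** S') = (\<lambda>i. S ** gr i X ** S')"
    if X: "trace X = 0" for X
  proof (rule eigen_components_eqI[OF lie_algebra_special_linear aut \<zeta>])
    fix i
    have "\<zeta> ^ w j = \<zeta> ^ i * \<zeta> ^ w k" if "gr i X $ j $ k \<noteq> 0" for j k
      using that cyclic_degree_power[OF \<zeta>m(1) w, of j k] by (simp add: gr_def split: if_splits)
    then show "S ** gr i X ** S' \<in> eigen_part special_linear \<theta> \<zeta> i"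
      using eig[OF trgr[OF X], of i] trgr[OF X] by (simp add: eigen_part_def tr)
  next
    fix i assume "m \<le> i"
    then have "gr i X = 0"
      using cyclic_degree_less[OF w] by (auto simp: gr_def vec_eq_iff not_le[symmetric])
    then show "S ** gr i X ** S' = 0" by simp
  next
    have "(\<Sum>i<m. gr i X) $ j $ k = X $ j $ k" for j k
      using cyclic_degree_less[OF w] by (simp add: sum_component gr_def)
    then have "(\<Sum>i<m. gr i X) = X" by (simp add: vec_eq_iff)
    then show "(\<Sum>i<m. S ** gr i X ** S') = S ** X ** S'"
      using mats.linear_sum[OF mat_linear_mult[of S S'], of "\<lambda>i. gr i X" "{..<m}"] by simp
  qed
  define a where "a j = int (w j)" for j
  have "lbracket (periodic_contraction special_linear \<theta> \<zeta> m) (S ** X ** S') (S ** Y ** S')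
      = S ** cbracket a X Y ** S'" if "trace X = 0" "trace Y = 0" for X Y
  proof -
    have prod: "(S ** P ** S') ** (S ** Q ** S') = S ** (P ** Q) ** S'" for P Q
    proof -
      have "(S ** P ** S') ** (S ** Q ** S') = S ** P ** (S' ** S) ** Q ** S'"
        by (simp add: matrix_mul_assoc)
      then show ?thesis by (simp add: S matrix_mul_assoc)
    qed
    have "lbracket (periodic_contraction special_linear \<theta> \<zeta> m) (S ** X ** S') (S ** Y ** S')
      = (\<Sum>i<m. \<Sum>j<m. if i + j \<le> m - 1 then S ** (gr i X ** gr j Y - gr j Y ** gr i X) ** S' else 0)"
      by (simp add: periodic_contraction_def comp[OF that(1)] comp[OF that(2)] prod mmult_linear cong: if_cong)
    also have "\<dots> = (\<Sum>i<m. \<Sum>j<m. S ** ((if i + j \<le> m - 1 then gr i X ** gr j Y else 0)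
        - (if i + j \<le> m - 1 then gr j Y ** gr i X else 0)) ** S')"
      by (intro sum.cong refl) simp
    also have "\<dots> = S ** (\<Sum>i<m. \<Sum>j<m. (if i + j \<le> m - 1 then gr i X ** gr j Y else 0)
        - (if i + j \<le> m - 1 then gr j Y ** gr i X else 0)) ** S'"
      by (simp only: mats.linear_sum[OF mat_linear_mult])
    \<comment> \<open>The summations of the second part are exchanged, so that its outer index
      grades the left factor \<open>Y\<close> and the truncation formula applies to it as
      well.\<close>
    also have "(\<Sum>i<m. \<Sum>j<m. (if i + j \<le> m - 1 then gr i X ** gr j Y else 0)
        - (if i + j \<le> m - 1 then gr j Y ** gr i X else 0))
      = (\<Sum>i<m. \<Sum>j<m. if i + j \<le> m - 1 then gr i X ** gr j Y else 0)
        - (\<Sum>j<m. \<Sum>i<m. if j + i \<le> m - 1 then gr j Y ** gr i X else 0)"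
      unfolding sum_subtractf by (subst (2) sum.swap) (simp only: add.commute)
    also have "\<dots> = cbracket a X Y"
      unfolding gr_def graded_truncation_cmult[OF w] cbracket_def a_def ..
    finally show ?thesis .
  qed
  then show ?thesis using that[OF S] by blast
qed

theorem proposition4p10:
  fixes \<theta> :: "'k::{alg_closed_field, field_char_0}^'n^'n \<Rightarrow> 'k^'n^'n"
    and \<zeta> :: 'k and l m :: nat
  assumes "l \<ge> 1" and "CARD('n) = l + 1"
    and "inner_automorphism special_linear \<theta>"
    and "has_order special_linear \<theta> m"
    and "primitive_root_of_unity m \<zeta>"
  shows "is_parabolic_contraction (special_linear :: ('k, 'k^'n^'n) lie_struct)
           (periodic_contraction special_linear \<theta> \<zeta> m)
         \<and> lie_index (periodic_contraction special_linear \<theta> \<zeta> m)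
             = lie_index (special_linear :: ('k, 'k^'n^'n) lie_struct)
         \<and> lie_index (special_linear :: ('k, 'k^'n^'n) lie_struct) = l"
proof -
  let ?Q = "periodic_contraction special_linear \<theta> \<zeta> m"
  obtain S S' :: "'k^'n^'n" and a :: "'n \<Rightarrow> int"
    where S: "S ** S' = mat 1" "S' ** S = mat 1"
      and br: "\<And>X Y. trace X = 0 \<Longrightarrow> trace Y = 0 \<Longrightarrow>
        lbracket ?Q (S ** X ** S') (S ** Y ** S') = S ** cbracket a X Y ** S'"
    using periodic_contraction_normal_form[OF assms(3-5)] by blast
  let ?f = "\<lambda>X. S ** X ** S'" and ?g = "\<lambda>X. S' ** X ** S"
  have Q: "lcarrier ?Q = {A. trace A = 0}" "lscale ?Q = matrix_scale"
    by (simp_all add: periodic_contraction_def)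
  have conj: "P' ** (P ** X ** P') ** P = X" if "P' ** P = mat 1" for P P' X :: "'k^'n^'n"
  proof -
    have "P' ** (P ** X ** P') ** P = (P' ** P) ** X ** (P' ** P)" by (simp add: matrix_mul_assoc)
    then show ?thesis by (simp add: that)
  qed
  have tr: "trace (P ** y ** P') = trace y" if "P' ** P = mat 1" for P P' y :: "'k^'n^'n"
  proof -
    have "trace (P ** y ** P') = trace (P' ** (P ** y))" by (rule trace_mul_sym)
    then show ?thesis by (simp add: matrix_mul_assoc that)
  qed
  have bij: "bij_betw ?f {A. trace A = 0} {A. trace A = 0}"
    by (rule bij_betw_byWitness[where f' = ?g]) (auto simp: conj S tr)
  have iso: "lie_iso (contraction a) ?Q ?f"
    unfolding lie_iso_def contraction_simps Q
    using bij br
    by (simp add: mat_linear_add[OF mat_linear_mult] mat_linear_scale[OF mat_linear_mult])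
  have alg: "lie_algebra ?Q"
    by (rule lie_algebra_transport[OF lie_algebra_contraction iso])
      (simp_all add: Q mat.vector_space_axioms subspace_trace_zero)
  have "lie_index (contraction a :: ('k, 'k^'n^'n) lie_struct) = lie_index ?Q"
  proof (rule lie_index_transport[where f = ?f and g = ?g])
    show "?f ` lcarrier (contraction a) = lcarrier ?Q"
      using bij unfolding Q contraction_simps bij_betw_def by blast
  qed (simp_all add: Q mat_linear_mult conj S br)
  moreover have "lie_index (special_linear :: ('k, 'k^'n^'n) lie_struct) = CARD('n) - 1"
    using lie_index_contraction[of "\<lambda>_ :: 'n. 0"] by (simp only: contraction_const)
  moreover have "lie_index (contraction a :: ('k, 'k^'n^'n) lie_struct) = CARD('n) - 1"
    by (rule lie_index_contraction)
  ultimately show ?thesis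
    using is_parabolic_contraction_of_iso[OF alg iso] assms(2) by simp
qed

end
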